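(* Let $A_1$ and $A_2$ be unital $C^*$-algebras, let $p$ be a positive real number, and let $\phi\colon A_{1+}\to A_{2+}$ be a surjection. The following are equivalent: (i) there exists a Jordan $*$-isomorphism $J\colon A_1\to A_2$ such that $\phi=J$ on $A_{1+}$; (ii) $\|\phi(x)\phi(y)\|=\|xy\|$ for all $x,y\in A_{1+}$; (iii) $\|\phi(x)\phi(y)\|_S=\|xy\|_S$ for all $x,y\in A_{1+}$; (iv) $\sigma(\phi(x)\phi(y))=\sigma(xy)$ for all $x,y\in A_{1+}$; (v) $\|(\phi(x)^{p/2}\phi(y)^p\phi(x)^{p/2})^{1/p}\|=\|(x^{p/2}y^px^{p/2})^{1/p}\|$ for all $x,y\in A_{1+}$.
   Context: For a unital $C^*$-algebra $A$ (unit always denoted $e$), $A_+$ denotes the positive semidefinite cone of $A$, i.e. the set of all positive elements $a\ge 0$ of $A$ (not necessarily invertible); $A_{j+}$ denotes this cone for $A=A_j$. $\sigma(a)$ is the spectrum of $a\in A$, and $\|a\|_S=\sup\{|t|\colon t\in\sigma(a)\}$ is the spectral seminorm. Positive real powers of positive elements are taken via continuous functional calculus. A Jordan $*$-isomorphism $J\colon A_1\to A_2$ is a complex linear bijection that preserves the Jordan product $(ab+ba)/2$ and the involution. *)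

theory Defs
  imports "HOL-Analysis.Analysis"
begin

text \<open>
  Unital C*-algebras. The norm is submultiplicative, and \<open>norm 1 = 1\<close>, by
  \<^class>\<open>real_normed_algebra_1\<close>; in particular the algebra is not the zero algebra,
  as is implicit in taking suprema over spectra. Completeness is \<^class>\<open>banach\<close>.
\<close>

class unital_cstar_algebra = real_normed_algebra_1 + banach +
  fixes scaleC :: "complex \<Rightarrow> 'a \<Rightarrow> 'a"  (infixr "*\<^sub>C" 75)
    and star :: "'a \<Rightarrow> 'a"
  assumes scaleC_add_right: "c *\<^sub>C (x + y) = c *\<^sub>C x + c *\<^sub>C y"
    and scaleC_add_left: "(c + d) *\<^sub>C x = c *\<^sub>C x + d *\<^sub>C x"
    and scaleC_scaleC: "c *\<^sub>C (d *\<^sub>C x) = (c * d) *\<^sub>C x"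
    and scaleC_of_real: "complex_of_real r *\<^sub>C x = r *\<^sub>R x"
    and mult_scaleC_left: "(c *\<^sub>C x) * y = c *\<^sub>C (x * y)"
    and mult_scaleC_right: "x * (c *\<^sub>C y) = c *\<^sub>C (x * y)"
    and norm_scaleC: "norm (c *\<^sub>C x) = cmod c * norm x"
    and star_star: "star (star x) = x"
    and star_add: "star (x + y) = star x + star y"
    and star_scaleC: "star (c *\<^sub>C x) = cnj c *\<^sub>C star x"
    and star_mult: "star (x * y) = star y * star x"
    and cstar_identity: "norm (star x * x) = (norm x)\<^sup>2"

definition invertible_elem :: "'a::monoid_mult \<Rightarrow> bool" where
  "invertible_elem x \<longleftrightarrow> (\<exists>y. x * y = 1 \<and> y * x = 1)"

definition spectrum :: "'a::unital_cstar_algebra \<Rightarrow> complex set" where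
  "spectrum x = {z. \<not> invertible_elem (x - z *\<^sub>C 1)}"

definition spectral_seminorm :: "'a::unital_cstar_algebra \<Rightarrow> real" where
  "spectral_seminorm x = (SUP z\<in>spectrum x. cmod z)"

definition pos_cone :: "'a::unital_cstar_algebra set" where
  "pos_cone = {x. star x = x \<and> (\<forall>z\<in>spectrum x. z \<in> \<real> \<and> 0 \<le> Re z)}"

text \<open>
  \<open>is_cfc a \<Phi>\<close>: on the functions continuous on the spectrum of \<open>a\<close>, \<open>\<Phi>\<close> is the continuous
  functional calculus of \<open>a\<close>, that is, the isometric unital *-homomorphism
  \<open>C(\<sigma>(a)) \<rightarrow> A\<close> sending the identity function to \<open>a\<close>. A function on the spectrum is
  represented by any extension to the complex plane; by the isometry clause \<open>\<Phi>\<close> does not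
  depend on the extension. For normal \<open>a\<close> such a \<open>\<Phi>\<close> exists and its values on continuous
  functions are uniquely determined.
\<close>

definition is_cfc ::
    "'a::unital_cstar_algebra \<Rightarrow> ((complex \<Rightarrow> complex) \<Rightarrow> 'a) \<Rightarrow> bool" where
  "is_cfc a \<Phi> \<longleftrightarrow>
     (\<forall>f g. continuous_on (spectrum a) f \<longrightarrow> continuous_on (spectrum a) g \<longrightarrow>
        \<Phi> (\<lambda>z. f z + g z) = \<Phi> f + \<Phi> g \<and> \<Phi> (\<lambda>z. f z * g z) = \<Phi> f * \<Phi> g) \<and>
     (\<forall>f c. continuous_on (spectrum a) f \<longrightarrow>
        \<Phi> (\<lambda>z. c * f z) = c *\<^sub>C \<Phi> f \<and>
        \<Phi> (\<lambda>z. cnj (f z)) = star (\<Phi> f) \<and>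
        norm (\<Phi> f) = (SUP z\<in>spectrum a. cmod (f z))) \<and>
     \<Phi> (\<lambda>z. 1) = 1 \<and> \<Phi> (\<lambda>z. z) = a"

definition cfc :: "'a::unital_cstar_algebra \<Rightarrow> (complex \<Rightarrow> complex) \<Rightarrow> 'a" where
  "cfc a f = (THE b. \<exists>\<Phi>. is_cfc a \<Phi> \<and> \<Phi> f = b)"

text \<open>Real powers \<open>a\<^sup>r\<close>, meant for positive \<open>a\<close> and \<open>r > 0\<close>; recall \<open>0 powr r = 0\<close>.\<close>

definition pos_powr :: "'a::unital_cstar_algebra \<Rightarrow> real \<Rightarrow> 'a" where
  "pos_powr a r = cfc a (\<lambda>z. complex_of_real (Re z powr r))"

definition jordan_star_iso ::
    "('a::unital_cstar_algebra \<Rightarrow> 'b::unital_cstar_algebra) \<Rightarrow> bool" where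
  "jordan_star_iso J \<longleftrightarrow>
     Vector_Spaces.linear scaleC scaleC J \<and> bij J \<and>
     (\<forall>x y. J ((1/2) *\<^sub>C (x * y + y * x)) = (1/2) *\<^sub>C (J x * J y + J y * J x)) \<and>
     (\<forall>x. J (star x) = star (J x))"

end

theory Submission
  imports Defs "HOL-Computational_Algebra.Fundamental_Theorem_Algebra"
begin

text \<open>
  For \<open>x, y \<ge> 0\<close> the numbers in (ii), (iii) and (v) are powers of \<open>r(x\<^sup>q y\<^sup>q)\<close>, with \<open>r\<close> the spectral
  radius and \<open>q = 2\<close>, \<open>1\<close>, \<open>p\<close>. Hence each of them says that \<open>\<psi>(x) = \<phi>(x\<^sup>1\<^sup>/\<^sup>q)\<^sup>q\<close> preserves \<open>r(x y)\<close>.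
  Such a \<open>\<psi>\<close> is a positively homogeneous order isomorphism with \<open>\<psi>(1) = 1\<close>, thus an isometry for the
  Thompson metric on the invertible positive elements. As in the proof of the Mazur-Ulam theorem, it
  commutes with the reflections \<open>x \<mapsto> m x\<^sup>-\<^sup>1 m\<close>, so \<open>\<psi>(m x m) = \<psi>(m) \<psi>(x) \<psi>(m)\<close>. Comparing first-order
  terms at \<open>1\<close> in this identity, \<open>\<psi>\<close> has an additive derivative \<open>T\<close> there, which is a unital order
  isomorphism between the selfadjoint parts. Kadison's inequality for \<open>T\<close> and its inverse gives
  \<open>T(h\<^sup>2) = T(h)\<^sup>2\<close>, and writing \<open>x\<close> as \<open>(1 + h)\<^sup>N\<close> with \<open>h\<close> of order \<open>1/N\<close> gives \<open>\<psi> = T\<close>.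
\<close>

section \<open>Algebra, spectrum and square roots\<close>

text \<open>The pairing r(x y) sees the order because r(x y^-1) <= t means x <= t y, so testing
  against inverses recovers \<open>\<preceq>\<close>; this also makes \<open>\<psi>\<close>
  injective, which is not among the hypotheses. The obstacle is that \<open>\<psi>\<close> is only a
  map of cones, with no additivity or continuity given. The reflections supply the algebra: for h, k
  of size d one has (1+h)(1+k)(1+h) = 1 + 2h + k + O(d^2), so the triple identity makes
  \<open>\<psi>\<close> additive at 1 up to a quadratic error, and such an error disappears on
  rescaling. The same error bound shows that the derivative of the inverse map is the inverse of T.
  Reflections see only invertible elements; singular ones are reached through x + e with e -> 0, by
  order alone. Condition (iv) is placed between (i) and (iii): a Jordan isomorphism preserves the
  spectrum of x y for positive x, y, and the spectrum determines the spectral seminorm. The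
  C*-algebra background rests on an iteration for the square root of 1 - k; from it follows that a
  selfadjoint element attains its norm on its spectrum, which turns positivity into a norm
  condition.\<close>

lemma scaleC_one [simp]: "1 *\<^sub>C x = x"
  using scaleC_of_real[of 1 x] by simp

lemma scaleC_zero_right [simp]: "c *\<^sub>C 0 = 0"
  using scaleC_add_right[of c 0 0] by simp

lemma scaleC_zero_left [simp]: "0 *\<^sub>C x = 0"
  using scaleC_add_left[of 0 0 x] by simp

lemma scaleC_minus_left [simp]: "(- c) *\<^sub>C x = - (c *\<^sub>C x)"
  using scaleC_add_left[of c "- c" x] by (simp add: minus_unique[symmetric] eq_neg_iff_add_eq_0 add.commute)

lemma scaleC_minus_right [simp]: "c *\<^sub>C (- x) = - (c *\<^sub>C x)"
  using scaleC_add_right[of c x "- x"] by (simp add: eq_neg_iff_add_eq_0 add.commute)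

lemma scaleC_diff_left: "(c - d) *\<^sub>C x = c *\<^sub>C x - d *\<^sub>C x"
  using scaleC_add_left[of c "- d" x] by simp

lemma scaleC_diff_right: "c *\<^sub>C (x - y) = c *\<^sub>C x - c *\<^sub>C y"
  using scaleC_add_right[of c x "- y"] by simp

lemma vector_space_scaleC: "vector_space (scaleC :: complex \<Rightarrow> 'a::unital_cstar_algebra \<Rightarrow> 'a)"
  by unfold_locales (simp_all add: scaleC_add_right scaleC_add_left scaleC_scaleC)

lemma scaleC_scaleR: "c *\<^sub>C (r *\<^sub>R x) = r *\<^sub>R (c *\<^sub>C x)"
  by (simp add: scaleC_of_real[symmetric] scaleC_scaleC mult.commute)

lemma scaleC_mult_scaleC: "(c *\<^sub>C x) * (d *\<^sub>C y) = (c * d) *\<^sub>C (x * y)"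
  by (simp add: mult_scaleC_left mult_scaleC_right scaleC_scaleC mult.commute)

lemma star_zero [simp]: "star 0 = 0"
  using star_scaleC[of 0 "0"] by simp

lemma star_one [simp]: "star 1 = (1 :: 'a::unital_cstar_algebra)"
  using star_mult[of "star (1::'a)" 1] by (simp add: star_star)

lemma star_minus [simp]: "star (- x) = - star x"
  using star_scaleC[of "-1" x] by simp

lemma star_diff: "star (x - y) = star x - star y"
  using star_add[of x "- y"] by simp

lemma star_scaleR: "star (r *\<^sub>R x) = r *\<^sub>R star x"
  using star_scaleC[of "complex_of_real r" x] by (simp add: scaleC_of_real)

lemma star_power: "star (x ^ n) = star x ^ n"
  by (induction n) (simp_all add: star_mult power_commutes)

lemma norm_star [simp]: "norm (star x) = norm (x :: 'a::unital_cstar_algebra)"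
proof -
  have le: "norm y \<le> norm (star y)" for y :: 'a
  proof (cases "norm y = 0")
    case False
    have "(norm y)\<^sup>2 \<le> norm (star y) * norm y"
      using cstar_identity[of y] norm_mult_ineq[of "star y" y] by simp
    then show ?thesis using False by (simp add: power2_eq_square)
  qed simp
  show ?thesis using le[of x] le[of "star x"] by (simp add: star_star)
qed

lemma bounded_linear_star: "bounded_linear star"
  by (rule bounded_linear_intro[where K = 1]) (simp_all add: star_add star_scaleR)

definition selfadjoint :: "'a::unital_cstar_algebra \<Rightarrow> bool" where
  "selfadjoint x \<longleftrightarrow> star x = x"

lemma selfadjoint_simps [simp]:
  "selfadjoint 0" "selfadjoint 1" "selfadjoint (star x * x)" "selfadjoint (x * star x)"
  by (simp_all add: selfadjoint_def star_mult star_star)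

lemma selfadjoint_intros [simp]:
  assumes "selfadjoint x"
  shows "selfadjoint (r *\<^sub>R x)" "selfadjoint (- x)" "selfadjoint (x * x)" "selfadjoint (x ^ n)"
  using assms by (simp_all add: selfadjoint_def star_scaleR star_mult star_power)

lemma selfadjoint_intros2 [simp]:
  assumes "selfadjoint x" "selfadjoint y"
  shows "selfadjoint (x + y)" "selfadjoint (x - y)" "selfadjoint (x * y * x)"
  using assms by (simp_all add: selfadjoint_def star_add star_diff star_mult mult.assoc)

lemma selfadjoint_mult: "selfadjoint x \<Longrightarrow> selfadjoint y \<Longrightarrow> x * y = y * x \<Longrightarrow> selfadjoint (x * y)"
  by (simp add: selfadjoint_def star_mult)

lemma selfadjoint_norm_mult: "selfadjoint x \<Longrightarrow> norm (x * x) = (norm x)\<^sup>2"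
  using cstar_identity[of x] by (simp add: selfadjoint_def)

lemma selfadjoint_LIMSEQ:
  assumes "\<And>n. selfadjoint (X n)" "X \<longlonglongrightarrow> x" shows "selfadjoint x"
  using bounded_linear.tendsto[OF bounded_linear_star assms(2)] assms LIMSEQ_unique
  by (auto simp: selfadjoint_def)

section \<open>Inverses\<close>

definition inv_elem :: "'a::monoid_mult \<Rightarrow> 'a" where
  "inv_elem x = (THE y. x * y = 1 \<and> y * x = 1)"

lemma invertible_elemI: "x * y = 1 \<Longrightarrow> y * x = 1 \<Longrightarrow> invertible_elem x"
  by (auto simp: invertible_elem_def)

lemma inv_elem_unique:
  assumes "x * y = 1" "y * x = 1" shows "inv_elem x = y"
  unfolding inv_elem_def
proof (rule the_equality)
  fix z assume "x * z = 1 \<and> z * x = 1"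
  then show "z = y" using assms by (metis mult.assoc mult_1_left mult_1_right)
qed (use assms in simp)

lemma inv_elem:
  assumes "invertible_elem x"
  shows "x * inv_elem x = 1" "inv_elem x * x = 1"
  using assms inv_elem_unique unfolding invertible_elem_def by metis+

lemma invertible_inv_elem: "invertible_elem x \<Longrightarrow> invertible_elem (inv_elem x)"
  using inv_elem invertible_elemI by metis

lemma inv_elem_inv_elem: "invertible_elem x \<Longrightarrow> inv_elem (inv_elem x) = x"
  by (simp add: inv_elem inv_elem_unique)

lemma invertible_one [simp]: "invertible_elem 1"
  by (auto simp: invertible_elem_def)

lemma inv_elem_one [simp]: "inv_elem 1 = 1"
  by (rule inv_elem_unique) auto

lemma inv_elem_mult_cancel [simp]:
  assumes "invertible_elem x"
  shows "x * (inv_elem x * y) = y" "inv_elem x * (x * y) = y"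
  using inv_elem[OF assms] by (metis mult.assoc mult_1_left)+

lemma invertible_two_sided:
  assumes "x * y = 1" "z * x = 1" shows "invertible_elem x"
proof -
  have "z = y" using assms by (metis mult.assoc mult_1_left mult_1_right)
  then show ?thesis using assms by (auto simp: invertible_elem_def)
qed

lemma invertible_mult:
  assumes "invertible_elem x" "invertible_elem y" shows "invertible_elem (x * y)"
  by (rule invertible_elemI[where y = "inv_elem y * inv_elem x"])
     (simp_all add: assms mult.assoc inv_elem)

text \<open>Commutation turns the inverse of the product into both a right and a left inverse of the
  factor. Used to show that a polynomial in \<open>a\<close> that has a singular linear factor is
  singular.\<close>

lemma invertible_commute_left:
  assumes "invertible_elem (x * y)" "x * y = y * x" shows "invertible_elem x"
proof (rule invertible_two_sided)
  show "x * (y * inv_elem (x * y)) = 1" using inv_elem(1)[OF assms(1)] by (simp add: mult.assoc)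
  show "(inv_elem (x * y) * y) * x = 1" using inv_elem(2)[OF assms(1)] by (simp add: assms(2) mult.assoc)
qed

lemma inv_elem_commute:
  assumes "invertible_elem x" "c * x = x * c" shows "c * inv_elem x = inv_elem x * c"
proof -
  have "c * inv_elem x = inv_elem x * (x * c) * inv_elem x" by (simp add: assms(1) mult.assoc[symmetric] inv_elem)
  also have "\<dots> = inv_elem x * c" unfolding assms(2)[symmetric] by (simp add: mult.assoc inv_elem assms(1))
  finally show ?thesis .
qed

lemma invertible_scaleC: "c \<noteq> 0 \<Longrightarrow> invertible_elem x \<Longrightarrow> invertible_elem (c *\<^sub>C x)"
  by (rule invertible_elemI[where y = "inverse c *\<^sub>C inv_elem x"])
     (simp_all add: scaleC_mult_scaleC inv_elem)

lemma invertible_scaleC_iff: "c \<noteq> 0 \<Longrightarrow> invertible_elem (c *\<^sub>C x) = invertible_elem x"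
  using invertible_scaleC[of c x] invertible_scaleC[of "inverse c" "c *\<^sub>C x"]
  by (auto simp: scaleC_scaleC)

lemma inv_elem_star: "invertible_elem x \<Longrightarrow> inv_elem (star x) = star (inv_elem x)"
  by (rule inv_elem_unique) (simp_all add: star_mult[symmetric] inv_elem)

lemma selfadjoint_inv_elem: "selfadjoint x \<Longrightarrow> invertible_elem x \<Longrightarrow> selfadjoint (inv_elem x)"
  using inv_elem_star[of x] by (simp add: selfadjoint_def)

text \<open>The adjoint of a right inverse of a selfadjoint element is a left inverse.\<close>

lemma selfadjoint_right_inverse:
  assumes "selfadjoint x" "x * y = 1" shows "invertible_elem x"
  using invertible_two_sided[OF assms(2), of "star y"] assms star_mult[of x y]
  by (simp add: selfadjoint_def)

lemma selfadjoint_left_inverse: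
  assumes "selfadjoint x" "y * x = 1" shows "invertible_elem x"
  using invertible_two_sided[OF _ assms(2), of "star y"] assms star_mult[of y x]
  by (simp add: selfadjoint_def)

section \<open>Neumann series and basic facts on the spectrum\<close>

lemma neumann:
  fixes x :: "'a::{real_normed_algebra_1, banach}"
  assumes "norm x < 1" shows "invertible_elem (1 - x)"
proof -
  have s: "summable (\<lambda>n. x ^ n)"
    by (rule summable_comparison_test'[where g = "\<lambda>n. norm x ^ n" and N = 0])
       (use assms in \<open>auto simp: norm_power_ineq\<close>)
  have "(\<Sum>n. x ^ n) = 1 + (\<Sum>n. x ^ Suc n)"
    using suminf_split_head[OF s] by simp
  moreover have "(\<Sum>n. x ^ Suc n) = x * (\<Sum>n. x ^ n)"
    using suminf_mult[OF s, of x] by simp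
  moreover have "(\<Sum>n. x ^ Suc n) = (\<Sum>n. x ^ n) * x"
    using suminf_mult2[OF s, of x] by (simp add: power_commutes)
  ultimately show ?thesis
    by (intro invertible_elemI[where y = "\<Sum>n. x ^ n"]) (simp_all add: algebra_simps)
qed

text \<open>Write y = x (1 - x^-1 (x - y)) and apply the Neumann series to the second
  factor.\<close>

lemma invertible_open:
  fixes x :: "'a::{real_normed_algebra_1, banach}"
  assumes "invertible_elem x"
  obtains e where "e > 0" "\<And>y. norm (y - x) < e \<Longrightarrow> invertible_elem y"
proof
  have [simp]: "inv_elem x \<noteq> 0" using inv_elem(1)[OF assms] by auto
  show "1 / norm (inv_elem x) > 0" by simp
  fix y assume "norm (y - x) < 1 / norm (inv_elem x)"
  then have "norm (inv_elem x * (x - y)) < 1"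
    using norm_mult_ineq[of "inv_elem x" "x - y"]
    by (simp add: field_simps norm_minus_commute)
  then have "invertible_elem (x * (1 - inv_elem x * (x - y)))"
    by (intro invertible_mult assms neumann)
  then show "invertible_elem y" by (simp add: assms algebra_simps inv_elem)
qed

lemma spectrum_norm_le: "z \<in> spectrum x \<Longrightarrow> cmod z \<le> norm x"
proof (rule ccontr)
  assume z: "z \<in> spectrum x" and "\<not> cmod z \<le> norm x"
  then have lt: "norm x < cmod z" by simp
  then have [simp]: "z \<noteq> 0" using norm_ge_zero[of x] by auto
  have "norm (inverse z *\<^sub>C x) < 1"
    unfolding norm_scaleC norm_inverse using lt by (simp add: inverse_eq_divide)
  then have "invertible_elem ((- z) *\<^sub>C (1 - inverse z *\<^sub>C x))"
    by (intro invertible_scaleC neumann) auto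
  then have "invertible_elem (x - z *\<^sub>C 1)"
    by (simp add: scaleC_diff_right scaleC_scaleC)
  then show False using z by (simp add: spectrum_def)
qed

lemma spectrum_closed: "closed (spectrum (x::'a::unital_cstar_algebra))"
proof -
  have "open (- spectrum x)"
    unfolding open_dist
  proof
    fix z assume "z \<in> - spectrum x"
    then have "invertible_elem (x - z *\<^sub>C 1)" by (simp add: spectrum_def)
    then obtain e where e: "e > 0" "\<And>y. norm (y - (x - z *\<^sub>C 1)) < e \<Longrightarrow> invertible_elem y"
      using invertible_open by blast
    have "y \<in> - spectrum x" if "dist y z < e" for y
    proof -
      have "norm ((x - y *\<^sub>C 1) - (x - z *\<^sub>C 1)) = cmod (z - y)"
        by (simp add: scaleC_diff_left[symmetric] norm_scaleC)
      then show ?thesis using e(2) that by (simp add: spectrum_def dist_norm norm_minus_commute)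
    qed
    then show "\<exists>e>0. \<forall>y. dist y z < e \<longrightarrow> y \<in> - spectrum x" using e(1) by blast
  qed
  then show ?thesis by (simp add: open_Compl closed_open)
qed

lemma spectrum_compact: "compact (spectrum (x::'a::unital_cstar_algebra))"
  using spectrum_closed spectrum_norm_le by (metis bounded_iff compact_eq_bounded_closed)

lemma spectrum_shift: "z \<in> spectrum (x + c *\<^sub>C 1) \<longleftrightarrow> z - c \<in> spectrum x"
  by (simp add: spectrum_def scaleC_diff_left algebra_simps)

lemma spectrum_scaleC: "c \<noteq> 0 \<Longrightarrow> z \<in> spectrum (c *\<^sub>C x) \<longleftrightarrow> z / c \<in> spectrum x"
  using invertible_scaleC_iff[of c "x - (z/c) *\<^sub>C 1"]
  by (simp add: spectrum_def scaleC_diff_right scaleC_scaleC)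

text \<open>Shift by i t: the C*-identity bounds |z + i t|^2 by |h|^2 + t^2. The t^2 cancels and
  leaves a term 2 t Im z that is bounded above for all real t, which forces Im z = 0.\<close>

lemma spectrum_selfadjoint_real:
  assumes "selfadjoint h" "z \<in> spectrum h" shows "z \<in> \<real>"
proof -
  define \<alpha> \<beta> where "\<alpha> = Re z" and "\<beta> = Im z"
  have bound: "\<alpha>\<^sup>2 + \<beta>\<^sup>2 + 2 * \<beta> * t \<le> (norm h)\<^sup>2" for t :: real
  proof -
    let ?u = "h + (\<i> * complex_of_real t) *\<^sub>C 1"
    have "z + \<i> * complex_of_real t \<in> spectrum ?u"
      using assms(2) by (simp add: spectrum_shift)
    then have "(cmod (z + \<i> * complex_of_real t))\<^sup>2 \<le> (norm ?u)\<^sup>2"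
      by (intro power_mono spectrum_norm_le) auto
    also have "\<dots> = norm (star ?u * ?u)" by (simp add: cstar_identity)
    also have "star ?u = h - (\<i> * complex_of_real t) *\<^sub>C 1"
      using assms(1) by (simp add: star_add star_scaleC selfadjoint_def)
    also have "(h - (\<i> * complex_of_real t) *\<^sub>C 1) * ?u = h * h + (complex_of_real (t\<^sup>2)) *\<^sub>C 1"
      by (simp add: algebra_simps mult_scaleC_left mult_scaleC_right scaleC_scaleC scaleC_diff_right power2_eq_square)
    also have "norm \<dots> \<le> norm (h * h) + norm (complex_of_real (t\<^sup>2) *\<^sub>C (1::'a))"
      by (rule norm_triangle_ineq)
    also have "norm (h * h) = (norm h)\<^sup>2" using assms(1) by (rule selfadjoint_norm_mult)
    also have "norm (complex_of_real (t\<^sup>2) *\<^sub>C (1::'a)) = t\<^sup>2"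
      unfolding norm_scaleC norm_of_real by simp
    finally have "(cmod (z + \<i> * complex_of_real t))\<^sup>2 \<le> (norm h)\<^sup>2 + t\<^sup>2" .
    then have "\<alpha>\<^sup>2 + (\<beta> + t)\<^sup>2 \<le> (norm h)\<^sup>2 + t\<^sup>2"
      unfolding cmod_power2 by (simp add: \<alpha>_def \<beta>_def)
    then show ?thesis by (simp add: power2_eq_square algebra_simps)
  qed
  have "\<beta> = 0"
  proof (rule ccontr)
    assume "\<beta> \<noteq> 0"
    then have "2 * \<beta> * (((norm h)\<^sup>2 + 1) / \<beta>) = 2 * ((norm h)\<^sup>2 + 1)" by simp
    then have "\<alpha>\<^sup>2 + \<beta>\<^sup>2 + 2 * ((norm h)\<^sup>2 + 1) \<le> (norm h)\<^sup>2"
      using bound[of "((norm h)\<^sup>2 + 1) / \<beta>"] by metis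
    then show False
      using zero_le_power2[of \<alpha>] zero_le_power2[of \<beta>] zero_le_power2[of "norm h"]
      unfolding distrib_left by linarith
  qed
  then show ?thesis by (simp add: \<beta>_def complex_is_Real_iff)
qed

text \<open>A fixed point of q = (k + q^2)/2 satisfies (1 - q)^2 = 1 - k. Every iterate commutes
  with whatever commutes with \<open>k\<close>, and so does the limit.\<close>

lemma sqrt_one_minus:
  fixes k :: "'a::unital_cstar_algebra"
  assumes "selfadjoint k" "norm k \<le> 1"
  obtains q where "selfadjoint q" "norm q \<le> 1" "(1 - q) * (1 - q) = 1 - k"
    "\<And>c. c * k = k * c \<Longrightarrow> c * q = q * c"
proof -
  define Q where "Q = rec_nat 0 (\<lambda>_ q. (1/2) *\<^sub>R (k + q * q))"
  \<comment> \<open>The same recursion with the scalar 1 for \<open>k\<close>. It is increasing and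
    bounded by 1, and its increments majorise those of \<open>Q\<close>; this gives convergence even
    when \<open>k\<close> has norm exactly 1.\<close>
  define S where "S = rec_nat 0 (\<lambda>_ s::real. (1 + s * s) / 2)"
  have Q: "Q 0 = 0" "\<And>n. Q (Suc n) = (1/2) *\<^sub>R (k + Q n * Q n)" by (simp_all add: Q_def)
  have S: "S 0 = 0" "\<And>n. S (Suc n) = (1 + S n * S n) / 2" by (simp_all add: S_def)
  have comm: "c * Q n = Q n * c" if "c * k = k * c" for c n
  proof (induction n)
    case (Suc n)
    have "c * (Q n * Q n) = Q n * Q n * c" using Suc by (metis mult.assoc)
    then show ?case by (simp add: Q that algebra_simps)
  qed (simp add: Q)
  have Qk: "Q n * k = k * Q n" for n using comm[of k n] by simp
  have QQ: "Q m * Q n = Q n * Q m" for m n by (rule comm[OF Qk])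
  have sa: "selfadjoint (Q n)" for n by (induction n) (auto simp: Q assms)
  have S01: "0 \<le> S n \<and> S n \<le> 1" for n
  proof (induction n)
    case (Suc n)
    have "S n * S n \<le> 1 * 1" using Suc by (intro mult_mono) auto
    then show ?case using Suc by (simp add: S)
  qed (simp add: S)
  have nQ: "norm (Q n) \<le> S n" for n
  proof (induction n)
    case (Suc n)
    have "norm (k + Q n * Q n) \<le> norm k + norm (Q n) * norm (Q n)"
      by (meson norm_triangle_ineq norm_mult_ineq add_left_mono order_trans)
    also have "\<dots> \<le> 1 + S n * S n" using Suc S01[of n] assms by (intro add_mono mult_mono) auto
    finally show ?case by (simp add: Q S)
  qed (simp add: Q S)
  have dQ: "norm (Q (Suc n) - Q n) \<le> S (Suc n) - S n" for n
  proof (induction n)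
    case 0
    show ?case using assms by (simp add: Q S)
  next
    case (Suc n)
    have "Q (Suc (Suc n)) - Q (Suc n) = (1/2) *\<^sub>R ((Q (Suc n) - Q n) * (Q (Suc n) + Q n))"
    proof -
      have "(Q (Suc n) - Q n) * (Q (Suc n) + Q n) = (k + Q (Suc n) * Q (Suc n)) - (k + Q n * Q n)"
        using QQ[of n "Suc n"] by (simp add: algebra_simps del: Q)
      then show ?thesis by (simp only: Q(2)[of "Suc n"] Q(2)[of n] scaleR_diff_right)
    qed
    then have "norm (Q (Suc (Suc n)) - Q (Suc n)) \<le> (1/2) * (norm (Q (Suc n) - Q n) * norm (Q (Suc n) + Q n))"
      by (simp add: norm_mult_ineq)
    also have "\<dots> \<le> (1/2) * ((S (Suc n) - S n) * (S (Suc n) + S n))"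
      using Suc nQ[of n] nQ[of "Suc n"] order_trans[OF norm_ge_zero Suc] norm_triangle_ineq[of "Q (Suc n)" "Q n"]
      by (intro mult_left_mono mult_mono) (auto intro: order_trans[OF norm_ge_zero])
    also have "\<dots> = S (Suc (Suc n)) - S (Suc n)"
      by (simp add: S(2)[of "Suc n"] S(2)[of n] field_simps power2_eq_square)
    finally show ?case .
  qed
  have mS: "S n \<le> S (Suc n)" for n using order_trans[OF norm_ge_zero dQ[of n]] by simp
  have "convergent S"
    using S01 mS by (intro Bseq_monoseq_convergent) (auto simp: monoseq_Suc intro!: BseqI'[of _ 1])
  then have "summable (\<lambda>n. S (Suc n) - S n)" using telescope_summable convergent_def by blast
  then have "summable (\<lambda>n. Q (Suc n) - Q n)"
    by (rule summable_comparison_test'[where N = 0]) (use dQ in auto)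
  then have "(\<lambda>n. \<Sum>i<n. Q (Suc i) - Q i) \<longlonglongrightarrow> (\<Sum>n. Q (Suc n) - Q n)" by (rule summable_LIMSEQ)
  then obtain q where q: "Q \<longlonglongrightarrow> q" by (auto simp: sum_lessThan_telescope Q(1))
  have "(\<lambda>n. (1/2) *\<^sub>R (k + Q n * Q n)) \<longlonglongrightarrow> (1/2) *\<^sub>R (k + q * q)"
    by (intro tendsto_intros q)
  moreover have "(\<lambda>n. (1/2) *\<^sub>R (k + Q n * Q n)) \<longlonglongrightarrow> q"
    using LIMSEQ_Suc[OF q] by (simp add: Q)
  ultimately have "q = (1/2) *\<^sub>R (k + q * q)" using LIMSEQ_unique by blast
  then have "2 *\<^sub>R q = k + q * q" by (metis scaleR_half_double scaleR_2 scaleR_right.add)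
  then have eq: "(1 - q) * (1 - q) = 1 - k" by (simp add: algebra_simps scaleR_2)
  show thesis
  proof (rule that[OF _ _ eq])
    show "selfadjoint q" using sa q by (rule selfadjoint_LIMSEQ)
    show "norm q \<le> 1"
      using tendsto_norm[OF q] nQ S01 by (intro LIMSEQ_le_const2) (auto intro: order_trans)
    fix c assume "c * k = k * c"
    then have "c * Q n = Q n * c" for n by (rule comm)
    then have "(\<lambda>n. c * Q n) \<longlonglongrightarrow> q * c" using tendsto_mult_right[OF q, of c] by simp
    then show "c * q = q * c" using tendsto_mult_left[OF q, of c] LIMSEQ_unique by blast
  qed
qed

text \<open>The element u = y + i z has u^* u = y^2 + z^2 because y and z commute, and y is its real
  part, so its norm is at most that of u.\<close>

lemma norm_le_sum_squares:
  assumes "selfadjoint y" "selfadjoint z" "y * z = z * y"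
  shows "(norm y)\<^sup>2 \<le> norm (y * y + z * z)"
proof -
  define u where "u = y + \<i> *\<^sub>C z"
  have su: "star u = y - \<i> *\<^sub>C z"
    using assms by (simp add: u_def star_add star_scaleC selfadjoint_def)
  have uu: "star u * u = y * y + z * z"
    unfolding su unfolding u_def using assms(3)
    by (simp add: algebra_simps mult_scaleC_left mult_scaleC_right scaleC_scaleC scaleC_diff_right)
  have "y = (1/2) *\<^sub>R (u + star u)" by (simp add: su) (simp add: u_def scaleR_2[symmetric] flip: scaleR_add_right)
  then have "norm y \<le> (1/2) * (norm u + norm (star u))"
    by (metis norm_scaleR norm_triangle_ineq abs_of_pos half_gt_zero_iff mult_left_mono zero_less_one less_imp_le)
  then have "norm y \<le> norm u" by simp
  then show ?thesis using cstar_identity[of u] uu by (simp add: power_mono)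
qed

section \<open>Positive elements\<close>

text \<open>
  This replaces the spectral radius formula: if \<open>1 - h\<^sup>2 \<ge> 1/C\<close>, with the difference exhibited as the square
  of a selfadjoint element commuting with \<open>h\<close>, then \<open>\<parallel>h\<parallel>\<^sup>2 \<le> 1 - 1/C\<close>.
\<close>

lemma one_minus_square_not_invertible:
  fixes h :: "'a::unital_cstar_algebra"
  assumes "selfadjoint h" "norm h = 1"
  shows "\<not> invertible_elem (1 - h * h)"
proof
  assume inv: "invertible_elem (1 - h * h)"
  define k where "k = h * h"
  define v where "v = inv_elem (1 - k)"
  have k: "selfadjoint k" "norm k \<le> 1" using assms by (simp_all add: k_def selfadjoint_norm_mult)
  have v: "(1 - k) * v = 1" "v * (1 - k) = 1" using inv by (simp_all add: v_def k_def inv_elem)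
  obtain q where q: "selfadjoint q" "(1 - q) * (1 - q) = 1 - k"
    "\<And>c. c * k = k * c \<Longrightarrow> c * q = q * c"
    using sqrt_one_minus[OF k] by metis
  define w where "w = 1 - q"
  have w: "selfadjoint w" "w * w = 1 - k" using q(1,2) by (simp_all add: w_def)
  have comm_w: "c * w = w * c" if "c * k = k * c" for c
    using q(3)[OF that] by (simp add: w_def right_diff_distrib left_diff_distrib)
  have winv: "invertible_elem w"
    using selfadjoint_right_inverse[of w "w * v"] w v by (simp add: mult.assoc[symmetric])
  define u where "u = inv_elem w"
  have u: "selfadjoint u" "w * u = 1" "u * w = 1"
    using winv w(1) by (simp_all add: u_def selfadjoint_inv_elem inv_elem)
  have uu: "u * u = v"
  proof -
    have "u * u * (w * w) = 1" by (metis u(3) mult.assoc mult_1_right)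
    then have "u * u * (1 - k) * v = v" by (simp add: w)
    then show ?thesis by (simp add: mult.assoc v)
  qed
  \<comment> \<open>\<open>C\<close> bounds the inverse \<open>v\<close> of 1 - k, so
    \<open>l\<close> has norm at most 1 and 1 - l has a square root \<open>y\<close>. Then (y w)^2 =
    (1 - l)(1 - k) = 1 - k - 1/C, and adding h^2 = k leaves the scalar 1 - 1/C.\<close>
  define C where "C = max 1 (norm v)"
  have C: "C \<ge> 1" "norm v \<le> C" by (simp_all add: C_def)
  define l where "l = (1 / C) *\<^sub>R v"
  have l: "selfadjoint l" "norm l \<le> 1"
    using C selfadjoint_intros(3)[OF u(1)] by (auto simp: l_def uu divide_simps)
  obtain q' where q': "selfadjoint q'" "(1 - q') * (1 - q') = 1 - l"
    "\<And>c. c * l = l * c \<Longrightarrow> c * q' = q' * c"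
    using sqrt_one_minus[OF l] by metis
  define y where "y = 1 - q'"
  have y: "selfadjoint y" "y * y = 1 - l" using q'(1,2) by (simp_all add: y_def)
  have comm_v: "c * v = v * c" if "c * k = k * c" for c
    unfolding v_def using that inv by (intro inv_elem_commute) (auto simp: k_def algebra_simps)
  have comm_y: "c * y = y * c" if "c * k = k * c" for c
    using q'(3)[of c] comm_v[OF that] by (simp add: l_def y_def right_diff_distrib left_diff_distrib)
  have "k * w = w * k" using comm_w[of k] by simp
  then have wy: "w * y = y * w" using comm_y[of w] by simp
  have hk: "h * k = k * h" by (simp add: k_def mult.assoc)
  have hyw: "h * (y * w) = (y * w) * h"
    using comm_y[OF hk] comm_w[OF hk] by (metis mult.assoc)
  have yw2: "(y * w) * (y * w) = (1 - k) - (1 / C) *\<^sub>R 1"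
  proof -
    have "(y * w) * (y * w) = (y * y) * (w * w)" using wy by (metis mult.assoc)
    also have "\<dots> = (1 - k) - l * (1 - k)" by (simp add: y w algebra_simps)
    also have "l * (1 - k) = (1 / C) *\<^sub>R 1" using v by (simp add: l_def)
    finally show ?thesis .
  qed
  have "(norm h)\<^sup>2 \<le> norm (h * h + (y * w) * (y * w))"
    by (rule norm_le_sum_squares[OF assms(1) selfadjoint_mult[OF y(1) w(1) wy[symmetric]] hyw])
  also have "h * h + (y * w) * (y * w) = (1 - 1 / C) *\<^sub>R 1"
    unfolding yw2 by (simp add: k_def scaleR_diff_left)
  also have "norm ((1 - 1 / C) *\<^sub>R (1::'a)) = 1 - 1 / C" using C by simp
  finally show False using C assms by simp
qed

text \<open>After scaling to norm 1, the singular element 1 - g^2 factors as (1 - g)(1 + g), so 1 or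
  -1 lies in the spectrum of g.\<close>

lemma norm_in_spectrum:
  fixes h :: "'a::unital_cstar_algebra"
  assumes "selfadjoint h"
  obtains z where "z \<in> spectrum h" "cmod z = norm h"
proof (cases "h = 0")
  case True
  have "(0::'a) * y \<noteq> 1" for y by simp
  then have "0 \<in> spectrum h" using True by (simp add: spectrum_def invertible_elem_def)
  then show ?thesis using that True by fastforce
next
  case False
  define g where "g = (1 / norm h) *\<^sub>R h"
  have "selfadjoint g" "norm g = 1" using False assms by (auto simp: g_def)
  then have "\<not> invertible_elem (1 - g * g)" by (rule one_minus_square_not_invertible)
  moreover have "1 - g * g = ((-1) *\<^sub>C (g - 1 *\<^sub>C 1)) * (g - (-1) *\<^sub>C 1)" by (simp add: algebra_simps)
  ultimately have "\<not> invertible_elem ((-1) *\<^sub>C (g - 1 *\<^sub>C 1)) \<or> \<not> invertible_elem (g - (-1) *\<^sub>C 1)"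
    using invertible_mult by metis
  then have "1 \<in> spectrum g \<or> -1 \<in> spectrum g"
    using invertible_scaleC_iff[of "-1" "g - 1 *\<^sub>C 1"] by (simp add: spectrum_def)
  then obtain s where s: "s \<in> spectrum g" "cmod s = 1"
    using that[of 1] that[of "-1"] by auto
  have "g = complex_of_real (1 / norm h) *\<^sub>C h" by (simp only: g_def scaleC_of_real)
  then have "complex_of_real (norm h) * s \<in> spectrum h"
    using s(1) False spectrum_scaleC[of "complex_of_real (1 / norm h)" s h] by (simp add: mult.commute)
  then show ?thesis using that[of "complex_of_real (norm h) * s"] s(2) by (simp add: norm_mult)
qed

lemma pos_coneD:
  assumes "x \<in> pos_cone"
  shows "selfadjoint x" "z \<in> spectrum x \<Longrightarrow> \<exists>r\<ge>0. z = complex_of_real r"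
proof -
  have x: "star x = x \<and> (\<forall>z\<in>spectrum x. z \<in> \<real> \<and> 0 \<le> Re z)"
    using assms unfolding pos_cone_def mem_Collect_eq .
  show "selfadjoint x" unfolding selfadjoint_def by (rule conjunct1[OF x])
  assume "z \<in> spectrum x"
  then have "z \<in> \<real>" "0 \<le> Re z" using conjunct2[OF x] by blast+
  then show "\<exists>r\<ge>0. z = complex_of_real r" by (metis of_real_Re)
qed

lemmas pos_selfadjoint [simp] = pos_coneD(1)

lemma spectrum_const_minus:
  "z \<in> spectrum (c *\<^sub>R 1 - h) \<longleftrightarrow> complex_of_real c - z \<in> spectrum h"
proof -
  have "c *\<^sub>R 1 - h = (-1) *\<^sub>C h + complex_of_real c *\<^sub>C 1" by (simp add: scaleC_of_real)
  then show ?thesis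
    using spectrum_shift[of z "(-1) *\<^sub>C h" "complex_of_real c"] spectrum_scaleC[of "-1" "z - complex_of_real c" h]
    by simp
qed

text \<open>The spectrum of c - h is the spectrum of h reflected in c/2, so h has no negative
  spectrum exactly if c - h has none above c. The norm form makes sums and limits of positive
  elements easy to treat.\<close>

lemma pos_cone_iff_norm:
  assumes "selfadjoint h" "norm h \<le> c"
  shows "h \<in> pos_cone \<longleftrightarrow> norm (c *\<^sub>R 1 - h) \<le> c"
proof
  assume h: "h \<in> pos_cone"
  have "selfadjoint (c *\<^sub>R 1 - h)" using assms by auto
  then obtain z where z: "z \<in> spectrum (c *\<^sub>R 1 - h)" "cmod z = norm (c *\<^sub>R 1 - h)"
    using norm_in_spectrum by blast
  let ?w = "complex_of_real c - z"
  have w: "?w \<in> spectrum h" using z by (simp add: spectrum_const_minus)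
  obtain r where r: "r \<ge> 0" "?w = complex_of_real r" using pos_coneD(2)[OF h w] by auto
  then have "r \<le> c" using spectrum_norm_le[OF w] assms by simp
  moreover have "z = complex_of_real (c - r)" using r(2) by (simp add: algebra_simps)
  ultimately have "cmod z \<le> c" using r(1) by (auto simp only: norm_of_real abs_of_nonneg diff_ge_0_iff_ge)
  then show "norm (c *\<^sub>R 1 - h) \<le> c" using z by simp
next
  assume n: "norm (c *\<^sub>R 1 - h) \<le> c"
  have "z \<in> \<real> \<and> 0 \<le> Re z" if z: "z \<in> spectrum h" for z
  proof
    show r: "z \<in> \<real>" using spectrum_selfadjoint_real assms z by blast
    have "complex_of_real c - z \<in> spectrum (c *\<^sub>R 1 - h)" using z by (simp add: spectrum_const_minus)
    then have "cmod (complex_of_real c - z) \<le> c" using spectrum_norm_le n order_trans by blast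
    then show "0 \<le> Re z" using complex_Re_le_cmod[of "complex_of_real c - z"] by simp
  qed
  then show "h \<in> pos_cone" using assms by (auto simp: pos_cone_def selfadjoint_def)
qed

lemma pos_cone_iff_norm':
  "h \<in> pos_cone \<longleftrightarrow> selfadjoint h \<and> norm (norm h *\<^sub>R 1 - h) \<le> norm h"
  using pos_cone_iff_norm[of h "norm h", OF _ order_refl] pos_coneD(1)[of h] by argo

text \<open>Raising c to a bound d of |h| raises the distance from h to the constant by at most d -
  c.\<close>

lemma pos_coneI:
  assumes "selfadjoint h" "norm (c *\<^sub>R 1 - h) \<le> c" shows "h \<in> pos_cone"
proof -
  define d where "d = max c (norm h)"
  have "norm (d *\<^sub>R 1 - h) \<le> norm ((d - c) *\<^sub>R (1::'a)) + norm (c *\<^sub>R 1 - h)"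
    using norm_triangle_ineq[of "(d - c) *\<^sub>R (1::'a)" "c *\<^sub>R 1 - h"] by (simp add: scaleR_diff_left)
  also have "\<dots> \<le> d" using assms by (simp add: d_def)
  finally show ?thesis using assms pos_cone_iff_norm[of h d] by (simp add: d_def)
qed

lemma pos_cone_add: "x \<in> pos_cone \<Longrightarrow> y \<in> pos_cone \<Longrightarrow> x + y \<in> pos_cone"
proof (rule pos_coneI)
  assume x: "x \<in> pos_cone" and y: "y \<in> pos_cone"
  have "norm ((norm x + norm y) *\<^sub>R 1 - (x + y)) = norm ((norm x *\<^sub>R 1 - x) + (norm y *\<^sub>R 1 - y))"
    by (rule arg_cong[where f = norm]) (simp add: scaleR_add_left)
  then show "norm ((norm x + norm y) *\<^sub>R 1 - (x + y)) \<le> norm x + norm y"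
    using x y norm_triangle_ineq[of "norm x *\<^sub>R 1 - x" "norm y *\<^sub>R 1 - y"]
    unfolding pos_cone_iff_norm' by linarith
qed simp

lemma zero_pos [simp]: "0 \<in> pos_cone"
  by (rule pos_coneI[where c = 0]) auto

lemma const_pos: "0 \<le> r \<Longrightarrow> r *\<^sub>R 1 \<in> pos_cone"
  by (rule pos_coneI[where c = r]) auto

lemma one_pos [simp]: "1 \<in> pos_cone"
  using const_pos[of 1] by simp

lemma pos_cone_scaleR: "x \<in> pos_cone \<Longrightarrow> 0 \<le> r \<Longrightarrow> r *\<^sub>R x \<in> pos_cone"
proof (rule pos_coneI)
  assume "x \<in> pos_cone" "0 \<le> r"
  then have "r * norm (norm x *\<^sub>R 1 - x) \<le> r * norm x"
    by (intro mult_left_mono) (auto simp: pos_cone_iff_norm')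
  moreover have "(r * norm x) *\<^sub>R 1 - r *\<^sub>R x = r *\<^sub>R (norm x *\<^sub>R 1 - x)"
    by (simp add: scaleR_diff_right)
  ultimately show "norm ((r * norm x) *\<^sub>R 1 - r *\<^sub>R x) \<le> r * norm x" using \<open>0 \<le> r\<close> by simp
qed simp

lemma pos_cone_sum: "(\<And>i. i \<in> I \<Longrightarrow> f i \<in> pos_cone) \<Longrightarrow> sum f I \<in> pos_cone"
  by (induction I rule: infinite_finite_induct) (simp_all add: pos_cone_add)

lemma pos_cone_LIMSEQ:
  assumes "\<And>n. X n \<in> pos_cone" "X \<longlonglongrightarrow> x" shows "x \<in> pos_cone"
proof -
  have "(\<lambda>n. norm (norm (X n) *\<^sub>R 1 - X n)) \<longlonglongrightarrow> norm (norm x *\<^sub>R 1 - x)"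
    by (intro tendsto_intros assms)
  then have "norm (norm x *\<^sub>R 1 - x) \<le> norm x"
    using tendsto_norm[OF assms(2)] by (rule LIMSEQ_le) (use assms in \<open>auto simp: pos_cone_iff_norm'\<close>)
  then show ?thesis using selfadjoint_LIMSEQ[OF _ assms(2)] assms(1) by (auto simp: pos_cone_iff_norm')
qed

text \<open>A negative spectral value -t^2 would make (h - i t)(h + i t) singular, although both
  factors are invertible because h has real spectrum.\<close>

lemma square_pos:
  assumes "selfadjoint h" shows "h * h \<in> pos_cone"
proof -
  have "z \<in> \<real> \<and> 0 \<le> Re z" if z: "z \<in> spectrum (h * h)" for z
  proof
    show r: "z \<in> \<real>" by (rule spectrum_selfadjoint_real[OF selfadjoint_intros(3)[OF assms] z])
    show "0 \<le> Re z"
    proof (rule ccontr)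
      assume neg: "\<not> 0 \<le> Re z"
      define t where "t = sqrt (- Re z)"
      have t: "t > 0" "t * t = - Re z" using neg by (simp_all add: t_def)
      have inv: "invertible_elem (h - (\<i> * complex_of_real s) *\<^sub>C 1)" if "s \<noteq> 0" for s
        using spectrum_selfadjoint_real[OF assms, of "\<i> * complex_of_real s"] that
        by (auto simp: spectrum_def complex_is_Real_iff)
      have "z = - complex_of_real (t * t)" using r t(2) by (auto simp: complex_eq_iff complex_is_Real_iff)
      then have "h * h - z *\<^sub>C 1
          = (h - (\<i> * complex_of_real t) *\<^sub>C 1) * (h - (\<i> * complex_of_real (- t)) *\<^sub>C 1)"
        by (simp add: algebra_simps scaleC_mult_scaleC mult_scaleC_left mult_scaleC_right scaleC_scaleC scaleC_diff_right)
      moreover have "invertible_elem \<dots>" using t(1) by (intro invertible_mult inv) auto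
      ultimately show False using z by (simp add: spectrum_def)
    qed
  qed
  then show ?thesis using selfadjoint_intros(3)[OF assms] by (auto simp: pos_cone_def selfadjoint_def)
qed

text \<open>With C = |h| the element k = 1 - h/C has norm at most 1, and sqrt(C) times the square
  root of 1 - k is the one wanted.\<close>

lemma pos_sqrt:
  assumes "h \<in> pos_cone"
  obtains w where "w \<in> pos_cone" "w * w = h" "\<And>c. c * h = h * c \<Longrightarrow> c * w = w * c"
proof (cases "h = 0")
  case True
  then show ?thesis using that[of 0] by auto
next
  case False
  define C where "C = norm h"
  have C: "C > 0" using False by (simp add: C_def)
  define k where "k = 1 - (1 / C) *\<^sub>R h"
  have "norm (C *\<^sub>R 1 - h) \<le> C" using assms by (simp add: pos_cone_iff_norm' C_def)
  moreover have "C *\<^sub>R 1 - h = C *\<^sub>R k" using C by (simp add: k_def scaleR_diff_right)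
  ultimately have k: "selfadjoint k" "norm k \<le> 1"
    using C assms pos_coneD(1) by (auto simp: k_def)
  obtain q where q: "selfadjoint q" "norm q \<le> 1" "(1 - q) * (1 - q) = 1 - k"
    "\<And>c. c * k = k * c \<Longrightarrow> c * q = q * c"
    using sqrt_one_minus[OF k] by metis
  show ?thesis
  proof
    have "1 - q \<in> pos_cone" using q by (intro pos_coneI[where c = 1]) auto
    then show "sqrt C *\<^sub>R (1 - q) \<in> pos_cone" using C by (intro pos_cone_scaleR) auto
    show "(sqrt C *\<^sub>R (1 - q)) * (sqrt C *\<^sub>R (1 - q)) = h"
      using C by (simp add: q(3)) (simp add: k_def)
    fix c assume "c * h = h * c"
    then have "c * q = q * c" by (intro q(4)) (simp add: k_def algebra_simps)
    then show "c * (sqrt C *\<^sub>R (1 - q)) = (sqrt C *\<^sub>R (1 - q)) * c" by (simp add: algebra_simps)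
  qed
qed

section \<open>The order defined by the cone\<close>

definition pos_le :: "'a::unital_cstar_algebra \<Rightarrow> 'a \<Rightarrow> bool"  (infix "\<preceq>" 50) where
  "x \<preceq> y \<longleftrightarrow> y - x \<in> pos_cone"

lemma pos_le_refl [simp]: "x \<preceq> x" by (simp add: pos_le_def)

lemma pos_le_trans [trans]: "x \<preceq> y \<Longrightarrow> y \<preceq> z \<Longrightarrow> x \<preceq> z"
  using pos_cone_add[of "y - x" "z - y"] by (simp add: pos_le_def)

text \<open>On selfadjoint elements the norm is the order-unit norm of 1. This is the bridge by
  which order-preserving maps are seen to respect norms.\<close>

lemma selfadjoint_norm_le_iff:
  assumes "selfadjoint h"
  shows "norm h \<le> c \<longleftrightarrow> h \<preceq> c *\<^sub>R 1 \<and> - (c *\<^sub>R 1) \<preceq> h"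
proof
  assume n: "norm h \<le> c"
  have "c *\<^sub>R 1 - h \<in> pos_cone" using assms n by (intro pos_coneI[where c = c]) auto
  moreover have "h - - (c *\<^sub>R 1) \<in> pos_cone" using assms n by (intro pos_coneI[where c = c]) auto
  ultimately show "h \<preceq> c *\<^sub>R 1 \<and> - (c *\<^sub>R 1) \<preceq> h" by (simp add: pos_le_def)
next
  assume *: "h \<preceq> c *\<^sub>R 1 \<and> - (c *\<^sub>R 1) \<preceq> h"
  obtain z where z: "z \<in> spectrum h" "cmod z = norm h" using norm_in_spectrum[OF assms] .
  have 1: "complex_of_real c - z \<in> spectrum (c *\<^sub>R 1 - h)" using z by (simp add: spectrum_const_minus)
  have 2: "z + complex_of_real c \<in> spectrum (h + complex_of_real c *\<^sub>C 1)" using z by (simp add: spectrum_shift)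
  obtain r where r: "z = complex_of_real r"
    using spectrum_selfadjoint_real[OF assms z(1)] by (auto elim: Reals_cases)
  have "r \<le> c" using pos_coneD(2)[OF _ 1] * unfolding pos_le_def r by (auto simp flip: of_real_diff)
  moreover have "- c \<le> r" using pos_coneD(2)[OF _ 2] * unfolding pos_le_def r
    by (auto simp: scaleC_of_real simp flip: of_real_add)
  ultimately have "cmod z \<le> c" by (simp add: r)
  then show "norm h \<le> c" using z by simp
qed

lemma pos_norm_le_iff:
  assumes "h \<in> pos_cone" "0 \<le> c" shows "norm h \<le> c \<longleftrightarrow> h \<preceq> c *\<^sub>R 1"
  using selfadjoint_norm_le_iff[OF pos_coneD(1)[OF assms(1)], of c]
    pos_cone_add[OF assms(1) const_pos[OF assms(2)]] by (simp add: pos_le_def)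

lemma pos_norm_mono: "x \<in> pos_cone \<Longrightarrow> x \<preceq> y \<Longrightarrow> norm x \<le> norm y"
proof -
  assume x: "x \<in> pos_cone" and xy: "x \<preceq> y"
  then have "y \<in> pos_cone" using pos_cone_add[of x "y - x"] by (simp add: pos_le_def)
  then have "y \<preceq> norm y *\<^sub>R 1" using pos_norm_le_iff[of y "norm y"] by simp
  then show ?thesis using x xy pos_norm_le_iff[of x "norm y"] pos_le_trans by auto
qed

lemma pos_le_antisym: "x \<preceq> y \<Longrightarrow> y \<preceq> x \<Longrightarrow> x = y"
proof -
  assume xy: "x \<preceq> y" "y \<preceq> x"
  then have "selfadjoint (y - x)" by (simp add: pos_le_def)
  then have "norm (y - x) \<le> 0" using xy unfolding selfadjoint_norm_le_iff[OF \<open>selfadjoint (y - x)\<close>]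
    by (simp add: pos_le_def)
  then show ?thesis by simp
qed

text \<open>The square roots w, u of a and b commute as well, so a b = (w u)^2.\<close>

lemma commuting_mult_pos:
  assumes "a \<in> pos_cone" "b \<in> pos_cone" "a * b = b * a" shows "a * b \<in> pos_cone"
proof -
  obtain w where w: "w \<in> pos_cone" "w * w = a" "\<And>c. c * a = a * c \<Longrightarrow> c * w = w * c"
    using pos_sqrt[OF assms(1)] by metis
  obtain u where u: "u \<in> pos_cone" "u * u = b" "\<And>c. c * b = b * c \<Longrightarrow> c * u = u * c"
    using pos_sqrt[OF assms(2)] by metis
  have "b * w = w * b" using assms(3) by (intro w(3)) simp
  then have wu: "w * u = u * w" by (intro u(3)) simp
  then have "a * b = (w * u) * (w * u)" unfolding w(2)[symmetric] u(2)[symmetric] by (metis mult.assoc)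
  then show ?thesis
    using square_pos[OF selfadjoint_mult[OF pos_coneD(1)[OF w(1)] pos_coneD(1)[OF u(1)] wu]] by simp
qed

lemma power_pos: "a \<in> pos_cone \<Longrightarrow> a ^ n \<in> pos_cone"
  by (induction n) (auto intro: commuting_mult_pos simp: power_commutes)

text \<open>Since y - z divides y^3 - z^3, cubes of spectral values of y lie in the spectrum of y^3;
  a real number with nonnegative cube is nonnegative.\<close>

lemma cube_pos_imp_pos:
  assumes "selfadjoint y" "y * y * y \<in> pos_cone" shows "y \<in> pos_cone"
proof -
  have "z \<in> \<real> \<and> 0 \<le> Re z" if z: "z \<in> spectrum y" for z
  proof
    show r: "z \<in> \<real>" using spectrum_selfadjoint_real assms z by blast
    let ?g = "y * y + z *\<^sub>C y + (z * z) *\<^sub>C 1"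
    have "y * y * y - (z * z * z) *\<^sub>C 1 = (y - z *\<^sub>C 1) * ?g"
      "(y - z *\<^sub>C 1) * ?g = ?g * (y - z *\<^sub>C 1)"
      by (simp_all add: algebra_simps mult_scaleC_left mult_scaleC_right scaleC_scaleC scaleC_add_right scaleC_diff_right)
    then have "\<not> invertible_elem (y * y * y - (z * z * z) *\<^sub>C 1)"
      using z invertible_commute_left[of "y - z *\<^sub>C 1" ?g] unfolding spectrum_def mem_Collect_eq by metis
    then have "z * z * z \<in> spectrum (y * y * y)" by (simp add: spectrum_def)
    then have "0 \<le> Re (z * z * z)" using pos_coneD(2)[OF assms(2)] by (metis Re_complex_of_real)
    then have "0 \<le> Re z * Re z * Re z" using r by (simp add: complex_is_Real_iff)
    then show "0 \<le> Re z" by (auto simp: zero_le_mult_iff mult_le_0_iff)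
  qed
  then show ?thesis using assms by (auto simp: pos_cone_def selfadjoint_def)
qed

text \<open>With u = |x|, the square root of x^2, the parts are (u + x)/2 and (u - x)/2. For d = u -
  y with y = x or -x, d^2 = 2 u d, hence d^3 = 2 u d^2 = 2 (w d)^2 with w^2 = u. So the cube of d is
  positive, and therefore d is.\<close>

lemma pos_neg_parts:
  assumes "selfadjoint x"
  obtains p n where "p \<in> pos_cone" "n \<in> pos_cone" "x = p - n" "p * n = 0" "n * p = 0"
proof -
  obtain u where u: "u \<in> pos_cone" "u * u = x * x" "\<And>c. c * (x * x) = (x * x) * c \<Longrightarrow> c * u = u * c"
    using pos_sqrt[OF square_pos[OF assms]] by metis
  obtain w where w: "w \<in> pos_cone" "w * w = u" "\<And>c. c * u = u * c \<Longrightarrow> c * w = w * c"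
    using pos_sqrt[OF u(1)] by metis
  have xu: "x * u = u * x" by (rule u(3)) (simp add: mult.assoc)
  have pos: "u - y \<in> pos_cone" if y: "selfadjoint y" "y * y = x * x" "y * u = u * y" for y
  proof (rule cube_pos_imp_pos)
    let ?d = "u - y"
    have sa: "selfadjoint ?d" using u(1) y(1) by simp
    show "selfadjoint ?d" by (rule sa)
    have dd: "?d * ?d = 2 *\<^sub>R (u * ?d)" using u(2) y by (simp add: algebra_simps scaleR_2)
    have wd: "w * ?d = ?d * w" using w(3)[of u] w(3)[OF y(3)] by (simp add: algebra_simps)
    have "?d * ?d * ?d = 2 *\<^sub>R (u * (?d * ?d))" by (subst dd) (simp add: mult.assoc)
    also have "u * (?d * ?d) = w * (w * ?d) * ?d" by (simp only: w(2)[symmetric] mult.assoc)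
    also have "\<dots> = (w * ?d) * (w * ?d)"
      using arg_cong[OF wd, of "\<lambda>t. w * t * ?d"] by (simp only: mult.assoc)
    finally show "?d * ?d * ?d \<in> pos_cone"
      using square_pos[OF selfadjoint_mult[OF pos_coneD(1)[OF w(1)] sa wd]] by (simp add: pos_cone_scaleR)
  qed
  have 1: "u - x \<in> pos_cone" by (rule pos) (use assms xu in auto)
  have "u - (- x) \<in> pos_cone" by (rule pos) (use assms xu in auto)
  then have 2: "u + x \<in> pos_cone" by simp
  show ?thesis
  proof
    show "(1/2) *\<^sub>R (u + x) \<in> pos_cone" "(1/2) *\<^sub>R (u - x) \<in> pos_cone"
      using 1 2 by (auto intro: pos_cone_scaleR)
    show "x = (1/2) *\<^sub>R (u + x) - (1/2) *\<^sub>R (u - x)"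
      by (simp add: scaleR_diff_right[symmetric])
    show "(1/2) *\<^sub>R (u + x) * (1/2) *\<^sub>R (u - x) = 0" "(1/2) *\<^sub>R (u - x) * (1/2) *\<^sub>R (u + x) = 0"
      using u(2) xu by (simp_all add: algebra_simps)
  qed
qed

text \<open>If c inverts b a - z, then (a c b - 1)/z inverts a b - z.\<close>

lemma nonzero_spectrum_commute:
  assumes "z \<noteq> 0" "z \<in> spectrum (a * b)" shows "z \<in> spectrum (b * a)"
proof (rule ccontr)
  assume "z \<notin> spectrum (b * a)"
  then have inv: "invertible_elem (b * a - z *\<^sub>C 1)" by (simp add: spectrum_def)
  define c where "c = inv_elem (b * a - z *\<^sub>C 1)"
  have c: "b * a * c = 1 + z *\<^sub>C c" "c * (b * a) = 1 + z *\<^sub>C c"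
    using inv_elem[OF inv] by (simp_all add: c_def[symmetric] algebra_simps mult_scaleC_left mult_scaleC_right)
  have c': "b * (a * (c * y)) = y + z *\<^sub>C (c * y)" "c * (b * (a * y)) = y + z *\<^sub>C (c * y)" for y
    using c by (metis distrib_right mult.assoc mult_1_left mult_scaleC_left)+
  let ?d = "inverse z *\<^sub>C (a * c * b - 1)"
  have "(a * b - z *\<^sub>C 1) * ?d = 1" "?d * (a * b - z *\<^sub>C 1) = 1"
    using assms(1)
    by (simp_all add: algebra_simps mult_scaleC_left mult_scaleC_right scaleC_scaleC scaleC_diff_right scaleC_add_right c' )
  then show False using assms(2) by (auto simp: spectrum_def intro: invertible_elemI)
qed

text \<open>Let n be the negative part of \<open>star a * a\<close> and b = a n. Then
  \<open>star b * b\<close> = -n^3 is negative, and so is \<open>b * star b\<close>, which has the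
  same nonzero spectrum. But their sum is half a sum of two squares of selfadjoint elements, hence
  positive. This forces n^3 = 0 and n = 0.\<close>

lemma star_mult_self_pos:
  fixes a :: "'a::unital_cstar_algebra"
  shows "star a * a \<in> pos_cone"
proof -
  obtain p n where pn: "p \<in> pos_cone" "n \<in> pos_cone" "star a * a = p - n" "p * n = 0" "n * p = 0"
    using pos_neg_parts[of "star a * a"] by auto
  have sn: "star n = n" "selfadjoint n" using pn(2) pos_coneD(1) by (auto simp: selfadjoint_def)
  define b where "b = a * n"
  have bb: "star b * b = - (n * n * n)"
  proof -
    have "star b * b = n * (star a * a) * n" by (simp add: b_def star_mult sn mult.assoc)
    then show ?thesis unfolding pn(3) by (simp add: algebra_simps pn)
  qed
  have n3: "n * n * n \<in> pos_cone" using power_pos[OF pn(2), of 3] by (simp add: power3_eq_cube)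
  have neg: "- (b * star b) \<in> pos_cone"
  proof -
    have "z \<in> \<real> \<and> 0 \<le> Re z" if z: "z \<in> spectrum (- (b * star b))" for z
    proof (cases "z = 0")
      case False
      have "- z \<in> spectrum (b * star b)" using spectrum_scaleC[of "-1" z "b * star b"] z by simp
      then have "- z \<in> spectrum (star b * b)" using False nonzero_spectrum_commute[of "- z" b "star b"] by simp
      then have "z \<in> spectrum (n * n * n)" using spectrum_scaleC[of "-1" "- z" "n * n * n"] by (simp add: bb)
      then show ?thesis using n3 by (auto simp: pos_cone_def)
    qed simp
    then show ?thesis using selfadjoint_simps(4)[of b] by (auto simp: pos_cone_def selfadjoint_def)
  qed
  define h k where "h = b + star b" and "k = \<i> *\<^sub>C (b - star b)"
  have hk: "selfadjoint h" "selfadjoint k"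
    by (simp_all add: h_def k_def selfadjoint_def star_add star_diff star_scaleC star_star scaleC_diff_right)
  have "star b * b + b * star b = (1/2) *\<^sub>R (h * h + k * k)"
    by (simp add: h_def k_def algebra_simps scaleC_mult_scaleC scaleR_2[symmetric])
  moreover have "(1/2) *\<^sub>R (h * h + k * k) \<in> pos_cone"
    by (intro pos_cone_scaleR pos_cone_add square_pos hk) auto
  ultimately have "star b * b + b * star b \<in> pos_cone" by simp
  then have "star b * b \<in> pos_cone" using pos_cone_add[OF _ neg] by fastforce
  then have "- (n * n * n) \<in> pos_cone" by (simp add: bb)
  then have n3z: "n * n * n = 0" using pos_le_antisym[of "n * n * n" 0] n3 by (simp add: pos_le_def)
  have "norm ((n * n) * (n * n)) = (norm (n * n))\<^sup>2" by (rule selfadjoint_norm_mult) (use sn in auto)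
  then have "n * n = 0" using n3z by (simp add: mult.assoc[symmetric])
  then have "n = 0" using selfadjoint_norm_mult[OF sn(2)] by simp
  then show ?thesis using pn by simp
qed

lemma conj_pos: "x \<in> pos_cone \<Longrightarrow> star c * x * c \<in> pos_cone"
proof -
  assume "x \<in> pos_cone"
  then obtain w where w: "w \<in> pos_cone" "w * w = x" using pos_sqrt by metis
  then have "star c * x * c = star (w * c) * (w * c)"
    using pos_coneD(1)[OF w(1)] by (simp add: star_mult selfadjoint_def mult.assoc[symmetric]) (simp add: mult.assoc)
  then show ?thesis using star_mult_self_pos by simp
qed

lemma conj_selfadjoint_pos: "x \<in> pos_cone \<Longrightarrow> selfadjoint c \<Longrightarrow> c * x * c \<in> pos_cone"
  using conj_pos[of x c] by (simp add: selfadjoint_def)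

lemma pos_le_conj: "x \<preceq> y \<Longrightarrow> selfadjoint c \<Longrightarrow> c * x * c \<preceq> c * y * c"
  using conj_selfadjoint_pos[of "y - x" c] by (simp add: pos_le_def algebra_simps)

section \<open>Functional calculus\<close>

definition poly_elem :: "complex poly \<Rightarrow> 'a::unital_cstar_algebra \<Rightarrow> 'a" where
  "poly_elem p a = fold_coeffs (\<lambda>c x. c *\<^sub>C 1 + a * x) p 0"

lemma poly_elem_0 [simp]: "poly_elem 0 a = 0"
  by (simp add: poly_elem_def)

lemma poly_elem_pCons [simp]: "poly_elem (pCons c p) a = c *\<^sub>C 1 + a * poly_elem p a"
  by (cases "p = 0 \<and> c = 0") (auto simp: poly_elem_def)

lemma poly_elem_add: "poly_elem (p + q) a = poly_elem p a + poly_elem q a"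
  by (induction p q rule: poly_induct2) (simp_all add: algebra_simps scaleC_add_left)

lemma poly_elem_smult: "poly_elem (smult c p) a = c *\<^sub>C poly_elem p a"
  by (induction p) (simp_all add: scaleC_add_right scaleC_scaleC mult_scaleC_right)

lemma poly_elem_diff: "poly_elem (p - q) a = poly_elem p a - poly_elem q a"
  using poly_elem_add[of p "smult (-1) q" a] poly_elem_smult[of "-1" q a] by simp

lemma poly_elem_mult: "poly_elem (p * q) a = poly_elem p a * poly_elem q a"
  by (induction p) (simp_all add: poly_elem_add poly_elem_smult distrib_right mult_scaleC_left mult.assoc)

lemma poly_elem_commute: "c * a = a * c \<Longrightarrow> c * poly_elem p a = poly_elem p a * c"
proof (induction p)
  case (pCons k p)
  have "c * (a * poly_elem p a) = a * (c * poly_elem p a)" by (metis pCons.prems mult.assoc)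
  also have "\<dots> = a * poly_elem p a * c" using pCons by (simp add: mult.assoc)
  finally show ?case by (simp add: algebra_simps mult_scaleC_left mult_scaleC_right)
qed simp

lemma poly_elem_star: "selfadjoint a \<Longrightarrow> star (poly_elem p a) = poly_elem (map_poly cnj p) a"
proof (induction p)
  case (pCons c p)
  then show ?case
    using poly_elem_commute[of a a "map_poly cnj p"]
    by (simp add: map_poly_pCons star_add star_mult star_scaleC selfadjoint_def)
qed simp

text \<open>Split p into linear factors; each factor is invertible at \<open>a\<close> because its
  root lies outside the spectrum.\<close>

lemma invertible_poly_elem:
  assumes "p \<noteq> 0" "\<And>z. poly p z = 0 \<Longrightarrow> z \<notin> spectrum a"
  shows "invertible_elem (poly_elem p a)"
  using assms
proof (induction "degree p" arbitrary: p)
  case 0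
  then obtain c where "p = [:c:]" "c \<noteq> 0" by (metis degree_eq_zeroE pCons_0_0)
  then show ?case by (simp add: invertible_scaleC)
next
  case (Suc n)
  then have "\<not> constant (poly p)" by (simp add: constant_degree)
  then obtain z where z: "poly p z = 0" using fundamental_theorem_of_algebra by blast
  then obtain q where q: "p = [:- z, 1:] * q" by (metis poly_eq_0_iff_dvd dvdE)
  have "q \<noteq> 0" using q Suc.prems by auto
  then have "degree p = Suc (degree q)" by (simp add: q degree_mult_eq del: mult_pCons_left)
  then have "invertible_elem (poly_elem q a)"
    using Suc q \<open>q \<noteq> 0\<close> by (intro Suc.hyps) (auto simp del: mult_pCons_left)
  moreover have "invertible_elem (poly_elem [:- z, 1:] a)"
    using Suc.prems(2)[OF z] by (simp add: spectrum_def)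
  ultimately show ?case unfolding q poly_elem_mult by (rule invertible_mult[rotated])
qed

text \<open>X - z divides p - p(z), and the two factors commute at \<open>a\<close>, so a singular
  linear factor makes the product singular.\<close>

lemma poly_in_spectrum_poly_elem:
  assumes "z \<in> spectrum a" shows "poly p z \<in> spectrum (poly_elem p a)"
proof -
  have "poly (p - [:poly p z:]) z = 0" by simp
  then obtain q where "p - [:poly p z:] = [:- z, 1:] * q" by (metis poly_eq_0_iff_dvd dvdE)
  then have "poly_elem (p - [:poly p z:]) a = poly_elem [:- z, 1:] a * poly_elem q a"
    by (simp only: poly_elem_mult)
  then have *: "poly_elem p a - poly p z *\<^sub>C 1 = (a - z *\<^sub>C 1) * poly_elem q a" by (simp add: poly_elem_diff)
  have "(a - z *\<^sub>C 1) * poly_elem q a = poly_elem q a * (a - z *\<^sub>C 1)"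
    by (rule poly_elem_commute) (simp add: algebra_simps mult_scaleC_left mult_scaleC_right)
  then have "\<not> invertible_elem ((a - z *\<^sub>C 1) * poly_elem q a)"
    using assms invertible_commute_left[of "a - z *\<^sub>C 1" "poly_elem q a"]
    unfolding spectrum_def mem_Collect_eq by metis
  then show ?thesis by (simp add: spectrum_def *)
qed

lemma spectrum_poly_elem:
  assumes "selfadjoint a" shows "spectrum (poly_elem p a) = poly p ` spectrum a"
proof
  show "spectrum (poly_elem p a) \<subseteq> poly p ` spectrum a"
  proof
    fix w assume w: "w \<in> spectrum (poly_elem p a)"
    show "w \<in> poly p ` spectrum a"
    proof (cases "p = [:w:]")
      case True
      obtain z where "z \<in> spectrum a" using norm_in_spectrum[OF assms] .
      then show ?thesis using True by force
    next
      case False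
      have "\<not> invertible_elem (poly_elem (p - [:w:]) a)" using w by (simp add: spectrum_def poly_elem_diff)
      then obtain z where "poly (p - [:w:]) z = 0" "z \<in> spectrum a"
        using invertible_poly_elem[of "p - [:w:]" a] False by auto
      then show ?thesis by force
    qed
  qed
qed (use poly_in_spectrum_poly_elem in blast)

text \<open>For b = p(a), the selfadjoint element \<open>star b * b\<close> is itself a polynomial
  in a, equal to |p|^2 on the real spectrum. It attains its norm on its spectrum, which spectral
  mapping carries back to that of a.\<close>

lemma norm_poly_elem:
  assumes "selfadjoint a"
  shows "z \<in> spectrum a \<Longrightarrow> cmod (poly p z) \<le> norm (poly_elem p a)"
    and "\<exists>z\<in>spectrum a. norm (poly_elem p a) = cmod (poly p z)"
proof -
  show "cmod (poly p z) \<le> norm (poly_elem p a)" if "z \<in> spectrum a"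
    using poly_in_spectrum_poly_elem[OF that] by (rule spectrum_norm_le)
  define b where "b = poly_elem p a"
  have b: "star b * b = poly_elem (map_poly cnj p * p) a"
    unfolding b_def poly_elem_star[OF assms] by (simp add: poly_elem_mult)
  obtain w where w: "w \<in> spectrum (star b * b)" "cmod w = norm (star b * b)"
    using norm_in_spectrum[of "star b * b"] by auto
  then obtain z where z: "z \<in> spectrum a" "w = poly (map_poly cnj p * p) z"
    unfolding b spectrum_poly_elem[OF assms] by auto
  have "cnj z = z" using spectrum_selfadjoint_real[OF assms z(1)] by (simp add: Reals_cnj_iff)
  then have "w = cnj (poly p z) * poly p z" using poly_cnj[of p z] z(2) by simp
  then have "(norm b)\<^sup>2 = (cmod (poly p z))\<^sup>2"
    using w(2) by (simp add: cstar_identity norm_mult power2_eq_square)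
  then show "\<exists>z\<in>spectrum a. norm (poly_elem p a) = cmod (poly p z)"
    using z(1) by (auto simp: b_def power2_eq_iff_nonneg)
qed

text \<open>The graph of the functional calculus of \<open>a\<close>, as a closure of the polynomial one.\<close>

definition cfc_rel :: "'a::unital_cstar_algebra \<Rightarrow> (complex \<Rightarrow> complex) \<Rightarrow> 'a \<Rightarrow> bool" where
  "cfc_rel a f b \<longleftrightarrow> (\<exists>P. uniform_limit (spectrum a) (\<lambda>n z. poly (P n) z) f sequentially
     \<and> (\<lambda>n. poly_elem (P n) a) \<longlonglongrightarrow> b)"

lemma cfc_rel_norm_ge:
  assumes "selfadjoint a" "cfc_rel a f b" "z \<in> spectrum a" shows "cmod (f z) \<le> norm b"
proof -
  obtain P where P: "uniform_limit (spectrum a) (\<lambda>n z. poly (P n) z) f sequentially"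
    "(\<lambda>n. poly_elem (P n) a) \<longlonglongrightarrow> b" using assms(2) by (auto simp: cfc_rel_def)
  have "(\<lambda>n. cmod (poly (P n) z)) \<longlonglongrightarrow> cmod (f z)"
    by (intro tendsto_norm tendsto_uniform_limitI[OF P(1) assms(3)])
  then show ?thesis
    using tendsto_norm[OF P(2)] by (rule LIMSEQ_le) (use norm_poly_elem(1)[OF assms(1,3)] in auto)
qed

lemma cfc_rel_norm_le:
  assumes "selfadjoint a" "cfc_rel a f b" "\<And>z. z \<in> spectrum a \<Longrightarrow> cmod (f z) \<le> C" shows "norm b \<le> C"
proof (rule field_le_epsilon)
  fix e :: real assume e: "e > 0"
  obtain P where P: "uniform_limit (spectrum a) (\<lambda>n z. poly (P n) z) f sequentially"
    "(\<lambda>n. poly_elem (P n) a) \<longlonglongrightarrow> b" using assms(2) by (auto simp: cfc_rel_def)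
  have "\<forall>\<^sub>F n in sequentially. \<forall>z\<in>spectrum a. dist (poly (P n) z) (f z) < e"
    using P(1) e by (rule uniform_limitD)
  then have "\<forall>\<^sub>F n in sequentially. norm (poly_elem (P n) a) \<le> C + e"
  proof eventually_elim
    case (elim n)
    obtain z where z: "z \<in> spectrum a" "norm (poly_elem (P n) a) = cmod (poly (P n) z)"
      using norm_poly_elem(2)[OF assms(1)] by blast
    have "cmod (poly (P n) z) \<le> cmod (f z) + e"
      using elim z(1) norm_triangle_ineq2[of "poly (P n) z" "f z"] by (fastforce simp: dist_norm)
    then show ?case using z assms(3)[OF z(1)] by linarith
  qed
  then show "norm b \<le> C + e"
    by (rule tendsto_upperbound[OF tendsto_norm[OF P(2)]]) simp
qed

lemma cfc_rel_poly: "cfc_rel a (poly p) (poly_elem p a)"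
  unfolding cfc_rel_def by (intro exI[of _ "\<lambda>_. p"]) (auto intro: uniform_limit_intros)

lemma cfc_rel_cong:
  assumes "\<And>z. z \<in> spectrum a \<Longrightarrow> f z = g z" "cfc_rel a f b" shows "cfc_rel a g b"
proof -
  have "uniform_limit (spectrum a) F f sequentially \<longleftrightarrow> uniform_limit (spectrum a) F g sequentially" for F
    by (rule uniform_limit_cong') (simp_all add: assms(1))
  then show ?thesis using assms(2) by (simp add: cfc_rel_def)
qed

lemma cfc_rel_add: "cfc_rel a f b \<Longrightarrow> cfc_rel a g c \<Longrightarrow> cfc_rel a (\<lambda>z. f z + g z) (b + c)"
  unfolding cfc_rel_def
proof (elim exE conjE)
  fix P Q
  assume "uniform_limit (spectrum a) (\<lambda>n z. poly (P n) z) f sequentially" "(\<lambda>n. poly_elem (P n) a) \<longlonglongrightarrow> b"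
    "uniform_limit (spectrum a) (\<lambda>n z. poly (Q n) z) g sequentially" "(\<lambda>n. poly_elem (Q n) a) \<longlonglongrightarrow> c"
  then show "\<exists>P. uniform_limit (spectrum a) (\<lambda>n z. poly (P n) z) (\<lambda>z. f z + g z) sequentially \<and>
      (\<lambda>n. poly_elem (P n) a) \<longlonglongrightarrow> b + c"
    by (intro exI[of _ "\<lambda>n. P n + Q n"]) (auto simp: poly_elem_add intro!: uniform_limit_add tendsto_add)
qed

lemma cfc_rel_mult:
  assumes "selfadjoint a" "cfc_rel a f b" "cfc_rel a g c"
  shows "cfc_rel a (\<lambda>z. f z * g z) (b * c)"
proof -
  have bd: "bounded (f ` spectrum a)" "bounded (g ` spectrum a)"
    using cfc_rel_norm_ge[OF assms(1,2)] cfc_rel_norm_ge[OF assms(1,3)] by (auto simp: bounded_iff)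
  obtain P Q where
    PQ: "uniform_limit (spectrum a) (\<lambda>n z. poly (P n) z) f sequentially" "(\<lambda>n. poly_elem (P n) a) \<longlonglongrightarrow> b"
    "uniform_limit (spectrum a) (\<lambda>n z. poly (Q n) z) g sequentially" "(\<lambda>n. poly_elem (Q n) a) \<longlonglongrightarrow> c"
    using assms by (auto simp: cfc_rel_def)
  have "uniform_limit (spectrum a) (\<lambda>n z. poly (P n * Q n) z) (\<lambda>z. f z * g z) sequentially"
    using bounded_bilinear.bounded_uniform_limit[OF bounded_bilinear_mult PQ(1,3) bd(2,1)] by simp
  moreover have "(\<lambda>n. poly_elem (P n * Q n) a) \<longlonglongrightarrow> b * c"
    unfolding poly_elem_mult by (intro tendsto_mult PQ)
  ultimately show ?thesis unfolding cfc_rel_def by (intro exI[of _ "\<lambda>n. P n * Q n"]) blast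
qed

lemma cfc_rel_const: "cfc_rel a (\<lambda>z. c) (c *\<^sub>C 1)"
  using cfc_rel_cong[OF _ cfc_rel_poly[of a "[:c:]"], of "\<lambda>z. c"] by simp

lemma cfc_rel_ident: "cfc_rel a (\<lambda>z. z) a"
  using cfc_rel_cong[OF _ cfc_rel_poly[of a "[:0, 1:]"], of "\<lambda>z. z"] by simp

lemma cfc_rel_scale: "selfadjoint a \<Longrightarrow> cfc_rel a f b \<Longrightarrow> cfc_rel a (\<lambda>z. c * f z) (c *\<^sub>C b)"
  using cfc_rel_mult[OF _ cfc_rel_const[of a c], of f b] by (simp add: mult_scaleC_left)

lemma cfc_rel_diff: "selfadjoint a \<Longrightarrow> cfc_rel a f b \<Longrightarrow> cfc_rel a g c \<Longrightarrow> cfc_rel a (\<lambda>z. f z - g z) (b - c)"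
  using cfc_rel_add[of a f b "\<lambda>z. -1 * g z" "(-1) *\<^sub>C c"] cfc_rel_scale[of a g c "-1"] by simp

lemma cfc_rel_cnj:
  assumes a: "selfadjoint a" and "cfc_rel a f b" shows "cfc_rel a (\<lambda>z. cnj (f z)) (star b)"
proof -
  obtain P where P: "uniform_limit (spectrum a) (\<lambda>n z. poly (P n) z) f sequentially"
    "(\<lambda>n. poly_elem (P n) a) \<longlonglongrightarrow> b" using assms(2) by (auto simp: cfc_rel_def)
  have "poly (map_poly cnj p) z = cnj (poly p z)" if "z \<in> spectrum a" for z p
    using spectrum_selfadjoint_real[OF a that] poly_cnj[of p z] by (simp add: Reals_cnj_iff)
  then have "uniform_limit (spectrum a) (\<lambda>n z. poly (map_poly cnj (P n)) z) (\<lambda>z. cnj (f z)) sequentially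
     \<longleftrightarrow> uniform_limit (spectrum a) (\<lambda>n z. cnj (poly (P n) z)) (\<lambda>z. cnj (f z)) sequentially"
    by (intro uniform_limit_cong') auto
  then have "uniform_limit (spectrum a) (\<lambda>n z. poly (map_poly cnj (P n)) z) (\<lambda>z. cnj (f z)) sequentially"
    using bounded_linear.uniform_limit[OF bounded_linear_cnj P(1)] by blast
  moreover have "(\<lambda>n. poly_elem (map_poly cnj (P n)) a) \<longlonglongrightarrow> star b"
    using bounded_linear.tendsto[OF bounded_linear_star P(2)] by (simp add: poly_elem_star a)
  ultimately show ?thesis unfolding cfc_rel_def by (intro exI[of _ "\<lambda>n. map_poly cnj (P n)"]) blast
qed

lemma cfc_rel_unique:
  assumes "selfadjoint a" "cfc_rel a f b" "cfc_rel a f c" shows "b = c"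
  using cfc_rel_norm_le[OF assms(1) cfc_rel_diff[OF assms], of 0] by simp

text \<open>Since S is real, real Stone-Weierstrass applies to the real and the imaginary part
  separately, each with error e/2.\<close>

lemma complex_poly_approximation:
  assumes "compact S" "S \<subseteq> \<real>" "continuous_on S f" "e > 0"
  obtains p where "\<And>z. z \<in> S \<Longrightarrow> cmod (poly p z - f z) < e"
proof -
  define T where "T = Re ` S"
  have S: "S = complex_of_real ` T" unfolding T_def using assms(2) by (force simp: image_iff)
  have T: "compact T" unfolding T_def by (intro compact_continuous_image assms continuous_intros)
  have cont: "continuous_on T (\<lambda>t. f (complex_of_real t))"
    by (rule continuous_on_compose2[OF assms(3)]) (auto simp: S intro!: continuous_intros)
  have real: "\<exists>p. \<forall>t\<in>T. cmod (poly p (complex_of_real t) - complex_of_real (h t)) < e / 2"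
    if h: "continuous_on T h" for h :: "real \<Rightarrow> real"
  proof -
    obtain g where g: "real_polynomial_function g" "\<And>t. t \<in> T \<Longrightarrow> \<bar>h t - g t\<bar> < e / 2"
      using Stone_Weierstrass_real_polynomial_function[OF T h, of "e / 2"] assms(4)
      by (metis half_gt_zero)
    obtain c n where gc: "g = (\<lambda>x. \<Sum>i\<le>n. c i * x ^ i)" using g(1) real_polynomial_function_iff_sum by auto
    let ?p = "\<Sum>i\<le>n. monom (complex_of_real (c i)) i"
    have "poly ?p (complex_of_real t) = complex_of_real (g t)" for t
      by (simp add: gc poly_sum poly_monom)
    then have "\<forall>t\<in>T. cmod (poly ?p (complex_of_real t) - complex_of_real (h t)) < e / 2"
      using g(2) by (simp add: abs_minus_commute flip: of_real_diff)
    then show ?thesis by blast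
  qed
  obtain p where p: "\<forall>t\<in>T. cmod (poly p (complex_of_real t) - complex_of_real (Re (f (complex_of_real t)))) < e / 2"
    using real[OF continuous_on_Re[OF cont]] by blast
  obtain q where q: "\<forall>t\<in>T. cmod (poly q (complex_of_real t) - complex_of_real (Im (f (complex_of_real t)))) < e / 2"
    using real[OF continuous_on_Im[OF cont]] by blast
  show thesis
  proof
    fix z assume "z \<in> S"
    then obtain t where t: "t \<in> T" "z = complex_of_real t" using S by auto
    have "poly (p + smult \<i> q) z - f z = (poly p z - complex_of_real (Re (f z))) + \<i> * (poly q z - complex_of_real (Im (f z)))"
      using complex_eq[of "f z"] by (simp add: algebra_simps)
    also have "cmod \<dots> \<le> cmod (poly p z - complex_of_real (Re (f z))) + cmod (poly q z - complex_of_real (Im (f z)))"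
      by (metis norm_triangle_ineq norm_mult norm_ii mult_1)
    also have "\<dots> < e" using p q t by fastforce
    finally show "cmod (poly (p + smult \<i> q) z - f z) < e" .
  qed
qed

text \<open>Polynomials converging uniformly on the spectrum are Cauchy in the algebra, because the
  norm of p(a) is a value of |p| on the spectrum.\<close>

lemma cfc_rel_exists:
  fixes a :: "'a::unital_cstar_algebra"
  assumes a: "selfadjoint a" and f: "continuous_on (spectrum a) f"
  obtains b where "cfc_rel a f b"
proof -
  have "\<exists>p. \<forall>z\<in>spectrum a. cmod (poly p z - f z) < 1 / Suc n" for n
    using complex_poly_approximation[OF spectrum_compact _ f, of "1 / Suc n"] spectrum_selfadjoint_real[OF a]
    by (metis of_nat_0_less_iff subsetI zero_less_Suc zero_less_divide_1_iff)
  then obtain P where P: "\<And>n z. z \<in> spectrum a \<Longrightarrow> cmod (poly (P n) z - f z) < 1 / Suc n" by metis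
  have "uniform_limit (spectrum a) (\<lambda>n z. poly (P n) z) f sequentially"
  proof (rule uniform_limitI)
    fix e :: real assume "e > 0"
    then obtain N where N: "1 / Suc N < e" using nat_approx_posE by blast
    have "dist (poly (P n) z) (f z) < e" if "n \<ge> N" "z \<in> spectrum a" for n z
    proof -
      have "1 / real (Suc n) \<le> 1 / real (Suc N)" using that by (simp add: frac_le)
      then show ?thesis using P[OF that(2), of n] N by (simp add: dist_norm)
    qed
    then show "\<forall>\<^sub>F n in sequentially. \<forall>z\<in>spectrum a. dist (poly (P n) z) (f z) < e"
      using eventually_sequentially by blast
  qed
  moreover have "Cauchy (\<lambda>n. poly_elem (P n) a)"
  proof (rule metric_CauchyI)
    fix e :: real assume "e > 0"
    then obtain N where N: "1 / Suc N < e / 2" using nat_approx_posE half_gt_zero by metis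
    have "dist (poly_elem (P m) a) (poly_elem (P n) a) < e" if mn: "m \<ge> N" "n \<ge> N" for m n
    proof -
      obtain z where z: "z \<in> spectrum a" "norm (poly_elem (P m - P n) a) = cmod (poly (P m - P n) z)"
        using norm_poly_elem(2)[OF a] by blast
      have "poly (P m - P n) z = (poly (P m) z - f z) - (poly (P n) z - f z)" by simp
      then have "cmod (poly (P m - P n) z) \<le> cmod (poly (P m) z - f z) + cmod (poly (P n) z - f z)"
        by (metis norm_triangle_ineq4)
      also have "\<dots> < 1 / Suc m + 1 / Suc n" using P[OF z(1), of m] P[OF z(1), of n] by linarith
      also have "\<dots> \<le> 1 / Suc N + 1 / Suc N" using mn by (intro add_mono) (simp_all add: frac_le)
      finally show ?thesis using z N by (simp add: dist_norm poly_elem_diff)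
    qed
    then show "\<exists>N. \<forall>m\<ge>N. \<forall>n\<ge>N. dist (poly_elem (P m) a) (poly_elem (P n) a) < e" by blast
  qed
  ultimately show thesis using that unfolding cfc_rel_def by (metis Cauchy_convergent_iff convergent_def)
qed

lemma cfc_rel_norm:
  assumes "selfadjoint a" "cfc_rel a f b" shows "norm b = (SUP z\<in>spectrum a. cmod (f z))"
proof (rule antisym)
  obtain z0 where z0: "z0 \<in> spectrum a" using norm_in_spectrum[OF assms(1)] .
  have bdd: "bdd_above ((\<lambda>z. cmod (f z)) ` spectrum a)"
    using cfc_rel_norm_ge[OF assms] by (auto simp: bdd_above_def)
  show "norm b \<le> (SUP z\<in>spectrum a. cmod (f z))"
    by (rule cfc_rel_norm_le[OF assms]) (rule cSUP_upper[OF _ bdd])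
  show "(SUP z\<in>spectrum a. cmod (f z)) \<le> norm b"
    using z0 cfc_rel_norm_ge[OF assms] by (intro cSUP_least) auto
qed

text \<open>The choice is harmless: \<open>cfc_rel\<close> determines its value uniquely and has one
  for every continuous function.\<close>

lemma is_cfc_exists:
  assumes a: "selfadjoint a" shows "is_cfc a (\<lambda>f. SOME b. cfc_rel a f b)"
proof -
  define \<Phi> where "\<Phi> = (\<lambda>f. SOME b. cfc_rel a f b)"
  have \<Phi>: "\<Phi> f = b" if "cfc_rel a f b" for f b
    unfolding \<Phi>_def using cfc_rel_unique[OF a that] that by (metis someI)
  have rel: "cfc_rel a f (\<Phi> f)" if "continuous_on (spectrum a) f" for f
    using cfc_rel_exists[OF a that] \<Phi> by metis
  have "is_cfc a \<Phi>"
    unfolding is_cfc_def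
    using \<Phi>[OF cfc_rel_add[OF rel rel]] \<Phi>[OF cfc_rel_mult[OF a rel rel]] \<Phi>[OF cfc_rel_scale[OF a rel]]
      \<Phi>[OF cfc_rel_cnj[OF a rel]] cfc_rel_norm[OF a rel] \<Phi>[OF cfc_rel_const[of a 1]] \<Phi>[OF cfc_rel_ident]
    by (simp del: scaleC_one add: scaleC_one)
  then show ?thesis by (simp add: \<Phi>_def)
qed

text \<open>The algebraic clauses fix the calculus on polynomials, and the isometry clause then
  fixes it on their uniform limits.\<close>

lemma is_cfc_cfc_rel:
  assumes a: "selfadjoint a" and \<Phi>: "is_cfc a \<Phi>" and f: "continuous_on (spectrum a) f"
  shows "cfc_rel a f (\<Phi> f)"
proof -
  have add: "\<Phi> (\<lambda>z. g z + h z) = \<Phi> g + \<Phi> h" and mult: "\<Phi> (\<lambda>z. g z * h z) = \<Phi> g * \<Phi> h"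
    if "continuous_on (spectrum a) g" "continuous_on (spectrum a) h" for g h
    using \<Phi> that unfolding is_cfc_def by blast+
  have scale: "\<Phi> (\<lambda>z. c * g z) = c *\<^sub>C \<Phi> g" and norm: "norm (\<Phi> g) = (SUP z\<in>spectrum a. cmod (g z))"
    if "continuous_on (spectrum a) g" for g c
    using \<Phi> that unfolding is_cfc_def by blast+
  have one: "\<Phi> (\<lambda>z. 1) = 1" and ident: "\<Phi> (\<lambda>z. z) = a" using \<Phi> unfolding is_cfc_def by blast+
  have const: "\<Phi> (\<lambda>z. c) = c *\<^sub>C 1" for c using scale[of "\<lambda>z. 1" c] one by simp
  have pol: "\<Phi> (poly p) = poly_elem p a" for p
  proof (induction p)
    case 0
    then show ?case using const[of 0] by (simp add: poly_0[abs_def] fun_eq_iff[symmetric])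
  next
    case (pCons c p)
    have "\<Phi> (\<lambda>z. c + z * poly p z) = \<Phi> (\<lambda>z. c) + \<Phi> (\<lambda>z. z * poly p z)"
      by (rule add) (auto intro!: continuous_intros)
    also have "\<Phi> (\<lambda>z. z * poly p z) = a * poly_elem p a"
      using mult[of "\<lambda>z. z" "poly p"] ident pCons.IH by (simp add: continuous_intros)
    finally show ?case by (simp add: const poly_pCons[abs_def] fun_eq_iff[symmetric])
  qed
  obtain b where b: "cfc_rel a f b" using cfc_rel_exists[OF a f] .
  obtain P where P: "uniform_limit (spectrum a) (\<lambda>n z. poly (P n) z) f sequentially"
    "(\<lambda>n. poly_elem (P n) a) \<longlonglongrightarrow> b" using b by (auto simp: cfc_rel_def)
  have diff: "norm (\<Phi> f - poly_elem (P n) a) = norm (b - poly_elem (P n) a)" for n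
  proof -
    have c: "continuous_on (spectrum a) (\<lambda>z. - 1 * poly (P n) z)" by (intro continuous_intros)
    have "\<Phi> (\<lambda>z. f z + - 1 * poly (P n) z) = \<Phi> f + (-1) *\<^sub>C poly_elem (P n) a"
      using add[OF f c] scale[of "poly (P n)" "-1"] pol[of "P n"] by (simp add: continuous_intros)
    then have "norm (\<Phi> f - poly_elem (P n) a) = (SUP z\<in>spectrum a. cmod (f z - poly (P n) z))"
      using norm[OF continuous_on_add[OF f c]] by simp
    also have "\<dots> = norm (b - poly_elem (P n) a)"
      using cfc_rel_norm[OF a cfc_rel_diff[OF a b cfc_rel_poly]] by simp
    finally show ?thesis .
  qed
  have "(\<lambda>n. norm (poly_elem (P n) a - \<Phi> f)) \<longlonglongrightarrow> 0"
    using P(2) by (simp add: norm_minus_commute[of _ "\<Phi> f"] diff norm_minus_commute[of b] tendsto_norm_zero LIM_zero)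
  then have "(\<lambda>n. poly_elem (P n) a) \<longlonglongrightarrow> \<Phi> f" by (simp add: LIM_zero_iff tendsto_norm_zero_iff)
  then show ?thesis using b LIMSEQ_unique[OF P(2)] by blast
qed

text \<open>The definite description in \<open>cfc\<close> ranges over the value and not over the
  calculus; two calculi may differ on discontinuous functions but agree at a continuous f.\<close>

lemma cfc_rel_cfc:
  assumes a: "selfadjoint a" and f: "continuous_on (spectrum a) f" shows "cfc_rel a f (cfc a f)"
proof -
  obtain b where b: "cfc_rel a f b" using cfc_rel_exists[OF a f] .
  have "cfc a f = b"
    unfolding cfc_def
  proof (rule the_equality)
    show "\<exists>\<Phi>. is_cfc a \<Phi> \<and> \<Phi> f = b"
      using is_cfc_exists[OF a] is_cfc_cfc_rel[OF a is_cfc_exists[OF a] f] cfc_rel_unique[OF a _ b] by blast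
    show "c = b" if "\<exists>\<Phi>. is_cfc a \<Phi> \<and> \<Phi> f = c" for c
      using that is_cfc_cfc_rel[OF a _ f] cfc_rel_unique[OF a _ b] by blast
  qed
  then show ?thesis using b by simp
qed

text \<open>The inclusion of spectral mapping that composition of powers needs. It passes from
  polynomials to limits because the singular elements form a closed set.\<close>

lemma cfc_rel_spectrum:
  assumes "cfc_rel a f b" "z \<in> spectrum a" shows "f z \<in> spectrum b"
proof (rule ccontr)
  assume "f z \<notin> spectrum b"
  then have "invertible_elem (b - f z *\<^sub>C 1)" by (simp add: spectrum_def)
  then obtain e where e: "e > 0" "\<And>y. norm (y - (b - f z *\<^sub>C 1)) < e \<Longrightarrow> invertible_elem y"
    using invertible_open by blast
  obtain P where P: "uniform_limit (spectrum a) (\<lambda>n z. poly (P n) z) f sequentially"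
    "(\<lambda>n. poly_elem (P n) a) \<longlonglongrightarrow> b" using assms(1) by (auto simp: cfc_rel_def)
  have "(\<lambda>n. poly (P n) z *\<^sub>C 1) \<longlonglongrightarrow> f z *\<^sub>C (1::'a)"
  proof -
    have "norm (c *\<^sub>C (1::'a) - d *\<^sub>C 1) = cmod (c - d)" for c d
      by (simp add: norm_scaleC flip: scaleC_diff_left)
    then show ?thesis using tendsto_uniform_limitI[OF P(1) assms(2)] by (simp add: tendsto_iff dist_norm)
  qed
  then have "(\<lambda>n. poly_elem (P n) a - poly (P n) z *\<^sub>C 1) \<longlonglongrightarrow> b - f z *\<^sub>C 1"
    by (intro tendsto_diff P(2))
  then obtain n where "norm ((poly_elem (P n) a - poly (P n) z *\<^sub>C 1) - (b - f z *\<^sub>C 1)) < e"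
    using LIMSEQ_D[OF _ e(1)] by blast
  then have "invertible_elem (poly_elem (P n) a - poly (P n) z *\<^sub>C 1)" by (rule e(2))
  then show False using poly_in_spectrum_poly_elem[OF assms(2), of "P n"] by (simp add: spectrum_def)
qed

section \<open>Real powers of positive elements\<close>

lemma cfc_rel_pos_powr:
  assumes "a \<in> pos_cone" "r > 0"
  shows "cfc_rel a (\<lambda>z. complex_of_real (Re z powr r)) (pos_powr a r)"
proof -
  have "continuous_on (spectrum a) (\<lambda>z. complex_of_real (Re z powr r))"
    using assms pos_coneD(2)[OF assms(1)]
    by (fastforce intro!: continuous_intros continuous_on_powr')
  then show ?thesis unfolding pos_powr_def using assms by (intro cfc_rel_cfc) auto
qed

lemma pos_powr_add:
  assumes "a \<in> pos_cone" "r > 0" "s > 0" shows "pos_powr a r * pos_powr a s = pos_powr a (r + s)"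
  using cfc_rel_mult[OF _ cfc_rel_pos_powr[OF assms(1,2)] cfc_rel_pos_powr[OF assms(1,3)]]
    cfc_rel_pos_powr[OF assms(1), of "r + s"] cfc_rel_unique[of a] assms
  by (simp add: powr_add)

lemma pos_powr_one [simp]: "a \<in> pos_cone \<Longrightarrow> pos_powr a 1 = a"
proof -
  assume a: "a \<in> pos_cone"
  have "cfc_rel a (\<lambda>z. complex_of_real (Re z powr 1)) a"
    using pos_coneD(2)[OF a] by (intro cfc_rel_cong[OF _ cfc_rel_ident]) fastforce
  then show ?thesis using cfc_rel_unique[OF _ cfc_rel_pos_powr[OF a, of 1]] a by simp
qed

lemma pos_powr_pos:
  assumes a: "a \<in> pos_cone" and "r > 0" shows "pos_powr a r \<in> pos_cone"
proof -
  have rel: "cfc_rel a (\<lambda>z. complex_of_real (Re z powr (r/2))) (pos_powr a (r/2))"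
    using assms by (intro cfc_rel_pos_powr) auto
  have "selfadjoint (pos_powr a (r/2))"
    unfolding selfadjoint_def
    using cfc_rel_cnj[OF _ rel] a by (intro cfc_rel_unique[OF _ _ rel]) simp_all
  then show ?thesis using square_pos pos_powr_add[OF a, of "r/2" "r/2"] assms(2) by fastforce
qed

lemma norm_pos_powr:
  assumes a: "a \<in> pos_cone" and r: "r > 0" shows "norm (pos_powr a r) = norm a powr r"
proof (rule antisym)
  have sa: "selfadjoint a" using a by simp
  note rel = cfc_rel_pos_powr[OF a r]
  show "norm (pos_powr a r) \<le> norm a powr r"
  proof (rule cfc_rel_norm_le[OF sa rel])
    fix z assume z: "z \<in> spectrum a"
    then obtain t where "t \<ge> 0" "z = complex_of_real t" using pos_coneD(2)[OF a] by blast
    then show "cmod (complex_of_real (Re z powr r)) \<le> norm a powr r"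
      using spectrum_norm_le[OF z] r by (simp add: powr_mono2)
  qed
  obtain z where z: "z \<in> spectrum a" "cmod z = norm a" using norm_in_spectrum[OF sa] .
  then obtain t where "t \<ge> 0" "z = complex_of_real t" using pos_coneD(2)[OF a] by blast
  then show "norm a powr r \<le> norm (pos_powr a r)" using cfc_rel_norm_ge[OF sa rel z(1)] z(2) by simp
qed

text \<open>Polynomials approximating t^s on the spectrum of b = a^r, composed with t^r, approximate
  t^(r s) on the spectrum of a, because t^r maps the latter spectrum into the former.\<close>

lemma pos_powr_powr:
  assumes a: "a \<in> pos_cone" and r: "r > 0" and s: "s > 0"
  shows "pos_powr (pos_powr a r) s = pos_powr a (r * s)"
proof -
  define b where "b = pos_powr a r"
  have sa: "selfadjoint a" using a by simp
  have b: "b \<in> pos_cone" unfolding b_def using a r by (rule pos_powr_pos)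
  let ?f = "\<lambda>r z. complex_of_real (Re z powr r)"
  have relb: "cfc_rel a (?f r) b" unfolding b_def using a r by (rule cfc_rel_pos_powr)
  obtain P where P: "uniform_limit (spectrum b) (\<lambda>n z. poly (P n) z) (?f s) sequentially"
    "(\<lambda>n. poly_elem (P n) b) \<longlonglongrightarrow> pos_powr b s"
    using cfc_rel_pos_powr[OF b s] by (auto simp: cfc_rel_def)
  have comp: "cfc_rel a (\<lambda>z. poly p (?f r z)) (poly_elem p b)" for p
  proof (induction p)
    case (pCons c p)
    then show ?case using cfc_rel_add[OF cfc_rel_const cfc_rel_mult[OF sa relb]] by simp
  qed (use cfc_rel_const[of a 0] in simp)
  have rs: "cfc_rel a (?f (r * s)) (pos_powr a (r * s))" using a r s by (intro cfc_rel_pos_powr) auto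
  have "(\<lambda>n. poly_elem (P n) b) \<longlonglongrightarrow> pos_powr a (r * s)"
  proof (rule LIMSEQ_I)
    fix e :: real assume e: "e > 0"
    then obtain N where N: "\<forall>n\<ge>N. \<forall>z\<in>spectrum b. dist (poly (P n) z) (?f s z) < e / 2"
      using P(1) unfolding uniform_limit_sequentially_iff by (meson half_gt_zero)
    have "norm (poly_elem (P n) b - pos_powr a (r * s)) \<le> e / 2" if "n \<ge> N" for n
    proof (rule cfc_rel_norm_le[OF sa cfc_rel_diff[OF sa comp rs]])
      fix z assume z: "z \<in> spectrum a"
      have "?f (r * s) z = ?f s (?f r z)" by (simp add: powr_powr)
      then show "cmod (poly (P n) (?f r z) - ?f (r * s) z) \<le> e / 2"
        using N that cfc_rel_spectrum[OF relb z] by (force simp: dist_norm)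
    qed
    then show "\<exists>N. \<forall>n\<ge>N. norm (poly_elem (P n) b - pos_powr a (r * s)) < e" using e by (intro exI[of _ N]) force
  qed
  then show ?thesis using LIMSEQ_unique[OF P(2)] by (simp add: b_def)
qed

section \<open>Order, spectral radius of products and the Thompson metric\<close>

definition pos_inv :: "'a::unital_cstar_algebra set" where
  "pos_inv = {x \<in> pos_cone. invertible_elem x}"

lemma pos_invD: "x \<in> pos_inv \<Longrightarrow> x \<in> pos_cone" "x \<in> pos_inv \<Longrightarrow> invertible_elem x"
  by (simp_all add: pos_inv_def)

lemma one_pos_inv [simp]: "1 \<in> pos_inv"
  by (simp add: pos_inv_def)

abbreviation pos_root :: "'a::unital_cstar_algebra \<Rightarrow> 'a" where
  "pos_root x \<equiv> pos_powr x (1/2)"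

lemma pos_root_pos: "x \<in> pos_cone \<Longrightarrow> pos_root x \<in> pos_cone"
  by (rule pos_powr_pos) auto

lemma pos_root_square: "x \<in> pos_cone \<Longrightarrow> pos_root x * pos_root x = x"
  by (simp add: pos_powr_add)

lemma pos_root_pos_inv: "x \<in> pos_inv \<Longrightarrow> pos_root x \<in> pos_inv"
  using selfadjoint_right_inverse[of "pos_root x" "pos_root x * inv_elem x"]
  by (simp add: pos_inv_def pos_root_pos pos_root_square inv_elem mult.assoc[symmetric])

lemma pos_inv_inv_elem: "x \<in> pos_inv \<Longrightarrow> inv_elem x \<in> pos_inv"
proof -
  assume x: "x \<in> pos_inv"
  then have "inv_elem x * x * inv_elem x \<in> pos_cone"
    by (intro conj_selfadjoint_pos selfadjoint_inv_elem) (auto simp: pos_inv_def)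
  then show ?thesis using x by (simp add: pos_inv_def inv_elem invertible_inv_elem)
qed

lemma pos_inv_conj:
  "x \<in> pos_inv \<Longrightarrow> selfadjoint c \<Longrightarrow> invertible_elem c \<Longrightarrow> c * x * c \<in> pos_inv"
  by (simp add: pos_inv_def conj_selfadjoint_pos invertible_mult)

lemma pos_le_scaleR: "x \<preceq> y \<Longrightarrow> 0 \<le> t \<Longrightarrow> t *\<^sub>R x \<preceq> t *\<^sub>R y"
  using pos_cone_scaleR[of "y - x" t] by (simp add: pos_le_def scaleR_diff_right)

text \<open>With v the inverse of x and r its positive root, conjugating v <= |v| by r gives 1 <=
  |v| x. Conversely, x - e would have the negative spectral value -e if x were singular.\<close>

lemma pos_inv_iff_bounded_below:
  "x \<in> pos_inv \<longleftrightarrow> (\<exists>e>0. e *\<^sub>R 1 \<preceq> x)"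
proof
  assume x: "x \<in> pos_inv"
  define r where "r = pos_root x"
  define v where "v = inv_elem x"
  have r: "selfadjoint r" "r * r = x" using x by (simp_all add: r_def pos_inv_def pos_root_pos pos_root_square)
  have v: "v \<in> pos_cone" using pos_inv_inv_elem[OF x] by (simp add: v_def pos_inv_def)
  have "v \<noteq> 0" using inv_elem(1)[OF pos_invD(2)[OF x]] by (auto simp: v_def)
  then have n: "norm v > 0" by simp
  have "v \<preceq> norm v *\<^sub>R 1" using pos_norm_le_iff[OF v, of "norm v"] by simp
  then have "r * v * r \<preceq> r * (norm v *\<^sub>R 1) * r" using r(1) by (rule pos_le_conj)
  moreover have "r * v * r = 1"
  proof -
    have "r * v = v * r" unfolding v_def
      by (rule inv_elem_commute) (use x r(2) in \<open>auto simp: pos_inv_def mult.assoc[symmetric]\<close>)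
    then have "r * v * r = v * x" using r(2) by (simp add: mult.assoc)
    then show ?thesis using x by (simp add: v_def pos_inv_def inv_elem)
  qed
  ultimately have "1 \<preceq> norm v *\<^sub>R x" using r(2) by simp
  then have "(1 / norm v) *\<^sub>R 1 \<preceq> (1 / norm v) *\<^sub>R (norm v *\<^sub>R x)" by (rule pos_le_scaleR) simp
  then show "\<exists>e>0. e *\<^sub>R 1 \<preceq> x" using n by (intro exI[of _ "1 / norm v"]) simp
next
  assume "\<exists>e>0. e *\<^sub>R 1 \<preceq> x"
  then obtain e where e: "e > 0" "x - e *\<^sub>R 1 \<in> pos_cone" by (auto simp: pos_le_def)
  have "0 \<notin> spectrum x"
  proof
    assume "0 \<in> spectrum x"
    then have "- complex_of_real e \<in> spectrum (x + (- complex_of_real e) *\<^sub>C 1)"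
      by (simp add: spectrum_shift del: scaleC_minus_left)
    then have "- complex_of_real e \<in> spectrum (x - e *\<^sub>R 1)" by (simp add: scaleC_of_real)
    from pos_coneD(2)[OF e(2) this] show False using e(1) by (auto simp flip: of_real_minus)
  qed
  moreover have "x \<in> pos_cone" using pos_cone_add[OF e(2) const_pos[of e]] e(1) by simp
  ultimately show "x \<in> pos_inv" by (simp add: pos_inv_def spectrum_def)
qed

lemma pos_inv_add_const: "x \<in> pos_cone \<Longrightarrow> e > 0 \<Longrightarrow> x + e *\<^sub>R 1 \<in> pos_inv"
  using pos_inv_iff_bounded_below[of "x + e *\<^sub>R 1"] by (auto simp: pos_le_def)

text \<open>For positive \<open>x\<close>, \<open>y\<close> this is the spectral radius of \<open>x * y\<close>.\<close>

definition pairing :: "'a::unital_cstar_algebra \<Rightarrow> 'a \<Rightarrow> real" where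
  "pairing x y = norm (pos_root x * y * pos_root x)"

text \<open>The two sides are |v w|^2 and |w v|^2, and w v is the adjoint of v w.\<close>

lemma norm_conj_swap:
  assumes "selfadjoint w" "selfadjoint v"
  shows "norm (w * (v * v) * w) = norm (v * (w * w) * v)"
proof -
  have "norm (w * (v * v) * w) = (norm (v * w))\<^sup>2"
    using cstar_identity[of "v * w"] assms by (simp add: star_mult selfadjoint_def mult.assoc)
  also have "norm (v * w) = norm (w * v)"
    using norm_star[of "v * w"] assms by (simp add: star_mult selfadjoint_def del: norm_star)
  also have "(norm (w * v))\<^sup>2 = norm (v * (w * w) * v)"
    using cstar_identity[of "w * v"] assms by (simp add: star_mult selfadjoint_def mult.assoc)
  finally show ?thesis .
qed

text \<open>By \<open>norm_conj_swap\<close> any selfadjoint square root of x gives the norm of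
  y^(1/2) x y^(1/2). This allows x itself as the root of x^2.\<close>

lemma pairing_eq:
  assumes "x \<in> pos_cone" "y \<in> pos_cone" "selfadjoint w" "w * w = x"
  shows "pairing x y = norm (w * y * w)"
proof -
  have *: "norm (u * y * u) = norm (pos_root y * x * pos_root y)" if "selfadjoint u" "u * u = x" for u
    using norm_conj_swap[OF that(1), of "pos_root y"] assms(2) that
    by (simp add: pos_root_square pos_root_pos)
  show ?thesis
    unfolding pairing_def using *[OF assms(3,4)] *[of "pos_root x"] assms(1)
    by (simp add: pos_root_square pos_root_pos)
qed

lemma pairing_sym:
  assumes "x \<in> pos_cone" "y \<in> pos_cone" shows "pairing x y = pairing y x"
  using norm_conj_swap[of "pos_root x" "pos_root y"] assms
  by (simp add: pairing_def pos_root_square pos_root_pos)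

lemma pairing_nonneg [simp]: "0 \<le> pairing x y"
  by (simp add: pairing_def)

lemma pairing_one: "x \<in> pos_cone \<Longrightarrow> pairing 1 x = norm x" "x \<in> pos_cone \<Longrightarrow> pairing x 1 = norm x"
  using pairing_eq[of 1 x 1] pairing_sym[of 1 x] by simp_all

lemma pairing_self: "x \<in> pos_cone \<Longrightarrow> pairing x x = (norm x)\<^sup>2"
proof -
  assume x: "x \<in> pos_cone"
  define r where "r = pos_root x"
  have "r * r = x" using x by (simp add: r_def pos_root_square)
  then have "pairing x x = norm (x * x)" unfolding pairing_def r_def[symmetric] by (metis mult.assoc)
  then show ?thesis using x selfadjoint_norm_mult[of x] by simp
qed

lemma pairing_mono:
  assumes "x \<in> pos_cone" "a \<in> pos_cone" "b \<in> pos_cone" "a \<preceq> b" shows "pairing a x \<le> pairing b x"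
proof -
  have "norm (pos_root x * a * pos_root x) \<le> norm (pos_root x * b * pos_root x)"
    using assms by (intro pos_norm_mono conj_selfadjoint_pos pos_le_conj) (auto simp: pos_root_pos)
  then show ?thesis using pairing_sym[of a x] pairing_sym[of b x] assms by (simp add: pairing_def)
qed

lemma pairing_scaleR:
  assumes "x \<in> pos_cone" "y \<in> pos_cone" "0 \<le> t" shows "pairing (t *\<^sub>R x) y = t * pairing x y"
  using pairing_sym[of "t *\<^sub>R x" y] pairing_sym[of x y] assms
  by (simp add: pairing_def pos_cone_scaleR)

text \<open>With s = y^(-1/2) the pairing is the norm of s x s; the bound s x s <= t becomes x <= t
  y on conjugating with y^(1/2). Through this equivalence the pairing controls both the order and
  the Thompson metric.\<close>

lemma pairing_inv_elem_le_iff: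
  assumes x: "x \<in> pos_cone" and y: "y \<in> pos_inv" and t: "0 \<le> t"
  shows "pairing x (inv_elem y) \<le> t \<longleftrightarrow> x \<preceq> t *\<^sub>R y"
proof -
  define r where "r = pos_root y"
  define s where "s = inv_elem r"
  have r: "r \<in> pos_inv" "r * r = y" using y by (simp_all add: r_def pos_root_pos_inv pos_root_square pos_invD)
  have s: "s \<in> pos_inv" "selfadjoint s" "selfadjoint r"
    using pos_inv_inv_elem[OF r(1)] r(1) by (auto simp: s_def dest: pos_invD)
  have rs: "r * s = 1" "s * r = 1" using inv_elem[OF pos_invD(2)[OF r(1)]] by (simp_all add: s_def)
  have rs': "r * (s * c) = c" "s * (r * c) = c" for c
    by (simp_all add: mult.assoc[symmetric] rs)
  have ss: "s * s = inv_elem y"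
    by (rule inv_elem_unique[symmetric]) (simp_all add: r(2)[symmetric] mult.assoc rs rs')
  have iy: "inv_elem y \<in> pos_cone" using pos_inv_inv_elem[OF y] by (rule pos_invD)
  have "pairing x (inv_elem y) = norm (s * x * s)"
    using pairing_sym[OF x iy] pairing_eq[OF iy x s(2) ss] by simp
  also have "\<dots> \<le> t \<longleftrightarrow> s * x * s \<preceq> t *\<^sub>R 1"
    using x t s(2) by (intro pos_norm_le_iff conj_selfadjoint_pos)
  also have "\<dots> \<longleftrightarrow> x \<preceq> t *\<^sub>R y"
  proof -
    have "r * (s * x * s) * r = x" "r * (t *\<^sub>R 1) * r = t *\<^sub>R y" "s * (t *\<^sub>R y) * s = t *\<^sub>R 1"
      by (simp_all add: r(2)[symmetric] mult.assoc rs rs')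
    then show ?thesis
      using pos_le_conj[of "s * x * s" "t *\<^sub>R 1" r] pos_le_conj[of x "t *\<^sub>R y" s] s(2,3) by metis
  qed
  finally show ?thesis .
qed

text \<open>Testing against \<open>x = (b + \<epsilon>)\<^sup>-\<^sup>1\<close> recovers the order.\<close>

lemma pos_le_iff_pairing:
  assumes a: "a \<in> pos_cone" and b: "b \<in> pos_cone"
  shows "a \<preceq> b \<longleftrightarrow> (\<forall>x\<in>pos_inv. pairing a x \<le> pairing b x)"
proof
  show "a \<preceq> b \<Longrightarrow> \<forall>x\<in>pos_inv. pairing a x \<le> pairing b x"
    using pairing_mono a b by (auto dest: pos_invD)
  assume *: "\<forall>x\<in>pos_inv. pairing a x \<le> pairing b x"
  have le: "b + (1 / real (Suc n)) *\<^sub>R 1 - a \<in> pos_cone" for n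
  proof -
    let ?y = "b + (1 / real (Suc n)) *\<^sub>R 1"
    have y: "?y \<in> pos_inv" using b by (intro pos_inv_add_const) auto
    have "b \<preceq> 1 *\<^sub>R ?y" using const_pos[of "1 / real (Suc n)"] by (simp add: pos_le_def)
    then have "pairing b (inv_elem ?y) \<le> 1" using pairing_inv_elem_le_iff[OF b y, of 1] by simp
    then have "pairing a (inv_elem ?y) \<le> 1" using * pos_inv_inv_elem[OF y] by fastforce
    then show ?thesis using pairing_inv_elem_le_iff[OF a y, of 1] by (simp add: pos_le_def)
  qed
  have "(\<lambda>n. b + (1 / real (Suc n)) *\<^sub>R 1 - a) \<longlonglongrightarrow> b + 0 *\<^sub>R 1 - a"
    by (intro tendsto_intros LIMSEQ_inverse_real_of_nat[unfolded inverse_eq_divide])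
  then show "a \<preceq> b" using pos_cone_LIMSEQ[OF le] by (simp add: pos_le_def)
qed

text \<open>The exponential of the Thompson metric.\<close>

definition thompson :: "'a::unital_cstar_algebra \<Rightarrow> 'a \<Rightarrow> real" where
  "thompson x y = max (pairing x (inv_elem y)) (pairing y (inv_elem x))"

lemma thompson_nonneg: "0 \<le> thompson x y"
  by (simp add: thompson_def le_max_iff_disj)

lemma thompson_le_iff:
  assumes "x \<in> pos_inv" "y \<in> pos_inv" "0 \<le> t"
  shows "thompson x y \<le> t \<longleftrightarrow> x \<preceq> t *\<^sub>R y \<and> y \<preceq> t *\<^sub>R x"
  using assms by (simp add: thompson_def pairing_inv_elem_le_iff pos_invD)

text \<open>Multiplicative because \<open>thompson\<close> is the exponential of the distance;
  accordingly, distance 0 corresponds to the value 1.\<close>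

lemma thompson_triangle:
  assumes "x \<in> pos_inv" "y \<in> pos_inv" "z \<in> pos_inv"
  shows "thompson x z \<le> thompson x y * thompson y z"
proof -
  have xy: "x \<preceq> thompson x y *\<^sub>R y" "y \<preceq> thompson x y *\<^sub>R x"
    using thompson_le_iff[of x y "thompson x y"] assms by (simp_all add: thompson_nonneg)
  have yz: "y \<preceq> thompson y z *\<^sub>R z" "z \<preceq> thompson y z *\<^sub>R y"
    using thompson_le_iff[of y z "thompson y z"] assms by (simp_all add: thompson_nonneg)
  have "x \<preceq> (thompson x y * thompson y z) *\<^sub>R z"
    using pos_le_trans[OF xy(1) pos_le_scaleR[OF yz(1) thompson_nonneg]] by simp
  moreover have "z \<preceq> (thompson x y * thompson y z) *\<^sub>R x"
    using pos_le_trans[OF yz(2) pos_le_scaleR[OF xy(2) thompson_nonneg]] by (simp add: mult.commute)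
  ultimately show ?thesis using assms by (simp add: thompson_le_iff thompson_nonneg)
qed

lemma thompson_conj_le:
  assumes "x \<in> pos_inv" "y \<in> pos_inv" "selfadjoint c" "invertible_elem c"
  shows "thompson (c * x * c) (c * y * c) \<le> thompson x y"
proof -
  have "x \<preceq> thompson x y *\<^sub>R y" "y \<preceq> thompson x y *\<^sub>R x"
    using thompson_le_iff[of x y "thompson x y"] assms by (simp_all add: thompson_nonneg)
  then show ?thesis
    using pos_le_conj[OF _ assms(3)] assms by (fastforce simp: thompson_le_iff thompson_nonneg pos_inv_conj)
qed

lemma thompson_conj:
  assumes "x \<in> pos_inv" "y \<in> pos_inv" "selfadjoint c" "invertible_elem c"
  shows "thompson (c * x * c) (c * y * c) = thompson x y"
proof (rule antisym)
  have "inv_elem c * (c * z * c) * inv_elem c = z" for z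
    by (simp add: mult.assoc inv_elem assms(4))
  then show "thompson x y \<le> thompson (c * x * c) (c * y * c)"
    using thompson_conj_le[OF pos_inv_conj[OF assms(1,3,4)] pos_inv_conj[OF assms(2,3,4)]
        selfadjoint_inv_elem[OF assms(3,4)] invertible_inv_elem[OF assms(4)]] by simp
qed (rule thompson_conj_le[OF assms])

lemma thompson_inv_elem:
  assumes "x \<in> pos_inv" "y \<in> pos_inv"
  shows "thompson (inv_elem x) (inv_elem y) = thompson x y"
  using assms pairing_sym[of "inv_elem x" y] pairing_sym[of "inv_elem y" x]
  by (simp add: thompson_def inv_elem_inv_elem pos_inv_inv_elem pos_invD max.commute)

section \<open>Point reflections and isometries of the Thompson metric\<close>

definition reflect :: "'a::unital_cstar_algebra \<Rightarrow> 'a \<Rightarrow> 'a" where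
  "reflect m x = m * inv_elem x * m"

lemma inv_elem_conj:
  "invertible_elem c \<Longrightarrow> invertible_elem x \<Longrightarrow> inv_elem (c * x * c) = inv_elem c * inv_elem x * inv_elem c"
  by (rule inv_elem_unique) (simp_all add: mult.assoc inv_elem)

lemma reflect_pos_inv: "m \<in> pos_inv \<Longrightarrow> x \<in> pos_inv \<Longrightarrow> reflect m x \<in> pos_inv"
  unfolding reflect_def by (intro pos_inv_conj pos_inv_inv_elem) (auto dest: pos_invD)

lemma reflect_reflect: "m \<in> pos_inv \<Longrightarrow> x \<in> pos_inv \<Longrightarrow> reflect m (reflect m x) = x"
  by (simp add: reflect_def inv_elem_conj inv_elem_inv_elem invertible_inv_elem pos_invD)
     (simp add: mult.assoc inv_elem pos_invD)

lemma reflect_self: "m \<in> pos_inv \<Longrightarrow> reflect m m = m"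
  by (simp add: reflect_def inv_elem pos_invD)

lemma thompson_reflect:
  assumes "m \<in> pos_inv" "x \<in> pos_inv" "y \<in> pos_inv"
  shows "thompson (reflect m x) (reflect m y) = thompson x y"
  using assms thompson_conj[of "inv_elem x" "inv_elem y" m]
  by (simp add: reflect_def thompson_inv_elem pos_inv_inv_elem pos_invD)

text \<open>A reflection moves a point by twice its distance from the centre, hence the square.
  Conjugation by m^(-1/2) reduces to m = 1, where the pair is z^-1, z and both pairings are squares
  of norms.\<close>

lemma thompson_reflect_self:
  assumes m: "m \<in> pos_inv" and x: "x \<in> pos_inv"
  shows "thompson (reflect m x) x = (thompson x m)\<^sup>2"
proof -
  define w where "w = pos_root m"
  define z where "z = inv_elem w * x * inv_elem w"
  have w: "w \<in> pos_inv" "w * w = m" using m by (simp_all add: w_def pos_root_pos_inv pos_root_square pos_invD)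
  have w': "selfadjoint w" "invertible_elem w" using w(1) by (auto dest: pos_invD)
  have z: "z \<in> pos_inv" unfolding z_def
    using x w' by (intro pos_inv_conj selfadjoint_inv_elem invertible_inv_elem)
  have zi: "invertible_elem z" "inv_elem z \<in> pos_inv" "inv_elem z \<in> pos_cone" "z \<in> pos_cone"
    using z pos_inv_inv_elem[OF z] by (auto dest: pos_invD)
  have xz: "x = w * z * w" by (simp add: z_def mult.assoc inv_elem w')
  have "reflect m x = w * inv_elem z * w"
    unfolding reflect_def w(2)[symmetric] xz
    by (simp add: inv_elem_conj w' zi) (simp add: mult.assoc inv_elem w')
  then have "thompson (reflect m x) x = thompson (inv_elem z) z"
    unfolding xz using z zi w' by (simp add: thompson_conj)
  also have "\<dots> = max ((norm (inv_elem z))\<^sup>2) ((norm z)\<^sup>2)"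
    using zi by (simp add: thompson_def inv_elem_inv_elem pairing_self)
  also have "\<dots> = (max (norm z) (norm (inv_elem z)))\<^sup>2"
    using power_mono[of "norm z" "norm (inv_elem z)" 2] power_mono[of "norm (inv_elem z)" "norm z" 2]
    by (auto simp: max_def)
  also have "max (norm z) (norm (inv_elem z)) = thompson z 1"
    using zi by (simp add: thompson_def pairing_one)
  also have "\<dots> = thompson x m"
    using thompson_conj[OF z one_pos_inv w'] by (simp add: xz[symmetric] w(2))
  finally show ?thesis .
qed

lemma thompson_eqI: "x \<in> pos_inv \<Longrightarrow> y \<in> pos_inv \<Longrightarrow> thompson x y \<le> 1 \<Longrightarrow> x = y"
  using thompson_le_iff[of x y 1] pos_le_antisym by auto

lemma reflect_fixed_point:
  assumes "m \<in> pos_inv" "x \<in> pos_inv" "reflect m x = x" shows "x = m"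
proof -
  have "thompson x x \<le> 1" using thompson_le_iff[of x x 1] assms by simp
  then have "(thompson x m)\<^sup>2 \<le> 1" using thompson_reflect_self[OF assms(1,2)] assms(3) by simp
  then have "thompson x m \<le> 1" by (simp add: abs_square_le_1 abs_le_iff)
  then show ?thesis using assms by (intro thompson_eqI)
qed

text \<open>Surjectivity is carried by an explicit inverse, so that compositions and inverses of
  isometries are again available as pairs of maps.\<close>

definition thompson_isometry ::
    "('a::unital_cstar_algebra \<Rightarrow> 'b::unital_cstar_algebra) \<Rightarrow> ('b \<Rightarrow> 'a) \<Rightarrow> bool" where
  "thompson_isometry g g' \<longleftrightarrow>
     (\<forall>x\<in>pos_inv. g x \<in> pos_inv \<and> g' (g x) = x) \<and> (\<forall>y\<in>pos_inv. g' y \<in> pos_inv \<and> g (g' y) = y) \<and>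
     (\<forall>x\<in>pos_inv. \<forall>y\<in>pos_inv. thompson (g x) (g y) = thompson x y)"

lemma thompson_isometry_inverse: "thompson_isometry g g' \<Longrightarrow> thompson_isometry g' g"
  unfolding thompson_isometry_def by metis

lemma thompson_isometry_compose:
  "thompson_isometry g g' \<Longrightarrow> thompson_isometry h h' \<Longrightarrow> thompson_isometry (h \<circ> g) (g' \<circ> h')"
  unfolding thompson_isometry_def by simp

lemma thompson_isometry_reflect: "m \<in> pos_inv \<Longrightarrow> thompson_isometry (reflect m) (reflect m)"
  unfolding thompson_isometry_def by (simp add: reflect_pos_inv reflect_reflect thompson_reflect)

text \<open>
  Vaisala's proof of the Mazur-Ulam theorem: if \<open>g\<close> is an isometry fixing \<open>a\<close> and its mirror image
  \<open>b\<close>, then so is the commutator of \<open>g\<close> with the reflection, and this commutator moves the centre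
  by twice the distance.
\<close>

lemma thompson_isometry_fixes_center:
  fixes g :: "'a::unital_cstar_algebra \<Rightarrow> 'a"
  assumes m: "m \<in> pos_inv" and a: "a \<in> pos_inv"
    and g: "thompson_isometry g g'" "g a = a" "g (reflect m a) = reflect m a"
  shows "g m = m"
proof -
  let ?b = "reflect m a"
  define W where "W = {g. (\<exists>g'. thompson_isometry g g') \<and> g a = a \<and> g ?b = ?b}"
  define S where "S = (\<lambda>g. thompson (g m) m) ` W"
  have b: "?b \<in> pos_inv" using m a by (rule reflect_pos_inv)
  have gW: "g \<in> W" using g by (auto simp: W_def)
  have in_pos: "h m \<in> pos_inv" if "h \<in> W" for h
    using that m by (auto simp: W_def thompson_isometry_def)
  \<comment> \<open>An isometry fixing \<open>a\<close> keeps m at its distance from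
    \<open>a\<close>, so h m stays within a fixed distance of m.\<close>
  have bdd: "bdd_above S"
  proof (rule bdd_aboveI)
    fix s assume "s \<in> S"
    then obtain h h' where h: "thompson_isometry h h'" "h a = a" "s = thompson (h m) m"
      by (auto simp: S_def W_def)
    have "h m \<in> pos_inv" "thompson (h m) (h a) = thompson m a"
      using h(1) m a by (auto simp: thompson_isometry_def)
    then show "s \<le> thompson m a * thompson a m"
      using thompson_triangle[of "h m" a m] h(2,3) m a by simp
  qed
  \<comment> \<open>Applying h' and then the reflection, which fixes m, to the pair
    \<open>reflect m (h m)\<close>, \<open>h m\<close> turns its distance, twice that of h m from m,
    into the distance of k m from m.\<close>
  have step: "(thompson (h m) m)\<^sup>2 \<in> S" if hW: "h \<in> W" for h
  proof -
    obtain h' where h: "thompson_isometry h h'" "h a = a" "h ?b = ?b" using hW by (auto simp: W_def)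
    have h': "h' a = a" "h' ?b = ?b" using h a b by (metis thompson_isometry_def)+
    define k where "k = reflect m \<circ> h' \<circ> reflect m \<circ> h"
    have "\<exists>k'. thompson_isometry k k'"
      unfolding k_def comp_assoc
      using thompson_isometry_compose thompson_isometry_reflect[OF m] h(1) thompson_isometry_inverse[OF h(1)]
      by blast
    moreover have "k a = a" "k ?b = ?b"
      using h(2,3) h' reflect_reflect[OF m a] by (simp_all add: k_def)
    ultimately have kW: "k \<in> W" by (auto simp: W_def)
    have hm: "h m \<in> pos_inv" using hW by (rule in_pos)
    have rhm: "reflect m (h m) \<in> pos_inv" using m hm by (rule reflect_pos_inv)
    have hrhm: "h' (reflect m (h m)) \<in> pos_inv" using h(1) rhm by (auto simp: thompson_isometry_def)
    have "(thompson (h m) m)\<^sup>2 = thompson (reflect m (h m)) (h m)"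
      using thompson_reflect_self[OF m hm] by simp
    also have "\<dots> = thompson (h' (reflect m (h m))) (h' (h m))"
      using thompson_isometry_inverse[OF h(1)] rhm hm by (simp add: thompson_isometry_def)
    also have "h' (h m) = m" using h(1) m by (simp add: thompson_isometry_def)
    also have "thompson (h' (reflect m (h m))) m = thompson (k m) m"
      using thompson_reflect[OF m hrhm m] reflect_self[OF m] by (simp add: k_def)
    finally show ?thesis using kW by (simp add: S_def)
  qed
  \<comment> \<open>Each s in S has s^2 in S, so s is at most the square root of the supremum. A
    supremum above 1 would then be at most its own square root.\<close>
  have "Sup S \<le> 1"
  proof (rule ccontr)
    assume "\<not> Sup S \<le> 1"
    then have S1: "Sup S > 1" by simp
    have "s \<le> sqrt (Sup S)" if s: "s \<in> S" for s
    proof -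
      obtain h where "h \<in> W" "s = thompson (h m) m" using s by (auto simp: S_def)
      then have "s\<^sup>2 \<le> Sup S" using step bdd by (auto intro: cSup_upper)
      then show ?thesis by (rule real_le_rsqrt)
    qed
    then have "Sup S \<le> sqrt (Sup S)" using gW by (intro cSup_least) (auto simp: S_def)
    moreover have "sqrt (Sup S) < Sup S"
      using S1 by (intro real_less_lsqrt) (auto simp: power2_eq_square)
    ultimately show False by simp
  qed
  moreover have "thompson (g m) m \<le> Sup S" using gW bdd by (auto simp: S_def intro!: cSup_upper)
  ultimately show ?thesis using in_pos[OF gW] m by (intro thompson_eqI) auto
qed

text \<open>The witness is the geometric mean m = w (w^-1 v w^-1)^(1/2) w with w = u^(1/2), the
  positive solution of the Riccati equation m u^-1 m = v.\<close>

lemma geometric_mean_exists: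
  assumes u: "u \<in> pos_inv" and v: "v \<in> pos_inv"
  obtains m where "m \<in> pos_inv" "reflect m u = v"
proof -
  define w where "w = pos_root u"
  define z where "z = pos_root (inv_elem w * v * inv_elem w)"
  have w: "w \<in> pos_inv" "w * w = u" using u by (simp_all add: w_def pos_root_pos_inv pos_root_square pos_invD)
  have w': "selfadjoint w" "invertible_elem w" using w(1) by (auto dest: pos_invD)
  have "inv_elem w * v * inv_elem w \<in> pos_inv"
    using v w' by (intro pos_inv_conj selfadjoint_inv_elem invertible_inv_elem)
  then have z: "z \<in> pos_inv" "z * z = inv_elem w * v * inv_elem w"
    by (simp_all add: z_def pos_root_pos_inv pos_root_square pos_invD)
  have "inv_elem u = inv_elem w * inv_elem w"
    using inv_elem_conj[of w 1] w w' by simp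
  then have "reflect (w * z * w) u = w * (z * z) * w"
    by (simp add: reflect_def mult.assoc inv_elem w')
  also have "\<dots> = v" by (simp add: z(2) mult.assoc inv_elem w')
  finally show ?thesis using that pos_inv_conj[OF z(1) w'] by blast
qed

text \<open>Let m' be the midpoint of T a and T (reflect m a). Going by T, reflecting in m',
  returning by T' and reflecting in m fixes both a and its mirror image, hence m. So reflection in
  m' fixes T m, which forces m' = T m.\<close>

lemma thompson_isometry_reflect_image:
  assumes T: "thompson_isometry T T'" and m: "m \<in> pos_inv" and a: "a \<in> pos_inv"
  shows "T (reflect m a) = reflect (T m) (T a)"
proof -
  have pos: "T m \<in> pos_inv" "T a \<in> pos_inv" "T (reflect m a) \<in> pos_inv"
    using T m a reflect_pos_inv[OF m a] by (auto simp: thompson_isometry_def)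
  obtain m' where m': "m' \<in> pos_inv" "reflect m' (T a) = T (reflect m a)"
    using geometric_mean_exists[OF pos(2,3)] .
  define g where "g = reflect m \<circ> T' \<circ> reflect m' \<circ> T"
  have inv: "T' (T x) = x" if "x \<in> pos_inv" for x using T that by (simp add: thompson_isometry_def)
  note isos = T thompson_isometry_reflect[OF m'(1)] thompson_isometry_inverse[OF T] thompson_isometry_reflect[OF m]
  have "\<exists>g'. thompson_isometry g g'"
    unfolding g_def comp_assoc
    by (rule exI) (rule thompson_isometry_compose[OF thompson_isometry_compose[OF
          thompson_isometry_compose[OF isos(1,2)] isos(3)] isos(4)])
  then obtain g' where "thompson_isometry g g'" ..
  moreover have "g a = a" using inv[OF reflect_pos_inv[OF m a]] reflect_reflect[OF m a] by (simp add: g_def m'(2))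
  moreover have "g (reflect m a) = reflect m a"
    using reflect_reflect[OF m'(1) pos(2)] inv[OF a] by (simp add: g_def m'(2))
  ultimately have gm: "g m = m" using thompson_isometry_fixes_center[OF m a] by blast
  have q: "reflect m' (T m) \<in> pos_inv" using m'(1) pos(1) by (rule reflect_pos_inv)
  then have "T' (reflect m' (T m)) \<in> pos_inv" using T by (simp add: thompson_isometry_def)
  then have "T' (reflect m' (T m)) = reflect m m"
    using gm reflect_reflect[OF m] by (metis comp_apply g_def)
  then have "T' (reflect m' (T m)) = m" by (simp add: reflect_self m)
  then have "reflect m' (T m) = T m" using q T by (metis thompson_isometry_def)
  then have "T m = m'" using reflect_fixed_point m'(1) pos(1) by blast
  then show ?thesis using m'(2) by simp
qed

section \<open>Cone bijections that preserve the pairing\<close>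

locale cone_iso =
  fixes \<psi> :: "'a::unital_cstar_algebra \<Rightarrow> 'b::unital_cstar_algebra" and \<psi>' :: "'b \<Rightarrow> 'a"
  assumes maps: "x \<in> pos_cone \<Longrightarrow> \<psi> x \<in> pos_cone" "y \<in> pos_cone \<Longrightarrow> \<psi>' y \<in> pos_cone"
    and inverse: "x \<in> pos_cone \<Longrightarrow> \<psi>' (\<psi> x) = x" "y \<in> pos_cone \<Longrightarrow> \<psi> (\<psi>' y) = y"
    and pairing: "x \<in> pos_cone \<Longrightarrow> z \<in> pos_cone \<Longrightarrow> pairing (\<psi> x) (\<psi> z) = pairing x z"
begin

text \<open>The inverse is a parameter of the locale, so the hypotheses are symmetric and every fact
  about \<open>\<psi>\<close> also holds for \<open>\<psi>'\<close>.\<close>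

lemma inverse_cone_iso: "cone_iso \<psi>' \<psi>"
proof
  show "pairing (\<psi>' x) (\<psi>' y) = pairing x y" if "x \<in> pos_cone" "y \<in> pos_cone" for x y
    using pairing[of "\<psi>' x" "\<psi>' y"] maps inverse that by simp
qed (use maps inverse in auto)

text \<open>The pairing determines the order. To obtain the inequality between images, a test
  element z is written as \<open>\<psi> (\<psi>' z)\<close>, which is where surjectivity
  enters.\<close>

lemma le_iff:
  assumes "x \<in> pos_cone" "y \<in> pos_cone" shows "\<psi> x \<preceq> \<psi> y \<longleftrightarrow> x \<preceq> y"
proof
  assume "\<psi> x \<preceq> \<psi> y"
  then have "pairing x z \<le> pairing y z" if "z \<in> pos_inv" for z
    using pairing_mono[of "\<psi> z" "\<psi> x" "\<psi> y"] pairing assms maps pos_invD(1)[OF that] by simp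
  then show "x \<preceq> y" using assms by (simp add: pos_le_iff_pairing)
next
  assume "x \<preceq> y"
  then have "pairing (\<psi> x) z \<le> pairing (\<psi> y) z" if "z \<in> pos_inv" for z
    using pairing_mono[of "\<psi>' z" x y] pairing[of x "\<psi>' z"] pairing[of y "\<psi>' z"] assms maps inverse pos_invD(1)[OF that]
    by simp
  then show "\<psi> x \<preceq> \<psi> y" using assms maps by (simp add: pos_le_iff_pairing)
qed

lemma scaleR:
  assumes "x \<in> pos_cone" "0 \<le> t" shows "\<psi> (t *\<^sub>R x) = t *\<^sub>R \<psi> x"
proof -
  have "pairing (\<psi> (t *\<^sub>R x)) z = pairing (t *\<^sub>R \<psi> x) z" if "z \<in> pos_inv" for z
    using pairing[of "t *\<^sub>R x" "\<psi>' z"] pairing[of x "\<psi>' z"] assms maps inverse pos_invD(1)[OF that]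
    by (simp add: pairing_scaleR pos_cone_scaleR)
  then show ?thesis
    using assms maps by (intro pos_le_antisym) (simp_all add: pos_le_iff_pairing pos_cone_scaleR)
qed

lemma norm: "x \<in> pos_cone \<Longrightarrow> norm (\<psi> x) = norm x"
  using pairing[of x x] by (simp add: pairing_self maps power2_eq_iff_nonneg)

text \<open>Both \<open>\<psi> 1\<close> and \<open>\<psi>' 1\<close> have norm at most 1 and so lie
  below 1; applying the monotone \<open>\<psi>\<close> to the second inequality gives the converse
  of the first.\<close>

lemma one: "\<psi> 1 = 1"
proof (rule pos_le_antisym)
  show "\<psi> 1 \<preceq> 1" using pos_norm_le_iff[of "\<psi> 1" 1] maps norm[of 1] by simp
  have "norm (\<psi>' 1) \<le> 1" using norm[of "\<psi>' 1"] maps(2)[of 1] inverse(2)[of 1] by simp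
  then have "\<psi>' 1 \<preceq> 1" using pos_norm_le_iff[of "\<psi>' 1" 1] maps(2)[of 1] by simp
  then show "1 \<preceq> \<psi> 1" using le_iff[of "\<psi>' 1" 1] maps(2)[of 1] inverse(2)[of 1] by simp
qed

lemma const: "0 \<le> t \<Longrightarrow> \<psi> (t *\<^sub>R 1) = t *\<^sub>R 1"
  by (simp add: scaleR one)

lemma pos_inv: "x \<in> pos_inv \<Longrightarrow> \<psi> x \<in> pos_inv"
proof -
  assume x: "x \<in> pos_inv"
  then obtain e where e: "e > 0" "e *\<^sub>R 1 \<preceq> x" using pos_inv_iff_bounded_below by blast
  then have "\<psi> (e *\<^sub>R 1) \<preceq> \<psi> x" using x by (simp add: le_iff pos_invD const_pos)
  then show ?thesis using e(1) const[of e] pos_inv_iff_bounded_below by auto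
qed

lemma inv_pos_inv: "y \<in> pos_inv \<Longrightarrow> \<psi>' y \<in> pos_inv"
  using inverse_cone_iso by (rule cone_iso.pos_inv)

lemma thompson: "x \<in> pos_inv \<Longrightarrow> y \<in> pos_inv \<Longrightarrow> thompson (\<psi> x) (\<psi> y) = thompson x y"
proof -
  assume xy: "x \<in> pos_inv" "y \<in> pos_inv"
  have "thompson (\<psi> x) (\<psi> y) \<le> t \<longleftrightarrow> thompson x y \<le> t" if t: "0 \<le> t" for t
    using xy t le_iff[of x "t *\<^sub>R y"] le_iff[of y "t *\<^sub>R x"]
    by (simp add: thompson_le_iff pos_inv pos_invD pos_cone_scaleR scaleR)
  from this[of "thompson x y"] this[of "thompson (\<psi> x) (\<psi> y)"] show ?thesis
    by (simp add: thompson_nonneg)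
qed

lemma thompson_isometry: "thompson_isometry \<psi> \<psi>'"
  unfolding thompson_isometry_def
  by (simp add: pos_inv inv_pos_inv inverse thompson pos_invD)

lemma inv_elem: "x \<in> pos_inv \<Longrightarrow> \<psi> (inv_elem x) = inv_elem (\<psi> x)"
  using thompson_isometry_reflect_image[OF thompson_isometry one_pos_inv, of x]
  by (simp add: reflect_def one)

text \<open>m x m is the reflection in m of the inverse of x, and \<open>\<psi>\<close> commutes
  with reflections and inverses.\<close>

lemma triple: "m \<in> pos_inv \<Longrightarrow> x \<in> pos_inv \<Longrightarrow> \<psi> (m * x * m) = \<psi> m * \<psi> x * \<psi> m"
  using thompson_isometry_reflect_image[OF thompson_isometry, of m "inv_elem x"]
  by (simp add: reflect_def inv_elem pos_inv_inv_elem pos_inv pos_invD inv_elem_inv_elem)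

end

section \<open>The derivative at the unit and Kadison's inequality\<close>

text \<open>Additivity gives integer homogeneity. Splitting N c into its integer part and a fraction
  in [0,1] bounds N times the defect by 2 |h|, and N is arbitrary.\<close>

lemma additive_bounded_scaleR:
  fixes T :: "'a::real_normed_vector \<Rightarrow> 'b::real_normed_vector"
  assumes V: "subspace V"
    and add: "\<And>h k. h \<in> V \<Longrightarrow> k \<in> V \<Longrightarrow> T (h + k) = T h + T k"
    and bound: "\<And>h. h \<in> V \<Longrightarrow> norm (T h) \<le> norm h"
    and h: "h \<in> V"
  shows "T (c *\<^sub>R h) = c *\<^sub>R T h"
proof -
  have zero: "T 0 = 0" using add[of 0 0] subspace_0[OF V] by simp
  have nat: "T (real n *\<^sub>R k) = real n *\<^sub>R T k" if "k \<in> V" for n k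
    by (induction n) (simp_all add: zero scaleR_add_left add that subspace_scale[OF V])
  have minus: "T (- k) = - T k" if "k \<in> V" for k
    using add[OF that subspace_neg[OF V that]] zero by (simp add: eq_neg_iff_add_eq_0 add.commute)
  have int: "T (of_int m *\<^sub>R k) = of_int m *\<^sub>R T k" if "k \<in> V" for m k
  proof (cases m)
    case (neg n)
    then show ?thesis using nat[OF that, of "Suc n"] minus[OF subspace_scale[OF V that, of "real (Suc n)"]]
      by (simp del: of_nat_Suc)
  qed (simp add: nat that)
  define D where "D = T (c *\<^sub>R h) - c *\<^sub>R T h"
  have "real (Suc n) * norm D \<le> 2 * norm h" for n
  proof -
    define N where "N = real (Suc n)"
    define f where "f = N * c - of_int \<lfloor>N * c\<rfloor>"
    have f: "0 \<le> f" "f \<le> 1" unfolding f_def by linarith+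
    have "N *\<^sub>R T (c *\<^sub>R h) = T ((N * c) *\<^sub>R h)"
      using nat[of "c *\<^sub>R h" "Suc n"] subspace_scale[OF V h, of c] by (simp add: N_def)
    also have "(N * c) *\<^sub>R h = of_int \<lfloor>N * c\<rfloor> *\<^sub>R h + f *\<^sub>R h" by (simp add: f_def scaleR_diff_left)
    also have "T \<dots> = of_int \<lfloor>N * c\<rfloor> *\<^sub>R T h + T (f *\<^sub>R h)"
      using h by (simp add: add subspace_scale[OF V] int)
    finally have "N *\<^sub>R D = T (f *\<^sub>R h) - f *\<^sub>R T h"
      by (simp add: D_def scaleR_diff_right f_def scaleR_diff_left)
    then have "N * norm D = norm (T (f *\<^sub>R h) - f *\<^sub>R T h)"
      by (metis N_def norm_scaleR abs_of_nat)
    also have "\<dots> \<le> norm (T (f *\<^sub>R h)) + norm (f *\<^sub>R T h)" by (rule norm_triangle_ineq4)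
    also have "\<dots> \<le> norm (f *\<^sub>R h) + norm (f *\<^sub>R h)"
      using bound[OF h] bound[of "f *\<^sub>R h"] subspace_scale[OF V h] f by (intro add_mono) (auto intro: mult_left_mono)
    also have "\<dots> \<le> 2 * norm h" using f mult_right_mono[of f 1 "norm h"] by simp
    finally show ?thesis by (simp add: N_def)
  qed
  then have "norm D \<le> 2 * norm h / real (Suc n)" for n by (simp add: pos_le_divide_eq mult.commute del: of_nat_Suc)
  moreover have "(\<lambda>n. 2 * norm h / real (Suc n)) \<longlonglongrightarrow> 0"
    using tendsto_mult_right_zero[OF LIMSEQ_inverse_real_of_nat, of "2 * norm h"] by (simp add: divide_inverse)
  ultimately have "norm D \<le> 0" by (intro LIMSEQ_le_const[where X = "\<lambda>n. 2 * norm h / real (Suc n)"]) auto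
  then show ?thesis by (simp add: D_def)
qed

text \<open>Hyers' direct method.\<close>

lemma quasi_additive_derivative:
  fixes G :: "'a::real_normed_vector \<Rightarrow> 'b::banach"
  assumes V: "subspace V" and r: "r > 0" and K: "K \<ge> 0"
    and quasi: "\<And>h k d. h \<in> V \<Longrightarrow> k \<in> V \<Longrightarrow> norm h \<le> d \<Longrightarrow> norm k \<le> d \<Longrightarrow> d \<le> r
        \<Longrightarrow> norm (G (h + k) - G h - G k) \<le> K * d\<^sup>2"
    and bound: "\<And>h. h \<in> V \<Longrightarrow> norm h \<le> r \<Longrightarrow> norm (G h) \<le> norm h"
  obtains T where "\<And>h k. h \<in> V \<Longrightarrow> k \<in> V \<Longrightarrow> T (h + k) = T h + T k"
    "\<And>c h. h \<in> V \<Longrightarrow> T (c *\<^sub>R h) = c *\<^sub>R T h"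
    "\<And>h. h \<in> V \<Longrightarrow> norm (T h) \<le> norm h"
    "\<And>h. h \<in> V \<Longrightarrow> norm h \<le> r \<Longrightarrow> norm (T h - G h) \<le> K * (norm h)\<^sup>2"
    "\<And>h. h \<in> V \<Longrightarrow> (\<lambda>n. 2 ^ n *\<^sub>R G ((1 / 2 ^ n) *\<^sub>R h)) \<longlonglongrightarrow> T h"
proof -
  define u where "u n h = (2 ^ n :: real) *\<^sub>R G ((1 / 2 ^ n) *\<^sub>R h)" for n h
  have sub: "c *\<^sub>R h \<in> V" if "h \<in> V" for c h using V that by (rule subspace_scale)
  \<comment> \<open>Quasi-additivity at 2^-(n+1) h has error of order 4^-(n+1), and rescaling costs
    only 2^n. The bound is stated with (1/2)^(n+1), whose sum is 1, so that the total deviation of T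
    from G is at most K |h|^2.\<close>
  have step: "norm (u (Suc n) h - u n h) \<le> K * (norm h)\<^sup>2 * (1/2) ^ Suc n" if h: "h \<in> V" "norm h \<le> r" for n h
  proof -
    define k where "k = (1 / 2 ^ Suc n) *\<^sub>R h"
    define d where "d = (1/2) ^ Suc n * norm h"
    have d: "0 \<le> d" "norm k \<le> d" by (simp_all add: k_def d_def power_one_over)
    have "(1/2::real) ^ Suc n \<le> 1" by (rule power_le_one) auto
    then have "d \<le> 1 * norm h" unfolding d_def by (rule mult_right_mono) simp
    then have "d \<le> r" using h(2) by simp
    then have q: "norm (G (k + k) - G k - G k) \<le> K * d\<^sup>2" using quasi[of k k d] d h sub by (simp add: k_def)
    have kk: "k + k = (1 / 2 ^ n) *\<^sub>R h" by (simp add: k_def scaleR_add_left[symmetric])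
    have "u (Suc n) h - u n h = - ((2 ^ n) *\<^sub>R (G (k + k) - G k - G k))"
      unfolding kk by (simp add: u_def k_def scaleR_diff_right scaleR_2[symmetric] mult.commute)
    then have "norm (u (Suc n) h - u n h) = 2 ^ n * norm (G (k + k) - G k - G k)" by simp
    also have "\<dots> \<le> 2 ^ n * (K * d\<^sup>2)" using q by (rule mult_left_mono) simp
    also have "\<dots> = K * (norm h)\<^sup>2 * ((1/2) ^ Suc n * (1/2))"
      by (simp add: d_def power2_eq_square power_one_over field_simps)
    also have "\<dots> \<le> K * (norm h)\<^sup>2 * ((1/2) ^ Suc n * 1)"
      using K by (intro mult_left_mono) auto
    finally show ?thesis by simp
  qed
  have geo: "(\<lambda>n. (1/2::real) ^ Suc n) sums 1" using power_half_series .
  have tele: "(\<Sum>i<n. u (Suc i) h - u i h) = u n h - u 0 h" for n h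
    by (rule sum_lessThan_telescope)
  have u0: "u 0 h = G h" for h by (simp add: u_def)
  have dist_G: "norm (u n h - G h) \<le> K * (norm h)\<^sup>2" if h: "h \<in> V" "norm h \<le> r" for n h
  proof -
    have "norm (u n h - G h) = norm (\<Sum>i<n. u (Suc i) h - u i h)"
      by (simp only: tele u0)
    also have "\<dots> \<le> (\<Sum>i<n. K * (norm h)\<^sup>2 * (1/2) ^ Suc i)" by (rule sum_norm_le) (rule step[OF h])
    also have "\<dots> = K * (norm h)\<^sup>2 * (\<Sum>i<n. (1/2) ^ Suc i)" by (rule sum_distrib_left[symmetric])
    also have "\<dots> \<le> K * (norm h)\<^sup>2 * 1"
      using sum_le_suminf[of "\<lambda>n. (1/2::real) ^ Suc n" "{..<n}"] geo K
      by (intro mult_left_mono) (auto simp: sums_iff)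
    finally show ?thesis by simp
  qed
  have small: "convergent (\<lambda>n. u n h)" if h: "h \<in> V" "norm h \<le> r" for h
  proof -
    have "summable (\<lambda>n. K * (norm h)\<^sup>2 * (1/2) ^ Suc n)" using geo by (intro summable_mult) (simp add: sums_iff)
    then have "summable (\<lambda>n. u (Suc n) h - u n h)"
      by (rule summable_comparison_test'[where N = 0]) (use step[OF h] in auto)
    then have "convergent (\<lambda>n. \<Sum>i<n. u (Suc i) h - u i h)" by (simp add: summable_iff_convergent)
    then have "convergent (\<lambda>n. u n h - u 0 h)" by (simp add: tele)
    then show ?thesis by (simp add: convergent_diff_const_right_iff)
  qed
  have shrink: "\<exists>N. (1 / 2 ^ N) * c \<le> r" for c :: real
  proof -
    have "(\<lambda>n. (1/2) ^ n * c) \<longlonglongrightarrow> 0 * c" by (intro tendsto_intros) auto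
    then have "\<forall>\<^sub>F n in sequentially. (1/2) ^ n * c < r" using r by (auto dest: order_tendstoD(2))
    then show ?thesis by (auto simp: eventually_sequentially power_one_over intro: less_imp_le)
  qed
  \<comment> \<open>For large h, shrink it by 2^N into the ball of radius r; undoing the scaling
    only shifts the index of the sequence by N.\<close>
  have conv: "convergent (\<lambda>n. u n h)" if h: "h \<in> V" for h
  proof -
    obtain N where N: "(1 / 2 ^ N) * norm h \<le> r" using shrink by blast
    let ?k = "(1 / 2 ^ N) *\<^sub>R h"
    have "convergent (\<lambda>n. u n ?k)" using N h sub by (intro small) auto
    then have "convergent (\<lambda>n. 2 ^ N *\<^sub>R u n ?k)"
      using tendsto_scaleR[OF tendsto_const] unfolding convergent_def by blast
    moreover have "(\<lambda>n. 2 ^ N *\<^sub>R u n ?k) = (\<lambda>n. u (n + N) h)"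
      by (simp add: u_def power_add fun_eq_iff mult.commute)
    ultimately show ?thesis using convergent_ignore_initial_segment[of "\<lambda>n. u n h" N] by simp
  qed
  define T where "T h = lim (\<lambda>n. u n h)" for h
  have T: "(\<lambda>n. u n h) \<longlonglongrightarrow> T h" if "h \<in> V" for h
    using conv[OF that] by (simp add: T_def convergent_LIMSEQ_iff)
  have ev: "\<forall>\<^sub>F n in sequentially. (1 / 2 ^ n) * c \<le> r" for c :: real
  proof -
    have "(\<lambda>n. (1/2) ^ n * c) \<longlonglongrightarrow> 0 * c" by (intro tendsto_intros) auto
    then have "\<forall>\<^sub>F n in sequentially. (1/2) ^ n * c < r" using r by (auto dest: order_tendstoD(2))
    then show ?thesis by eventually_elim (simp add: power_one_over)
  qed
  have bT: "norm (T h) \<le> norm h" if h: "h \<in> V" for h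
  proof (rule tendsto_upperbound[OF tendsto_norm[OF T[OF h]]])
    show "\<forall>\<^sub>F n in sequentially. norm (u n h) \<le> norm h"
      using ev[of "norm h"]
    proof eventually_elim
      case (elim n)
      then have "norm (G ((1 / 2 ^ n) *\<^sub>R h)) \<le> norm ((1 / 2 ^ n) *\<^sub>R h)" using h sub by (intro bound) auto
      then show ?case by (simp add: u_def field_simps)
    qed
  qed simp
  have aT: "T (h + k) = T h + T k" if hk: "h \<in> V" "k \<in> V" for h k
  proof -
    define c where "c = max (norm h) (norm k)"
    have lim: "(\<lambda>n. u n (h + k) - u n h - u n k) \<longlonglongrightarrow> T (h + k) - T h - T k"
      using hk by (intro tendsto_diff T subspace_add[OF V])
    have "\<forall>\<^sub>F n in sequentially. norm (u n (h + k) - u n h - u n k) \<le> K * c\<^sup>2 * (1/2) ^ n"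
      using ev[of c]
    proof eventually_elim
      case (elim n)
      have nrm: "norm ((1 / 2 ^ n) *\<^sub>R h) \<le> (1 / 2 ^ n) * c" "norm ((1 / 2 ^ n) *\<^sub>R k) \<le> (1 / 2 ^ n) * c"
        by (simp_all add: c_def divide_right_mono)
      have "norm (G ((1 / 2 ^ n) *\<^sub>R h + (1 / 2 ^ n) *\<^sub>R k) - G ((1 / 2 ^ n) *\<^sub>R h) - G ((1 / 2 ^ n) *\<^sub>R k))
          \<le> K * ((1 / 2 ^ n) * c)\<^sup>2"
        using elim hk sub by (intro quasi nrm) auto
      then have "2 ^ n * norm (G ((1 / 2 ^ n) *\<^sub>R (h + k)) - G ((1 / 2 ^ n) *\<^sub>R h) - G ((1 / 2 ^ n) *\<^sub>R k))
          \<le> 2 ^ n * (K * ((1 / 2 ^ n) * c)\<^sup>2)" by (simp add: scaleR_add_right)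
      also have "\<dots> = K * c\<^sup>2 * (1/2) ^ n" by (simp add: power2_eq_square power_one_over field_simps)
      finally show ?case
        by (simp add: u_def scaleR_diff_right[symmetric])
    qed
    moreover have "(\<lambda>n. K * c\<^sup>2 * (1/2) ^ n) \<longlonglongrightarrow> K * c\<^sup>2 * 0" by (intro tendsto_intros) auto
    ultimately have "(\<lambda>n. u n (h + k) - u n h - u n k) \<longlonglongrightarrow> 0"
      using Lim_null_comparison[of "\<lambda>n. u n (h + k) - u n h - u n k" "\<lambda>n. K * c\<^sup>2 * (1/2) ^ n"] by simp
    then have "T (h + k) - T h - T k = 0" using lim LIMSEQ_unique by blast
    then show ?thesis by (simp add: algebra_simps)
  qed
  show thesis
  proof
    show "T (c *\<^sub>R h) = c *\<^sub>R T h" if "h \<in> V" for c h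
      using additive_bounded_scaleR[OF V aT bT that] .
    show "norm (T h - G h) \<le> K * (norm h)\<^sup>2" if "h \<in> V" "norm h \<le> r" for h
      by (rule tendsto_upperbound[OF tendsto_norm[OF tendsto_diff[OF T[OF that(1)] tendsto_const]]])
         (use dist_G[OF that] in auto)
    show "(\<lambda>n. 2 ^ n *\<^sub>R G ((1 / 2 ^ n) *\<^sub>R h)) \<longlonglongrightarrow> T h" if "h \<in> V" for h
      using T[OF that] by (simp add: u_def)
  qed (use aT bT in auto)
qed

lemma subspace_selfadjoint: "subspace {h. selfadjoint h}"
  by (rule subspaceI) auto

lemma one_plus_small:
  assumes "selfadjoint h" "norm h \<le> c" "c < 1"
  shows "1 + h \<in> pos_inv" "(1 - c) *\<^sub>R 1 \<preceq> 1 + h" "1 + h \<preceq> (1 + c) *\<^sub>R 1"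
proof -
  have "h \<preceq> c *\<^sub>R 1" "- (c *\<^sub>R 1) \<preceq> h" using selfadjoint_norm_le_iff assms by blast+
  then show le: "(1 - c) *\<^sub>R 1 \<preceq> 1 + h" "1 + h \<preceq> (1 + c) *\<^sub>R 1"
    by (simp_all add: pos_le_def algebra_simps)
  show "1 + h \<in> pos_inv" unfolding pos_inv_iff_bounded_below
    using assms(3) le(1) by (intro exI[of _ "1 - c"]) simp
qed

context cone_iso
begin

definition G :: "'a \<Rightarrow> 'b" where "G h = \<psi> (1 + h) - 1"

lemma selfadjoint_G: "selfadjoint h \<Longrightarrow> norm h < 1 \<Longrightarrow> selfadjoint (G h)"
  using one_plus_small(1)[of h "norm h"] maps(1)[of "1 + h"] by (simp add: G_def pos_invD)

text \<open>1 + h lies between the constants 1 - |h| and 1 + |h|, which the monotone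
  \<open>\<psi>\<close> fixes.\<close>

lemma norm_G_le:
  assumes h: "selfadjoint h" "norm h < 1" shows "norm (G h) \<le> norm h"
proof -
  note s = one_plus_small[OF h(1) order_refl h(2)]
  have "\<psi> ((1 - norm h) *\<^sub>R 1) = (1 - norm h) *\<^sub>R 1" "\<psi> ((1 + norm h) *\<^sub>R 1) = (1 + norm h) *\<^sub>R 1"
    using h by (intro const; simp)+
  moreover have "\<psi> ((1 - norm h) *\<^sub>R 1) \<preceq> \<psi> (1 + h)" "\<psi> (1 + h) \<preceq> \<psi> ((1 + norm h) *\<^sub>R 1)"
    using s h by (simp_all add: le_iff pos_invD const_pos)
  ultimately have "(1 - norm h) *\<^sub>R 1 \<preceq> \<psi> (1 + h)" "\<psi> (1 + h) \<preceq> (1 + norm h) *\<^sub>R 1" by simp_all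
  then have "G h \<preceq> norm h *\<^sub>R 1" "- (norm h *\<^sub>R 1) \<preceq> G h"
    by (simp_all add: G_def pos_le_def algebra_simps)
  then show ?thesis using selfadjoint_norm_le_iff[OF selfadjoint_G[OF h]] by simp
qed

text \<open>With e = |h - k| and 1 + k >= 1/2 one has 1 + h <= 1 + k + e <= (1 + 2e)(1 + k).
  Monotonicity and homogeneity give G h - G k <= 2e \<open>\<psi>\<close> (1 + k), and
  \<open>\<psi>\<close> (1 + k) <= 3/2; hence the constant 3.\<close>

lemma G_lipschitz:
  assumes h: "selfadjoint h" "norm h \<le> 1/2" and k: "selfadjoint k" "norm k \<le> 1/2"
  shows "norm (G h - G k) \<le> 3 * norm (h - k)"
proof -
  define e where "e = norm (h - k)"
  have half: "G h - G k \<preceq> (3 * e) *\<^sub>R 1"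
    if h: "selfadjoint h" "norm h \<le> 1/2" and k: "selfadjoint k" "norm k \<le> 1/2" and e: "norm (h - k) = e" for h k
  proof -
    have e0: "e \<ge> 0" using e by auto
    have sh: "1 + h \<in> pos_cone" "1 + k \<in> pos_cone" "(1/2) *\<^sub>R 1 \<preceq> 1 + k" "1 + k \<preceq> (3/2) *\<^sub>R 1"
      using one_plus_small[OF h] one_plus_small[OF k] by (simp_all add: pos_invD)
    have "h - k \<preceq> e *\<^sub>R 1" using selfadjoint_norm_le_iff[of "h - k" e] h k e by simp
    then have "1 + h \<preceq> 1 + k + e *\<^sub>R 1" by (simp add: pos_le_def algebra_simps)
    also have "1 + k + e *\<^sub>R 1 \<preceq> (1 + 2 * e) *\<^sub>R (1 + k)"
      using pos_le_scaleR[OF sh(3), of "2 * e"] e0 by (simp add: pos_le_def algebra_simps)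
    finally have "\<psi> (1 + h) \<preceq> (1 + 2 * e) *\<^sub>R \<psi> (1 + k)"
      using e0 sh by (simp add: le_iff pos_cone_scaleR flip: scaleR)
    then have "\<psi> (1 + h) - \<psi> (1 + k) \<preceq> (2 * e) *\<^sub>R \<psi> (1 + k)" by (simp add: pos_le_def algebra_simps)
    also have "\<psi> (1 + k) \<preceq> (3/2) *\<^sub>R 1"
      using sh le_iff[of "1 + k" "(3/2) *\<^sub>R 1"] const[of "3/2"] const_pos[of "3/2"] by simp
    then have "(2 * e) *\<^sub>R \<psi> (1 + k) \<preceq> (3 * e) *\<^sub>R 1" using pos_le_scaleR[of _ _ "2 * e"] e0 by fastforce
    finally show ?thesis by (simp add: G_def)
  qed
  have "selfadjoint (G h - G k)" using h k by (simp add: selfadjoint_G)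
  moreover have "G h - G k \<preceq> (3 * e) *\<^sub>R 1" by (rule half) (use h k e_def in auto)
  moreover have "G k - G h \<preceq> (3 * e) *\<^sub>R 1" by (rule half) (use h k e_def norm_minus_commute in auto)
  then have "- ((3 * e) *\<^sub>R 1) \<preceq> G h - G k" by (simp add: pos_le_def algebra_simps)
  ultimately show ?thesis using selfadjoint_norm_le_iff[of "G h - G k" "3 * e"] by (simp add: e_def)
qed

text \<open>Expand the triple identity at 1 + h and 1 + k: the terms of second and third order, Q in
  the source and Q' in the target, have norm at most 4 d^2. Removing Q from the argument of G costs
  3 * 4 d^2 by the Lipschitz bound, and Q' costs 4 d^2. The restriction d <= 1/16 keeps the
  arguments within radius 1/2.\<close>

lemma G_triple:
  assumes h: "selfadjoint h" "norm h \<le> d" and k: "selfadjoint k" "norm k \<le> d" and d: "d \<le> 1/16"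
  shows "norm (G (2 *\<^sub>R h + k) - 2 *\<^sub>R G h - G k) \<le> 16 * d\<^sup>2"
proof -
  have d0: "0 \<le> d" using h(2) norm_ge_zero order_trans by blast
  have quad: "norm (x * x + x * y + y * x + x * y * x) \<le> 4 * d\<^sup>2"
    if "norm x \<le> d" "norm y \<le> d" for x y :: "'c::real_normed_algebra_1"
  proof -
    have m: "norm (a * b) \<le> d * d" if "norm a \<le> d" "norm b \<le> d" for a b :: 'c
      by (rule order_trans[OF norm_mult_ineq]) (use that d0 in \<open>intro mult_mono; auto\<close>)
    have "norm (x * y * x) \<le> (d * d) * 1"
      by (rule order_trans[OF norm_mult_ineq]) (use that d d0 m[OF that] in \<open>intro mult_mono; auto\<close>)
    then show ?thesis
      using m[OF that(1,1)] m[OF that] m[OF that(2,1)] norm_triangle_ineq[of "x * x + x * y + y * x" "x * y * x"]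
        norm_triangle_ineq[of "x * x + x * y" "y * x"] norm_triangle_ineq[of "x * x" "x * y"]
      by (simp add: power2_eq_square)
  qed
  define Q where "Q = h * h + h * k + k * h + h * k * h"
  define Q' where "Q' = G h * G h + G h * G k + G k * G h + G h * G k * G h"
  have Q: "norm Q \<le> 4 * d\<^sup>2" unfolding Q_def using h k by (intro quad) auto
  have "norm (G h) \<le> d" "norm (G k) \<le> d"
    using norm_G_le[of h] norm_G_le[of k] h k d by auto
  then have Q': "norm Q' \<le> 4 * d\<^sup>2" unfolding Q'_def by (rule quad)
  have saQ: "selfadjoint Q"
    using h(1) k(1) by (simp add: Q_def selfadjoint_def star_add star_mult mult.assoc add.commute add.left_commute)
  have d2: "d\<^sup>2 \<le> 1/256" using power_mono[OF d d0, of 2] by (simp add: power2_eq_square)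
  have n2: "norm (2 *\<^sub>R h + k) \<le> 3 * d" using norm_triangle_ineq[of "2 *\<^sub>R h" k] h k by simp
  have n3: "norm (2 *\<^sub>R h + k + Q) \<le> 3 * d + 4 * d\<^sup>2" using norm_triangle_ineq[of "2 *\<^sub>R h + k" Q] Q n2 by simp
  have "\<psi> ((1 + h) * (1 + k) * (1 + h)) = \<psi> (1 + h) * \<psi> (1 + k) * \<psi> (1 + h)"
    using h k d by (intro triple one_plus_small(1)[of _ d]) auto
  moreover have "(1 + h) * (1 + k) * (1 + h) = 1 + (2 *\<^sub>R h + k + Q)"
    by (simp add: Q_def algebra_simps scaleR_2)
  moreover have "\<psi> (1 + h) * \<psi> (1 + k) * \<psi> (1 + h) = 1 + (2 *\<^sub>R G h + G k + Q')"
  proof -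
    have "\<psi> (1 + h) = 1 + G h" "\<psi> (1 + k) = 1 + G k" by (simp_all add: G_def)
    then show ?thesis by (simp add: Q'_def algebra_simps scaleR_2)
  qed
  ultimately have "G (2 *\<^sub>R h + k + Q) = 2 *\<^sub>R G h + G k + Q'" by (simp add: G_def[of "2 *\<^sub>R h + k + Q"])
  then have eq: "G (2 *\<^sub>R h + k) - 2 *\<^sub>R G h - G k = (G (2 *\<^sub>R h + k) - G (2 *\<^sub>R h + k + Q)) + Q'"
    by simp
  have "norm (G (2 *\<^sub>R h + k) - G (2 *\<^sub>R h + k + Q)) \<le> 3 * norm ((2 *\<^sub>R h + k) - (2 *\<^sub>R h + k + Q))"
    using h k saQ n2 n3 d d2 by (intro G_lipschitz) auto
  then show ?thesis
    unfolding eq using norm_triangle_ineq[of "G (2 *\<^sub>R h + k) - G (2 *\<^sub>R h + k + Q)" Q'] Q Q' by simp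
qed

text \<open>Use \<open>G_triple\<close> with h/2, once with k and once with 0, and eliminate 2 G
  (h/2); the two errors of 16 d^2 add up.\<close>

lemma G_quasi_additive:
  assumes h: "selfadjoint h" "norm h \<le> d" and k: "selfadjoint k" "norm k \<le> d" and d: "d \<le> 1/16"
  shows "norm (G (h + k) - G h - G k) \<le> 32 * d\<^sup>2"
proof -
  have G0: "G 0 = 0" by (simp add: G_def one)
  let ?h = "(1/2) *\<^sub>R h"
  have d0: "0 \<le> d" using h(2) norm_ge_zero order_trans by blast
  have h2: "selfadjoint ?h" "norm ?h \<le> d" using h d0 by auto
  have "norm (G h - 2 *\<^sub>R G ?h) \<le> 16 * d\<^sup>2" using G_triple[OF h2, of 0] d d0 by (simp add: G0)
  moreover have "norm (G (h + k) - 2 *\<^sub>R G ?h - G k) \<le> 16 * d\<^sup>2" using G_triple[OF h2 k d] by simp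
  moreover have "G (h + k) - G h - G k = (G (h + k) - 2 *\<^sub>R G ?h - G k) - (G h - 2 *\<^sub>R G ?h)" by simp
  then have "norm (G (h + k) - G h - G k) \<le> norm (G (h + k) - 2 *\<^sub>R G ?h - G k) + norm (G h - 2 *\<^sub>R G ?h)"
    by (simp only: norm_triangle_ineq4)
  ultimately show ?thesis by linarith
qed

text \<open>Positivity of T is inherited by the limit because \<open>\<psi>\<close> is monotone, and
  T 1 = 1 because \<open>\<psi>\<close> fixes constants. Splitting into positive and negative parts
  then shows that T keeps selfadjointness.\<close>

lemma derivative_exists:
  obtains T where "\<And>h k. selfadjoint h \<Longrightarrow> selfadjoint k \<Longrightarrow> T (h + k) = T h + T k"
    "\<And>c h. selfadjoint h \<Longrightarrow> T (c *\<^sub>R h) = c *\<^sub>R T h"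
    "\<And>h. selfadjoint h \<Longrightarrow> selfadjoint (T h)"
    "\<And>h. selfadjoint h \<Longrightarrow> norm (T h) \<le> norm h"
    "T 1 = 1"
    "\<And>h. h \<in> pos_cone \<Longrightarrow> T h \<in> pos_cone"
    "\<And>h. selfadjoint h \<Longrightarrow> norm h \<le> 1/16 \<Longrightarrow> norm (T h - G h) \<le> 32 * (norm h)\<^sup>2"
proof -
  obtain T where T: "\<And>h k. selfadjoint h \<Longrightarrow> selfadjoint k \<Longrightarrow> T (h + k) = T h + T k"
    "\<And>c h. selfadjoint h \<Longrightarrow> T (c *\<^sub>R h) = c *\<^sub>R T h"
    "\<And>h. selfadjoint h \<Longrightarrow> norm (T h) \<le> norm h"
    "\<And>h. selfadjoint h \<Longrightarrow> norm h \<le> 1/16 \<Longrightarrow> norm (T h - G h) \<le> 32 * (norm h)\<^sup>2"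
    and lim: "\<And>h. selfadjoint h \<Longrightarrow> (\<lambda>n. 2 ^ n *\<^sub>R G ((1 / 2 ^ n) *\<^sub>R h)) \<longlonglongrightarrow> T h"
    by (rule quasi_additive_derivative[OF subspace_selfadjoint, of "1/16" 32 G])
       (auto intro: G_quasi_additive norm_G_le)
  have pos: "T h \<in> pos_cone" if h: "h \<in> pos_cone" for h
  proof (rule pos_cone_LIMSEQ[OF _ lim])
    fix n
    have k: "(1 / 2 ^ n) *\<^sub>R h \<in> pos_cone" using h by (intro pos_cone_scaleR) auto
    then have "1 \<preceq> 1 + (1 / 2 ^ n) *\<^sub>R h" by (simp add: pos_le_def)
    then have "\<psi> 1 \<preceq> \<psi> (1 + (1 / 2 ^ n) *\<^sub>R h)" using k by (simp add: le_iff pos_cone_add)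
    then have "G ((1 / 2 ^ n) *\<^sub>R h) \<in> pos_cone" by (simp add: G_def one pos_le_def)
    then show "2 ^ n *\<^sub>R G ((1 / 2 ^ n) *\<^sub>R h) \<in> pos_cone" by (intro pos_cone_scaleR) auto
  qed (use h in simp)
  have one: "T 1 = 1"
  proof -
    have "2 ^ n *\<^sub>R G ((1 / 2 ^ n) *\<^sub>R 1) = 1" for n
      using const[of "1 + 1 / 2 ^ n"] by (simp add: G_def scaleR_add_left)
    then have "(\<lambda>_::nat. 1) \<longlonglongrightarrow> T 1" using lim[of 1] by simp
    then show ?thesis using tendsto_const LIMSEQ_unique by blast
  qed
  have sa: "selfadjoint (T h)" if h: "selfadjoint h" for h
  proof -
    obtain p n where pn: "p \<in> pos_cone" "n \<in> pos_cone" "h = p - n"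
      using pos_neg_parts[OF h] by metis
    then have "T h = T p + (-1) *\<^sub>R T n" using T(1)[of p "(-1) *\<^sub>R n"] T(2)[of n "-1"] by simp
    then show ?thesis using pos[OF pn(1)] pos[OF pn(2)] by simp
  qed
  show thesis using that[of T] T pos one sa by blast
qed

end

text \<open>The Bernstein polynomial (n choose i) a^i (1 - a)^(n - i), in Pascal's recursion; this
  form makes positivity and the moments plain inductions in a noncommutative algebra.\<close>

primrec bernstein :: "'a::real_algebra_1 \<Rightarrow> nat \<Rightarrow> nat \<Rightarrow> 'a" where
  "bernstein a 0 i = (if i = 0 then 1 else 0)"
| "bernstein a (Suc n) i = (1 - a) * bernstein a n i + (case i of 0 \<Rightarrow> 0 | Suc j \<Rightarrow> a * bernstein a n j)"

lemma bernstein_eq_0: "n < i \<Longrightarrow> bernstein a n i = 0"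
  by (induction n arbitrary: i) (auto split: nat.split)

lemma bernstein_commute: "a * bernstein a n i = bernstein a n i * a"
proof (induction n arbitrary: i)
  case (Suc n)
  then have "a * (bernstein a n i * x) = bernstein a n i * (a * x)" for i x by (metis mult.assoc)
  then show ?case using Suc by (auto simp: algebra_simps split: nat.split)
qed simp

lemma sum_bernstein_Suc:
  "(\<Sum>i\<le>Suc n. g i *\<^sub>R bernstein a (Suc n) i)
    = (1 - a) * (\<Sum>i\<le>n. g i *\<^sub>R bernstein a n i) + a * (\<Sum>i\<le>n. g (Suc i) *\<^sub>R bernstein a n i)"
proof -
  have "(\<Sum>i\<le>Suc n. g i *\<^sub>R bernstein a (Suc n) i)
      = (\<Sum>i\<le>Suc n. g i *\<^sub>R ((1 - a) * bernstein a n i))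
        + (\<Sum>i\<le>Suc n. g i *\<^sub>R (case i of 0 \<Rightarrow> 0 | Suc j \<Rightarrow> a * bernstein a n j))"
    by (simp add: scaleR_add_right sum.distrib del: sum.atMost_Suc)
  also have "(\<Sum>i\<le>Suc n. g i *\<^sub>R (case i of 0 \<Rightarrow> 0 | Suc j \<Rightarrow> a * bernstein a n j))
      = (\<Sum>i\<le>n. g (Suc i) *\<^sub>R (a * bernstein a n i))"
    by (subst sum.atMost_Suc_shift) simp
  also have "(\<Sum>i\<le>Suc n. g i *\<^sub>R ((1 - a) * bernstein a n i)) = (\<Sum>i\<le>n. g i *\<^sub>R ((1 - a) * bernstein a n i))"
    by (simp add: bernstein_eq_0)
  finally show ?thesis by (simp add: sum_distrib_left)
qed

text \<open>The binomial moments of order 0, 1 and 2. After division by n^2 the variance term of the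
  last becomes (a - a^2)/n, which vanishes in the limit.\<close>

lemma bernstein_moments:
  "(\<Sum>i\<le>n. bernstein a n i) = 1"
  "(\<Sum>i\<le>n. real i *\<^sub>R bernstein a n i) = real n *\<^sub>R a"
  "(\<Sum>i\<le>n. (real i)\<^sup>2 *\<^sub>R bernstein a n i) = (real n)\<^sup>2 *\<^sub>R (a * a) + real n *\<^sub>R (a - a * a)"
proof -
  have 0: "(\<Sum>i\<le>n. bernstein a n i) = 1" for n
  proof (induction n)
    case (Suc n)
    then show ?case using sum_bernstein_Suc[of "\<lambda>_. 1" a n] by (simp add: algebra_simps)
  qed simp
  have 1: "(\<Sum>i\<le>n. real i *\<^sub>R bernstein a n i) = real n *\<^sub>R a" for n
  proof (induction n)
    case (Suc n)
    have "(\<Sum>i\<le>n. real (Suc i) *\<^sub>R bernstein a n i) = real n *\<^sub>R a + 1"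
      using Suc 0[of n] by (simp add: scaleR_add_left sum.distrib)
    then show ?case unfolding sum_bernstein_Suc[of real] Suc by (simp add: algebra_simps)
  qed simp
  have 2: "(\<Sum>i\<le>n. (real i)\<^sup>2 *\<^sub>R bernstein a n i) = (real n)\<^sup>2 *\<^sub>R (a * a) + real n *\<^sub>R (a - a * a)" for n
  proof (induction n)
    case (Suc n)
    have "(\<Sum>i\<le>n. (real (Suc i))\<^sup>2 *\<^sub>R bernstein a n i)
        = (\<Sum>i\<le>n. (real i)\<^sup>2 *\<^sub>R bernstein a n i + 2 *\<^sub>R (real i *\<^sub>R bernstein a n i) + bernstein a n i)"
      by (intro sum.cong refl) (simp add: power2_eq_square algebra_simps)
    also have "\<dots> = (\<Sum>i\<le>n. (real i)\<^sup>2 *\<^sub>R bernstein a n i) + 2 *\<^sub>R (real n *\<^sub>R a) + 1"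
      unfolding sum.distrib scaleR_sum_right[symmetric] 0 1 ..
    finally have s: "(\<Sum>i\<le>n. (real (Suc i))\<^sup>2 *\<^sub>R bernstein a n i)
        = (\<Sum>i\<le>n. (real i)\<^sup>2 *\<^sub>R bernstein a n i) + 2 *\<^sub>R (real n *\<^sub>R a) + 1" .
    show ?case unfolding sum_bernstein_Suc[of "\<lambda>i. (real i)\<^sup>2"] s Suc
      by (simp add: algebra_simps power2_eq_square)
  qed simp
  show "(\<Sum>i\<le>n. bernstein a n i) = 1" "(\<Sum>i\<le>n. real i *\<^sub>R bernstein a n i) = real n *\<^sub>R a"
    "(\<Sum>i\<le>n. (real i)\<^sup>2 *\<^sub>R bernstein a n i) = (real n)\<^sup>2 *\<^sub>R (a * a) + real n *\<^sub>R (a - a * a)"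
    by (fact 0 1 2)+
qed

lemma bernstein_pos:
  assumes "a \<in> pos_cone" "1 - a \<in> pos_cone" shows "bernstein a n i \<in> pos_cone"
proof (induction n arbitrary: i)
  case (Suc n)
  have "(1 - a) * bernstein a n i \<in> pos_cone" "a * bernstein a n j \<in> pos_cone" for i j
    by (rule commuting_mult_pos[OF assms(2) Suc], simp add: left_diff_distrib right_diff_distrib bernstein_commute)
       (rule commuting_mult_pos[OF assms(1) Suc bernstein_commute])
  then show ?case by (auto split: nat.split intro: pos_cone_add)
qed auto

locale unital_positive =
  fixes T :: "'a::unital_cstar_algebra \<Rightarrow> 'b::unital_cstar_algebra"
  assumes add: "selfadjoint h \<Longrightarrow> selfadjoint k \<Longrightarrow> T (h + k) = T h + T k"
    and scaleR: "selfadjoint h \<Longrightarrow> T (c *\<^sub>R h) = c *\<^sub>R T h"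
    and selfadjoint: "selfadjoint h \<Longrightarrow> selfadjoint (T h)"
    and one: "T 1 = 1"
    and pos: "h \<in> pos_cone \<Longrightarrow> T h \<in> pos_cone"
begin

lemma diff: "selfadjoint h \<Longrightarrow> selfadjoint k \<Longrightarrow> T (h - k) = T h - T k"
  using add[of h "(-1) *\<^sub>R k"] scaleR[of k "-1"] by simp

lemma sum: "(\<And>i. i \<in> I \<Longrightarrow> selfadjoint (f i)) \<Longrightarrow> T (\<Sum>i\<in>I. f i) = (\<Sum>i\<in>I. T (f i))"
proof -
  have zero: "T 0 = 0" using scaleR[of 0 0] by simp
  show "(\<And>i. i \<in> I \<Longrightarrow> selfadjoint (f i)) \<Longrightarrow> T (\<Sum>i\<in>I. f i) = (\<Sum>i\<in>I. T (f i))"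
  proof (induction I rule: infinite_finite_induct)
    case (insert x F)
    have "selfadjoint (sum f F)"
      using insert.prems subspace_sum[OF subspace_selfadjoint, of F f] by auto
    then show ?case using insert by (simp add: add)
  qed (simp_all add: zero)
qed

text \<open>
  Kadison's inequality. For a partition of unity \<open>F\<^sub>i \<ge> 0\<close> with \<open>Y = \<Sum> t\<^sub>i F\<^sub>i\<close> one has
  \<open>\<Sum> t\<^sub>i\<^sup>2 F\<^sub>i - Y\<^sup>2 = \<Sum> (t\<^sub>i - Y) F\<^sub>i (t\<^sub>i - Y) \<ge> 0\<close>; take \<open>F\<^sub>i\<close> to be the image of the Bernstein basis.
\<close>

lemma kadison:
  assumes a: "a \<in> pos_cone" "1 - a \<in> pos_cone" shows "T a * T a \<preceq> T (a * a)"
proof -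
  have sa: "selfadjoint a" "selfadjoint (T a)" using a selfadjoint by auto
  \<comment> \<open>For finite n the second moment of the partition of unity is T (a^2) plus the
    variance T (a - a^2)/n; the limit at the end removes the extra term.\<close>
  have "T (a * a) + (1 / real (Suc m)) *\<^sub>R T (a - a * a) - T a * T a \<in> pos_cone" for m
  proof -
    define n where "n = Suc m"
    define F where "F i = T (bernstein a n i)" for i
    define t where "t i = real i / real n" for i
    have n: "real n > 0" by (simp add: n_def)
    have B: "selfadjoint (bernstein a n i)" for i using bernstein_pos[OF a] by simp
    have F: "F i \<in> pos_cone" for i unfolding F_def using bernstein_pos[OF a] by (rule pos)
    have F0: "(\<Sum>i\<le>n. F i) = 1"
      unfolding F_def using sum[of "{..n}" "bernstein a n"] B by (simp add: bernstein_moments(1) one)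
    have F1: "(\<Sum>i\<le>n. t i *\<^sub>R F i) = T a"
    proof -
      have "(\<Sum>i\<le>n. t i *\<^sub>R F i) = (1 / real n) *\<^sub>R (\<Sum>i\<le>n. real i *\<^sub>R F i)"
        by (simp add: scaleR_sum_right t_def)
      also have "(\<Sum>i\<le>n. real i *\<^sub>R F i) = T (\<Sum>i\<le>n. real i *\<^sub>R bernstein a n i)"
        unfolding F_def by (subst sum) (simp_all add: B scaleR)
      finally show ?thesis using n sa by (simp add: bernstein_moments(2) scaleR)
    qed
    have F2: "(\<Sum>i\<le>n. (t i)\<^sup>2 *\<^sub>R F i) = T (a * a) + (1 / real n) *\<^sub>R T (a - a * a)"
    proof -
      have "(\<Sum>i\<le>n. (t i)\<^sup>2 *\<^sub>R F i) = (1 / (real n)\<^sup>2) *\<^sub>R (\<Sum>i\<le>n. (real i)\<^sup>2 *\<^sub>R F i)"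
        by (simp add: scaleR_sum_right t_def power_divide)
      also have "(\<Sum>i\<le>n. (real i)\<^sup>2 *\<^sub>R F i) = T (\<Sum>i\<le>n. (real i)\<^sup>2 *\<^sub>R bernstein a n i)"
        unfolding F_def by (subst sum) (simp_all add: B scaleR)
      finally show ?thesis using n sa unfolding bernstein_moments(3)
        by (simp add: scaleR add scaleR_add_right power2_eq_square)
    qed
    have "(\<Sum>i\<le>n. (t i *\<^sub>R 1 - T a) * F i * (t i *\<^sub>R 1 - T a)) \<in> pos_cone"
      using F sa by (intro pos_cone_sum conj_selfadjoint_pos) auto
    also have "(\<Sum>i\<le>n. (t i *\<^sub>R 1 - T a) * F i * (t i *\<^sub>R 1 - T a))
        = (\<Sum>i\<le>n. (t i)\<^sup>2 *\<^sub>R F i - (t i *\<^sub>R F i) * T a - T a * (t i *\<^sub>R F i) + T a * F i * T a)"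
      by (intro sum.cong refl) (simp add: algebra_simps power2_eq_square)
    also have "\<dots> = (\<Sum>i\<le>n. (t i)\<^sup>2 *\<^sub>R F i) - (\<Sum>i\<le>n. t i *\<^sub>R F i) * T a
        - T a * (\<Sum>i\<le>n. t i *\<^sub>R F i) + T a * (\<Sum>i\<le>n. F i) * T a"
      by (simp only: sum.distrib sum_subtractf sum_distrib_left sum_distrib_right)
    also have "\<dots> = T (a * a) + (1 / real n) *\<^sub>R T (a - a * a) - T a * T a"
      unfolding F0 F1 F2 by simp
    finally show ?thesis by (simp add: n_def)
  qed
  moreover have "(\<lambda>m. T (a * a) + (1 / real (Suc m)) *\<^sub>R T (a - a * a) - T a * T a)
      \<longlonglongrightarrow> T (a * a) + 0 *\<^sub>R T (a - a * a) - T a * T a"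
    by (intro tendsto_intros LIMSEQ_inverse_real_of_nat[unfolded inverse_eq_divide])
  ultimately show ?thesis using pos_cone_LIMSEQ by (fastforce simp: pos_le_def)
qed

end

section \<open>Construction of the Jordan isomorphism\<close>

lemma (in unital_positive) mono: "selfadjoint h \<Longrightarrow> selfadjoint k \<Longrightarrow> h \<preceq> k \<Longrightarrow> T h \<preceq> T k"
  using pos[of "k - h"] diff[of k h] by (simp add: pos_le_def)

text \<open>The affine change a = (h + c)/(2c) brings h into the range [0,1] of Kadison's
  inequality. That inequality for T' at b = T a, pushed forward by T, is the reverse of the one for
  T at a; expanding the square returns from a to h.\<close>

lemma unital_positive_square:
  assumes T: "unital_positive T" and T': "unital_positive T'"
    and inv: "\<And>h. selfadjoint h \<Longrightarrow> T' (T h) = h" "\<And>k. selfadjoint k \<Longrightarrow> T (T' k) = k"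
    and h: "selfadjoint h"
  shows "T (h * h) = T h * T h"
proof (cases "h = 0")
  case True
  then show ?thesis using unital_positive.scaleR[OF T, of 0 0] by simp
next
  case False
  interpret T: unital_positive T by fact
  interpret T': unital_positive T' by fact
  define c where "c = norm h"
  define a where "a = (1 / (2 * c)) *\<^sub>R (h + c *\<^sub>R 1)"
  have c: "c > 0" using False by (simp add: c_def)
  have sa: "selfadjoint a" using h by (simp add: a_def)
  have "h \<preceq> c *\<^sub>R 1" "- (c *\<^sub>R 1) \<preceq> h" using selfadjoint_norm_le_iff[OF h, of c] by (simp_all add: c_def)
  then have "h + c *\<^sub>R 1 \<in> pos_cone" "c *\<^sub>R 1 - h \<in> pos_cone" by (simp_all add: pos_le_def)
  moreover have "1 - a = (1 / (2 * c)) *\<^sub>R (c *\<^sub>R 1 - h)"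
  proof -
    have "(1 / (2 * c)) *\<^sub>R (c *\<^sub>R 1 - h) + a = (1 / (2 * c)) *\<^sub>R ((2 * c) *\<^sub>R 1)"
      by (simp only: a_def scaleR_add_right[symmetric]) (simp add: scaleR_add_left[symmetric])
    then show ?thesis using c by (simp add: algebra_simps)
  qed
  ultimately have a: "a \<in> pos_cone" "1 - a \<in> pos_cone"
    using c pos_cone_scaleR[of _ "1 / (2 * c)"] by (simp_all add: a_def)
  define b where "b = T a"
  have b: "b \<in> pos_cone" "1 - b \<in> pos_cone"
    using T.pos[OF a(1)] T.pos[OF a(2)] sa by (simp_all add: b_def T.diff T.one)
  have sab: "selfadjoint b" "selfadjoint (b * b)" using b by simp_all
  have "b * b \<preceq> T (a * a)" unfolding b_def using a by (rule T.kadison)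
  moreover have "a * a \<preceq> T' (b * b)" using T'.kadison[OF b] inv(1)[OF sa] by (simp add: b_def)
  then have "T (a * a) \<preceq> b * b"
    using T.mono[of "a * a" "T' (b * b)"] inv(2)[OF sab(2)] T'.selfadjoint[OF sab(2)] sa by simp
  ultimately have sq: "T (a * a) = T a * T a" unfolding b_def using pos_le_antisym by blast
  have ha: "h = (2 * c) *\<^sub>R a - c *\<^sub>R 1" using c by (simp add: a_def)
  have "h * h = (4 * c\<^sup>2) *\<^sub>R (a * a) - (4 * c\<^sup>2) *\<^sub>R a + c\<^sup>2 *\<^sub>R 1"
    unfolding ha by (simp add: algebra_simps power2_eq_square scaleR_add_left[symmetric])
  then have "T (h * h) = (4 * c\<^sup>2) *\<^sub>R (T a * T a) - (4 * c\<^sup>2) *\<^sub>R T a + c\<^sup>2 *\<^sub>R 1"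
    using sa by (simp add: T.add T.diff T.scaleR T.one sq)
  also have "\<dots> = ((2 * c) *\<^sub>R T a - c *\<^sub>R 1) * ((2 * c) *\<^sub>R T a - c *\<^sub>R 1)"
    by (simp add: algebra_simps power2_eq_square scaleR_add_left[symmetric])
  also have "(2 * c) *\<^sub>R T a - c *\<^sub>R 1 = T h" unfolding ha using sa by (simp add: T.diff T.scaleR T.one)
  finally show ?thesis .
qed

section \<open>Complex-linear extension from the selfadjoint part\<close>

definition re_part :: "'a::unital_cstar_algebra \<Rightarrow> 'a" where
  "re_part x = (1/2) *\<^sub>R (x + star x)"

definition im_part :: "'a::unital_cstar_algebra \<Rightarrow> 'a" where
  "im_part x = (- \<i> / 2) *\<^sub>C (x - star x)"

lemma selfadjoint_parts [simp]: "selfadjoint (re_part x)" "selfadjoint (im_part x)"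
  by (simp_all add: selfadjoint_def re_part_def im_part_def star_scaleR star_scaleC star_add star_diff star_star
      add.commute scaleC_diff_right)

lemma scaleC_half: "(1/2) *\<^sub>C x = (1/2) *\<^sub>R x"
  using scaleC_of_real[of "1/2" x] by simp

lemma parts_eq: "x = re_part x + \<i> *\<^sub>C im_part x"
proof -
  have "\<i> *\<^sub>C im_part x = (1/2) *\<^sub>R (x - star x)" by (simp add: im_part_def scaleC_scaleC scaleC_half)
  then show ?thesis
    by (simp add: re_part_def scaleR_add_right[symmetric])
qed

lemma star_decomp: "selfadjoint h \<Longrightarrow> selfadjoint k \<Longrightarrow> star (h + \<i> *\<^sub>C k) = h - \<i> *\<^sub>C k"
  by (simp add: selfadjoint_def star_add star_scaleC)

lemma parts_decomp:
  assumes "selfadjoint h" "selfadjoint k"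
  shows "re_part (h + \<i> *\<^sub>C k) = h" "im_part (h + \<i> *\<^sub>C k) = k"
proof -
  show "re_part (h + \<i> *\<^sub>C k) = h"
    unfolding re_part_def star_decomp[OF assms] by (simp add: scaleR_2[symmetric])
  have "h + \<i> *\<^sub>C k - (h - \<i> *\<^sub>C k) = 2 *\<^sub>R (\<i> *\<^sub>C k)" by (simp add: scaleR_2)
  then show "im_part (h + \<i> *\<^sub>C k) = k"
    unfolding im_part_def star_decomp[OF assms] by (simp add: scaleC_scaleR scaleC_scaleC scaleC_half)
qed

lemma norm_parts_le: "norm (re_part x) \<le> norm x" "norm (im_part x) \<le> norm x"
  using norm_triangle_ineq[of x "star x"] norm_triangle_ineq4[of x "star x"]
  by (simp_all add: re_part_def im_part_def norm_scaleC norm_divide)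

lemma jordan_star_iso_iff:
  "jordan_star_iso J \<longleftrightarrow> (\<forall>x y. J (x + y) = J x + J y) \<and> (\<forall>c x. J (c *\<^sub>C x) = c *\<^sub>C J x) \<and> bij J \<and>
     (\<forall>x y. J (x * y + y * x) = J x * J y + J y * J x) \<and> (\<forall>x. J (star x) = star (J x))"
  (is "_ \<longleftrightarrow> ?add \<and> ?scale \<and> _ \<and> ?mult \<and> _")
proof -
  have lin: "Vector_Spaces.linear scaleC scaleC J \<longleftrightarrow> ?add \<and> ?scale"
    by (simp add: Vector_Spaces.linear_iff vector_space_scaleC)
  have "(\<forall>x y. J ((1/2) *\<^sub>C (x * y + y * x)) = (1/2) *\<^sub>C (J x * J y + J y * J x)) \<longleftrightarrow> ?mult" if ?scale
  proof -
    have "(1/2) *\<^sub>C a = (1/2) *\<^sub>C b \<longleftrightarrow> a = b" for a b :: 'b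
      by (simp add: scaleC_half)
    then show ?thesis using that by simp
  qed
  then show ?thesis unfolding jordan_star_iso_def lin by blast
qed

text \<open>T is controlled on selfadjoint elements only, so J is built from real and imaginary
  parts. Preservation of squares polarises to the Jordan product h k + k h.\<close>

lemma jordan_extension:
  fixes T :: "'a::unital_cstar_algebra \<Rightarrow> 'b::unital_cstar_algebra"
  assumes T: "unital_positive T" and T': "unital_positive T'"
    and inv: "\<And>h. selfadjoint h \<Longrightarrow> T' (T h) = h" "\<And>k. selfadjoint k \<Longrightarrow> T (T' k) = k"
  obtains J where "jordan_star_iso J" "\<And>h. selfadjoint h \<Longrightarrow> J h = T h"
proof -
  interpret T: unital_positive T by fact
  interpret T': unital_positive T' by fact
  define J where "J x = T (re_part x) + \<i> *\<^sub>C T (im_part x)" for x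
  define J' where "J' x = T' (re_part x) + \<i> *\<^sub>C T' (im_part x)" for x
  have J: "J (h + \<i> *\<^sub>C k) = T h + \<i> *\<^sub>C T k" if "selfadjoint h" "selfadjoint k" for h k
    using that by (simp add: J_def parts_decomp)
  have J': "J' (h + \<i> *\<^sub>C k) = T' h + \<i> *\<^sub>C T' k" if "selfadjoint h" "selfadjoint k" for h k
    using that by (simp add: J'_def parts_decomp)
  have decomp: "\<exists>h k. selfadjoint h \<and> selfadjoint k \<and> x = h + \<i> *\<^sub>C k" for x :: "'c::unital_cstar_algebra"
    using parts_eq selfadjoint_parts by metis
  have add: "J (x + y) = J x + J y" for x y
  proof -
    obtain h k u v where d: "selfadjoint h" "selfadjoint k" "selfadjoint u" "selfadjoint v"
      "x = h + \<i> *\<^sub>C k" "y = u + \<i> *\<^sub>C v" using decomp by metis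
    have xy: "x + y = (h + u) + \<i> *\<^sub>C (k + v)" by (simp add: d scaleC_add_right)
    have "J (x + y) = T (h + u) + \<i> *\<^sub>C T (k + v)" unfolding xy using d(1-4) by (intro J) auto
    then show ?thesis using d by (simp add: J T.add scaleC_add_right)
  qed
  have scale: "J (c *\<^sub>C x) = c *\<^sub>C J x" for c x
  proof -
    obtain h k where d: "selfadjoint h" "selfadjoint k" "x = h + \<i> *\<^sub>C k" using decomp by metis
    define s t where "s = Re c" and "t = Im c"
    have expand: "c *\<^sub>C (a + \<i> *\<^sub>C b) = (s *\<^sub>R a - t *\<^sub>R b) + \<i> *\<^sub>C (t *\<^sub>R a + s *\<^sub>R b)"
      for a b :: "'c::unital_cstar_algebra"
    proof -
      have c: "c = complex_of_real s + \<i> * complex_of_real t" by (simp add: s_def t_def complex_eq)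
      show ?thesis unfolding c
        by (simp add: scaleC_add_left scaleC_add_right scaleC_scaleC[symmetric] scaleC_of_real scaleC_scaleR)
           (simp add: scaleC_scaleC scaleC_scaleR)
    qed
    show ?thesis unfolding d(3) expand using d(1,2) by (simp add: J expand T.add T.diff T.scaleR)
  qed
  have star: "J (star x) = star (J x)" for x
  proof -
    obtain h k where d: "selfadjoint h" "selfadjoint k" "x = h + \<i> *\<^sub>C k" using decomp by metis
    have "star x = h + \<i> *\<^sub>C ((-1) *\<^sub>R k)" unfolding d(3) using star_decomp[OF d(1,2)] by simp
    then have "J (star x) = T h + \<i> *\<^sub>C ((-1) *\<^sub>R T k)"
      using d J[of h "(-1) *\<^sub>R k"] T.scaleR[of k "-1"] by simp
    also have "\<dots> = star (J x)" using d J[of h k] star_decomp[of "T h" "T k"] T.selfadjoint by simp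
    finally show ?thesis .
  qed
  have sq: "T (h * h) = T h * T h" if "selfadjoint h" for h
    using unital_positive_square[OF T T' inv that] .
  have sa_anti: "selfadjoint (h * k + k * h)" if "selfadjoint h" "selfadjoint k" for h k :: "'c::unital_cstar_algebra"
    using that by (simp add: selfadjoint_def star_add star_mult add.commute)
  have anti: "T (h * k + k * h) = T h * T k + T k * T h" if hk: "selfadjoint h" "selfadjoint k" for h k
  proof -
    have "h * k + k * h = (h + k) * (h + k) - h * h - k * k" by (simp add: algebra_simps)
    then show ?thesis using hk by (simp add: T.diff T.add sq) (simp add: algebra_simps)
  qed
  have expand2: "(h + \<i> *\<^sub>C k) * (u + \<i> *\<^sub>C v) + (u + \<i> *\<^sub>C v) * (h + \<i> *\<^sub>C k)
      = ((h * u + u * h) - (k * v + v * k)) + \<i> *\<^sub>C ((h * v + v * h) + (k * u + u * k))"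
    for h k u v :: "'c::unital_cstar_algebra"
    by (simp add: algebra_simps scaleC_mult_scaleC mult_scaleC_left mult_scaleC_right scaleC_add_right scaleC_scaleC)
  have mult: "J (x * y + y * x) = J x * J y + J y * J x" for x y
  proof -
    obtain h k u v where d: "selfadjoint h" "selfadjoint k" "selfadjoint u" "selfadjoint v"
      "x = h + \<i> *\<^sub>C k" "y = u + \<i> *\<^sub>C v" using decomp by metis
    have "J (x * y + y * x) = T ((h * u + u * h) - (k * v + v * k)) + \<i> *\<^sub>C T ((h * v + v * h) + (k * u + u * k))"
      unfolding d(5,6) expand2 by (rule J) (simp_all add: sa_anti d(1-4))
    also have "\<dots> = ((T h * T u + T u * T h) - (T k * T v + T v * T k))
        + \<i> *\<^sub>C ((T h * T v + T v * T h) + (T k * T u + T u * T k))"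
      by (simp add: T.add T.diff anti sa_anti d(1-4))
    also have "\<dots> = J x * J y + J y * J x" unfolding d(5,6) using d(1-4) by (simp only: J expand2)
    finally show ?thesis .
  qed
  have JJ: "J' (J x) = x" for x
  proof -
    obtain h k where "selfadjoint h" "selfadjoint k" "x = h + \<i> *\<^sub>C k" using decomp by metis
    then show ?thesis by (simp add: J J' T.selfadjoint inv)
  qed
  have JJ': "J (J' x) = x" for x
  proof -
    obtain h k where "selfadjoint h" "selfadjoint k" "x = h + \<i> *\<^sub>C k" using decomp by metis
    then show ?thesis by (simp add: J J' T'.selfadjoint inv)
  qed
  have "bij J" using JJ JJ' by (rule o_bij[OF ext ext, unfolded comp_def id_def])
  then have "jordan_star_iso J" unfolding jordan_star_iso_iff using add scale star mult by blast
  moreover have "J h = T h" if "selfadjoint h" for h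
    using J[of h 0] that T.scaleR[of 0 0] by simp
  ultimately show thesis using that by blast
qed

section \<open>Agreement with the derivative, by repeated square roots\<close>

lemma norm_power_diff_le:
  fixes p q :: "'a::real_normed_algebra_1"
  assumes "norm p \<le> M" "norm q \<le> M" "1 \<le> M"
  shows "norm (p ^ n - q ^ n) \<le> real n * M ^ n * norm (p - q)"
proof (induction n)
  case (Suc n)
  have "p ^ Suc n - q ^ Suc n = p * (p ^ n - q ^ n) + (p - q) * q ^ n" by (simp add: algebra_simps)
  then have "norm (p ^ Suc n - q ^ Suc n) \<le> norm (p * (p ^ n - q ^ n)) + norm ((p - q) * q ^ n)"
    by (simp only: norm_triangle_ineq)
  also have "\<dots> \<le> M * (real n * M ^ n * norm (p - q)) + norm (p - q) * M ^ Suc n"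
  proof (rule add_mono)
    show "norm (p * (p ^ n - q ^ n)) \<le> M * (real n * M ^ n * norm (p - q))"
      by (rule order_trans[OF norm_mult_ineq]) (use Suc assms in \<open>intro mult_mono; auto\<close>)
    have "norm (q ^ n) \<le> M ^ n" using norm_power_ineq[of q n] power_mono[OF assms(2), of n] by simp
    also have "\<dots> \<le> M ^ Suc n" using assms by (intro power_increasing) auto
    finally show "norm ((p - q) * q ^ n) \<le> norm (p - q) * M ^ Suc n"
      by (intro order_trans[OF norm_mult_ineq] mult_left_mono) auto
  qed
  finally show ?case by (simp add: algebra_simps)
qed simp

text \<open>Positivity of (r - 1)^2 for a root r of u gives 2 (r - 1) <= u - 1; iterate.\<close>

lemma iterated_root_upper:
  assumes "\<And>n. selfadjoint (u n)" "\<And>n. u (Suc n) * u (Suc n) = u n"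
  shows "2 ^ n *\<^sub>R (u n - 1) \<preceq> u 0 - 1"
proof (induction n)
  case (Suc n)
  have "(u (Suc n) - 1) * (u (Suc n) - 1) \<in> pos_cone" using assms by (intro square_pos) auto
  moreover have "(u (Suc n) - 1) * (u (Suc n) - 1) = (u n - 1) - 2 *\<^sub>R (u (Suc n) - 1)"
    by (simp add: algebra_simps assms(2) scaleR_2 del: one_add_one)
  ultimately have "2 *\<^sub>R (u (Suc n) - 1) \<preceq> u n - 1" by (simp add: pos_le_def)
  from pos_le_scaleR[OF this, of "2 ^ n"]
  have "2 ^ Suc n *\<^sub>R (u (Suc n) - 1) \<preceq> 2 ^ n *\<^sub>R (u n - 1)" by (simp add: mult.commute)
  then show ?case using Suc by (rule pos_le_trans)
qed simp

text \<open>Here u n = x^(1/2^n) with inverse v n. The upper bound applies to both sequences, and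
  the square of u^(1/2) - v^(1/2) gives u + v >= 2, so that the upper bound for v n becomes a lower
  bound for u n.\<close>

lemma iterated_root:
  assumes x: "x \<in> pos_inv"
  obtains u c where "\<And>n. u n \<in> pos_inv" "u 0 = x" "\<And>n. u (Suc n) * u (Suc n) = u n"
    "\<And>n. norm (u n - 1) \<le> c / 2 ^ n" "c \<ge> 0"
proof -
  define u where "u = rec_nat x (\<lambda>_. pos_root)"
  have u0: "u 0 = x" and uS: "u (Suc n) = pos_root (u n)" for n by (simp_all add: u_def)
  have u: "u n \<in> pos_inv" for n by (induction n) (simp_all add: u0 x uS pos_root_pos_inv)
  have sq: "u (Suc n) * u (Suc n) = u n" for n using u[of n] by (simp add: uS pos_root_square pos_invD)
  define v where "v n = inv_elem (u n)" for n
  have v: "v n \<in> pos_inv" for n using u by (simp add: v_def pos_inv_inv_elem)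
  have vsq: "v (Suc n) * v (Suc n) = v n" for n
    using inv_elem_conj[of "u (Suc n)" 1] u by (simp add: v_def sq pos_invD)
  define c where "c = max (norm (u 0)) (norm (v 0))"
  have upper: "w n - 1 \<preceq> (c / 2 ^ n) *\<^sub>R 1"
    if w: "\<And>n. w n \<in> pos_inv" "\<And>n. w (Suc n) * w (Suc n) = w n" "norm (w 0) \<le> c" for w n
  proof -
    have "2 ^ n *\<^sub>R (w n - 1) \<preceq> w 0 - 1" using w by (intro iterated_root_upper) (simp_all add: pos_invD)
    also have "w 0 - 1 \<preceq> w 0" by (simp add: pos_le_def)
    also have "w 0 \<preceq> c *\<^sub>R 1"
      using w(3) selfadjoint_norm_le_iff[of "w 0" c] pos_invD(1)[OF w(1)] by simp
    finally have "(1 / 2 ^ n) *\<^sub>R (2 ^ n *\<^sub>R (w n - 1)) \<preceq> (1 / 2 ^ n) *\<^sub>R (c *\<^sub>R 1)"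
      by (rule pos_le_scaleR) simp
    then show ?thesis by simp
  qed
  have "norm (u n - 1) \<le> c / 2 ^ n" for n
  proof -
    have up: "u n - 1 \<preceq> (c / 2 ^ n) *\<^sub>R 1" by (rule upper) (use u sq c_def in auto)
    have vp: "v n - 1 \<preceq> (c / 2 ^ n) *\<^sub>R 1" by (rule upper) (use v vsq c_def in auto)
    have "(u (Suc n) - v (Suc n)) * (u (Suc n) - v (Suc n)) \<in> pos_cone"
      using u v by (intro square_pos) (simp add: pos_invD)
    moreover have "(u (Suc n) - v (Suc n)) * (u (Suc n) - v (Suc n)) = (u n - 1) - (1 - v n)"
      using inv_elem[OF pos_invD(2)[OF u[of "Suc n"]]] by (simp add: v_def[symmetric] algebra_simps sq vsq)
    ultimately have "1 - v n \<preceq> u n - 1" by (simp add: pos_le_def)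
    moreover have "- ((c / 2 ^ n) *\<^sub>R 1) \<preceq> 1 - v n" using vp by (simp add: pos_le_def algebra_simps)
    ultimately have "- ((c / 2 ^ n) *\<^sub>R 1) \<preceq> u n - 1" by (blast intro: pos_le_trans)
    then show ?thesis using up u by (subst selfadjoint_norm_le_iff) (simp_all add: pos_invD)
  qed
  moreover have "c \<ge> 0" by (simp add: c_def le_max_iff_disj)
  ultimately show thesis using that u u0 sq by blast
qed

context cone_iso
begin

text \<open>Both maps preserve the squares in the chain of roots, so their values at x are N-th
  powers of their values at x^(1/N), N = 2^n. Those differ by at most 32 (c/N)^2, and taking N-th
  powers magnifies this by at most N (1 + c/N)^N <= N exp c; the product is of order 1/N.\<close>

lemma eq_derivative_on_pos_inv:
  assumes T: "unital_positive T" and sq: "\<And>h. selfadjoint h \<Longrightarrow> T (h * h) = T h * T h"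
    and contr: "\<And>h. selfadjoint h \<Longrightarrow> norm (T h) \<le> norm h"
    and deriv: "\<And>h. selfadjoint h \<Longrightarrow> norm h \<le> 1/16 \<Longrightarrow> norm (T h - G h) \<le> 32 * (norm h)\<^sup>2"
    and x: "x \<in> pos_inv"
  shows "\<psi> x = T x"
proof -
  interpret T: unital_positive T by fact
  obtain u c where u: "\<And>n. u n \<in> pos_inv" "u 0 = x" "\<And>n. u (Suc n) * u (Suc n) = u n"
    "\<And>n. norm (u n - 1) \<le> c / 2 ^ n" and c: "c \<ge> 0" using iterated_root[OF x] by metis
  have pow: "F (u n) ^ (2 ^ n) = F x" if F: "\<And>n. F (u (Suc n) * u (Suc n)) = F (u (Suc n)) * F (u (Suc n))"
    for F :: "'a \<Rightarrow> 'b" and n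
  proof (induction n)
    case (Suc n)
    have "F (u (Suc n)) ^ (2 ^ Suc n) = (F (u (Suc n)) * F (u (Suc n))) ^ (2 ^ n)"
      by (simp add: power_mult power2_eq_square)
    also have "\<dots> = F (u n) ^ (2 ^ n)" by (simp only: F[symmetric] u(3))
    finally show ?case using Suc by simp
  qed (simp add: u)
  have \<psi>pow: "\<psi> (u n) ^ (2 ^ n) = \<psi> x" for n
    by (rule pow) (use triple[OF u(1) one_pos_inv] in \<open>simp add: one\<close>)
  have Tpow: "T (u n) ^ (2 ^ n) = T x" for n
    by (rule pow) (use sq u(1) in \<open>simp add: pos_invD\<close>)
  have "norm (\<psi> x - T x) \<le> exp c * 32 * c\<^sup>2 * (1 / 2 ^ n)" if n: "c / 2 ^ n \<le> 1/16" for n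
  proof -
    define h where "h = u n - 1"
    define M where "M = 1 + c / 2 ^ n"
    have h: "selfadjoint h" "norm h \<le> c / 2 ^ n" using u(1)[of n] u(4)[of n] by (simp_all add: h_def pos_invD)
    have un: "u n = 1 + h" by (simp add: h_def)
    have eq: "\<psi> (u n) = 1 + G h" "T (u n) = 1 + T h" using h by (simp_all add: un G_def T.add T.one)
    have "norm (G h) \<le> c / 2 ^ n" "norm (T h) \<le> c / 2 ^ n"
      using norm_G_le[of h] contr[of h] h n by auto
    then have M: "norm (\<psi> (u n)) \<le> M" "norm (T (u n)) \<le> M"
      unfolding eq M_def using norm_triangle_ineq[of 1 "G h"] norm_triangle_ineq[of 1 "T h"] by auto
    have "1 \<le> M" using c by (simp add: M_def)
    have "- real (2 ^ n) \<le> c" using order_trans[OF _ c, of "- real (2 ^ n)"] by simp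
    then have "M ^ (2 ^ n) \<le> exp c"
      unfolding M_def using exp_ge_one_plus_x_over_n_power_n[of "2 ^ n" c] c by simp
    have d: "norm (\<psi> (u n) - T (u n)) \<le> 32 * (c / 2 ^ n)\<^sup>2"
    proof -
      have "norm (\<psi> (u n) - T (u n)) = norm (T h - G h)" by (simp add: eq norm_minus_commute)
      also have "\<dots> \<le> 32 * (norm h)\<^sup>2" using h(1) order_trans[OF h(2) n] by (rule deriv)
      also have "\<dots> \<le> 32 * (c / 2 ^ n)\<^sup>2" using h by (intro mult_left_mono power_mono) auto
      finally show ?thesis .
    qed
    have "norm (\<psi> x - T x) = norm (\<psi> (u n) ^ (2 ^ n) - T (u n) ^ (2 ^ n))" by (simp only: \<psi>pow Tpow)
    also have "\<dots> \<le> real (2 ^ n) * M ^ (2 ^ n) * norm (\<psi> (u n) - T (u n))"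
      using M \<open>1 \<le> M\<close> by (rule norm_power_diff_le)
    also have "\<dots> \<le> real (2 ^ n) * exp c * (32 * (c / 2 ^ n)\<^sup>2)"
      using \<open>M ^ (2 ^ n) \<le> exp c\<close> \<open>1 \<le> M\<close> by (intro mult_mono d) auto
    also have "\<dots> = exp c * 32 * c\<^sup>2 * (1 / 2 ^ n)" by (simp add: power2_eq_square field_simps)
    finally show ?thesis .
  qed
  moreover have "\<forall>\<^sub>F n in sequentially. c / 2 ^ n \<le> 1/16"
  proof -
    have "(\<lambda>n. c * (1/2) ^ n) \<longlonglongrightarrow> c * 0" by (intro tendsto_intros) auto
    then have "\<forall>\<^sub>F n in sequentially. c * (1/2) ^ n < 1/16" by (rule order_tendstoD) simp
    then show ?thesis by eventually_elim (simp add: power_one_over)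
  qed
  ultimately have ev: "\<forall>\<^sub>F n in sequentially. norm (\<psi> x - T x) \<le> exp c * 32 * c\<^sup>2 * (1/2) ^ n"
    by (auto elim!: eventually_mono simp: power_one_over)
  have "(\<lambda>n. exp c * 32 * c\<^sup>2 * (1/2) ^ n) \<longlonglongrightarrow> exp c * 32 * c\<^sup>2 * 0" by (intro tendsto_intros) auto
  then have "norm (\<psi> x - T x) \<le> exp c * 32 * c\<^sup>2 * 0" using ev by (rule tendsto_lowerbound) simp
  then show ?thesis by simp
qed

text \<open>Monotonicity gives \<open>\<psi>\<close> x <= \<open>\<psi>\<close> (x + e) = T x + e,
  and e -> 0. Only one inequality results, as continuity of \<open>\<psi>\<close> at singular
  elements is not yet known; the other comes from the inverse map.\<close>

lemma le_derivative:
  assumes T: "unital_positive T" and eq: "\<And>x. x \<in> pos_inv \<Longrightarrow> \<psi> x = T x" and x: "x \<in> pos_cone"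
  shows "\<psi> x \<preceq> T x"
proof -
  interpret T: unital_positive T by fact
  have "T x + (1 / real (Suc n)) *\<^sub>R 1 - \<psi> x \<in> pos_cone" for n
  proof -
    let ?e = "1 / real (Suc n)"
    have y: "x + ?e *\<^sub>R 1 \<in> pos_inv" using x by (intro pos_inv_add_const) auto
    have "x \<preceq> x + ?e *\<^sub>R 1" using const_pos[of ?e] by (simp add: pos_le_def)
    then have "\<psi> x \<preceq> \<psi> (x + ?e *\<^sub>R 1)" using x pos_invD(1)[OF y] le_iff by blast
    then show ?thesis unfolding eq[OF y] using x by (simp add: T.add T.scaleR T.one pos_le_def)
  qed
  moreover have "(\<lambda>n. T x + (1 / real (Suc n)) *\<^sub>R 1 - \<psi> x) \<longlonglongrightarrow> T x + 0 *\<^sub>R 1 - \<psi> x"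
    by (intro tendsto_intros LIMSEQ_inverse_real_of_nat[unfolded inverse_eq_divide])
  ultimately show ?thesis using pos_cone_LIMSEQ by (fastforce simp: pos_le_def)
qed

text \<open>Near 1 the maps \<open>\<psi>\<close> and \<open>\<psi>'\<close> undo each other, so T'
  (T k) - k is quadratically small in k. It is also homogeneous in k, so replacing k by s h and
  letting s -> 0 shows that it vanishes.\<close>

lemma derivative_inverse:
  assumes T: "\<And>h. selfadjoint h \<Longrightarrow> selfadjoint (T h)" "\<And>c h. selfadjoint h \<Longrightarrow> T (c *\<^sub>R h) = c *\<^sub>R T h"
    "\<And>h. selfadjoint h \<Longrightarrow> norm h \<le> 1/16 \<Longrightarrow> norm (T h - G h) \<le> 32 * (norm h)\<^sup>2"
    and T': "unital_positive T'" "\<And>h. selfadjoint h \<Longrightarrow> norm (T' h) \<le> norm h"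
    "\<And>h. selfadjoint h \<Longrightarrow> norm h \<le> 1/16 \<Longrightarrow> norm (T' h - cone_iso.G \<psi>' h) \<le> 32 * (norm h)\<^sup>2"
    and h: "selfadjoint h"
  shows "T' (T h) = h"
proof -
  interpret T': unital_positive T' by fact
  have small: "norm (T' (T k) - k) \<le> 64 * (norm k)\<^sup>2" if k: "selfadjoint k" "norm k \<le> 1/16" for k
  proof -
    have Gk: "selfadjoint (G k)" "norm (G k) \<le> norm k" using k selfadjoint_G norm_G_le by auto
    have "1 + k \<in> pos_cone" using one_plus_small(1)[OF k] by (simp add: pos_invD)
    then have inv: "cone_iso.G \<psi>' (G k) = k"
      by (simp add: G_def cone_iso.G_def[OF inverse_cone_iso] inverse)
    have "T' (T k) - k = T' (T k - G k) + (T' (G k) - cone_iso.G \<psi>' (G k))"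
      using T(1)[OF k(1)] Gk by (simp add: T'.diff inv)
    then have "norm (T' (T k) - k) \<le> norm (T' (T k - G k)) + norm (T' (G k) - cone_iso.G \<psi>' (G k))"
      by (simp only: norm_triangle_ineq)
    also have "\<dots> \<le> norm (T k - G k) + 32 * (norm (G k))\<^sup>2"
      using T(1)[OF k(1)] Gk k by (intro add_mono T'(2,3)) auto
    also have "\<dots> \<le> 32 * (norm k)\<^sup>2 + 32 * (norm k)\<^sup>2"
      using T(3)[OF k] Gk(2) by (intro add_mono mult_left_mono power_mono) auto
    finally show ?thesis by simp
  qed
  define D where "D = norm (T' (T h) - h)"
  have scaled: "D \<le> 64 * s * (norm h)\<^sup>2" if s: "s > 0" "s * norm h \<le> 1/16" for s
  proof -
    have "T' (T (s *\<^sub>R h)) - s *\<^sub>R h = s *\<^sub>R (T' (T h) - h)"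
      using h T(1)[OF h] by (simp add: T(2) T'.scaleR scaleR_diff_right)
    then have "s * D = norm (T' (T (s *\<^sub>R h)) - s *\<^sub>R h)" using s by (simp add: D_def)
    also have "\<dots> \<le> 64 * (norm (s *\<^sub>R h))\<^sup>2" using h s by (intro small) auto
    finally have "s * D \<le> s * (64 * s * (norm h)\<^sup>2)" using s by (simp add: power2_eq_square ac_simps)
    then show ?thesis using s by simp
  qed
  have "D \<le> 0"
  proof (rule ccontr)
    assume "\<not> D \<le> 0"
    then have D: "D > 0" by simp
    \<comment> \<open>The first bound puts s h into the ball of radius 1/16; the second makes 64 s
      |h|^2 at most D/2, contradicting D > 0.\<close>
    define s where "s = min (1 / (16 * (norm h + 1))) (D / (128 * ((norm h)\<^sup>2 + 1)))"
    have pos: "norm h + 1 > 0" "(norm h)\<^sup>2 + 1 > 0" using zero_le_power2[of "norm h"] norm_ge_zero[of h] by linarith+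
    have s0: "s > 0" using D pos by (simp add: s_def)
    have "s * norm h \<le> (1 / (16 * (norm h + 1))) * (norm h + 1)" using pos s0 by (intro mult_mono) (auto simp: s_def)
    also have "\<dots> = 1/16" using pos(1) by (auto simp: divide_simps)
    finally have "s * norm h \<le> 1/16" .
    then have "D \<le> 64 * s * (norm h)\<^sup>2" using s0 by (rule scaled[rotated])
    also have "\<dots> \<le> 64 * (s * ((norm h)\<^sup>2 + 1))" using s0 by (simp add: algebra_simps)
    also have "s * ((norm h)\<^sup>2 + 1) \<le> (D / (128 * ((norm h)\<^sup>2 + 1))) * ((norm h)\<^sup>2 + 1)"
      using pos by (intro mult_right_mono) (auto simp: s_def)
    also have "\<dots> = D / 128" using pos(2) by (auto simp: divide_simps)
    finally show False using D by simp
  qed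
  then show ?thesis by (simp add: D_def)
qed

lemma jordan_star_iso_exists: "\<exists>J. jordan_star_iso J \<and> (\<forall>x\<in>pos_cone. \<psi> x = J x)"
proof -
  interpret inv: cone_iso \<psi>' \<psi> by (rule inverse_cone_iso)
  obtain T where T: "\<And>h k. selfadjoint h \<Longrightarrow> selfadjoint k \<Longrightarrow> T (h + k) = T h + T k"
    "\<And>c h. selfadjoint h \<Longrightarrow> T (c *\<^sub>R h) = c *\<^sub>R T h" "\<And>h. selfadjoint h \<Longrightarrow> selfadjoint (T h)"
    "\<And>h. selfadjoint h \<Longrightarrow> norm (T h) \<le> norm h" "T 1 = 1" "\<And>h. h \<in> pos_cone \<Longrightarrow> T h \<in> pos_cone"
    "\<And>h. selfadjoint h \<Longrightarrow> norm h \<le> 1/16 \<Longrightarrow> norm (T h - G h) \<le> 32 * (norm h)\<^sup>2"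
    by (rule derivative_exists, rule that)
  obtain T' where T': "\<And>h k. selfadjoint h \<Longrightarrow> selfadjoint k \<Longrightarrow> T' (h + k) = T' h + T' k"
    "\<And>c h. selfadjoint h \<Longrightarrow> T' (c *\<^sub>R h) = c *\<^sub>R T' h" "\<And>h. selfadjoint h \<Longrightarrow> selfadjoint (T' h)"
    "\<And>h. selfadjoint h \<Longrightarrow> norm (T' h) \<le> norm h" "T' 1 = 1" "\<And>h. h \<in> pos_cone \<Longrightarrow> T' h \<in> pos_cone"
    "\<And>h. selfadjoint h \<Longrightarrow> norm h \<le> 1/16 \<Longrightarrow> norm (T' h - inv.G h) \<le> 32 * (norm h)\<^sup>2"
    by (rule inv.derivative_exists, rule that)
  have uT: "unital_positive T" by unfold_locales (use T in auto)
  have uT': "unital_positive T'" by unfold_locales (use T' in auto)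
  have inv1: "T' (T h) = h" if "selfadjoint h" for h
    using derivative_inverse[OF T(3,2,7) uT' T'(4,7) that] .
  have inv2: "T (T' k) = k" if "selfadjoint k" for k
    using inv.derivative_inverse[OF T'(3,2,7) uT T(4,7) that] .
  have eq: "\<psi> x = T x" if "x \<in> pos_inv" for x
    using eq_derivative_on_pos_inv[OF uT unital_positive_square[OF uT uT' inv1 inv2] T(4,7) that] .
  have eq': "\<psi>' y = T' y" if "y \<in> pos_inv" for y
    using inv.eq_derivative_on_pos_inv[OF uT' unital_positive_square[OF uT' uT inv2 inv1] T'(4,7) that] .
  have eq_pos: "\<psi> x = T x" if x: "x \<in> pos_cone" for x
  proof (rule pos_le_antisym)
    show "\<psi> x \<preceq> T x" using uT eq x by (rule le_derivative)
    have Tx: "T x \<in> pos_cone" using x by (rule T(6))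
    have "\<psi>' (T x) \<preceq> T' (T x)" using uT' eq' Tx by (rule inv.le_derivative)
    then have "\<psi>' (T x) \<preceq> x" using inv1 x by simp
    then show "T x \<preceq> \<psi> x" using le_iff[of "\<psi>' (T x)" x] maps inverse Tx x by simp
  qed
  obtain J where "jordan_star_iso J" "\<And>h. selfadjoint h \<Longrightarrow> J h = T h"
    using jordan_extension[OF uT uT' inv1 inv2] by blast
  then show ?thesis using eq_pos by fastforce
qed

end

section \<open>Invariants of Jordan isomorphisms\<close>

locale jordan_iso =
  fixes J :: "'a::unital_cstar_algebra \<Rightarrow> 'b::unital_cstar_algebra"
  assumes jordan: "jordan_star_iso J"
begin

lemma add: "J (x + y) = J x + J y"
  and scaleC: "J (c *\<^sub>C x) = c *\<^sub>C J x"
  and bij: "bij J"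
  and anti: "J (x * y + y * x) = J x * J y + J y * J x"
  and star: "J (star x) = star (J x)"
  using jordan unfolding jordan_star_iso_iff by blast+

lemma scaleR: "J (r *\<^sub>R x) = r *\<^sub>R J x"
  using scaleC[of "complex_of_real r" x] by (simp add: scaleC_of_real)

lemma zero: "J 0 = 0"
  using scaleR[of 0 0] by simp

lemma diff: "J (x - y) = J x - J y"
  using add[of x "(-1) *\<^sub>R y"] scaleR[of "-1" y] by simp

lemma square: "J (x * x) = J x * J x"
proof -
  have "2 *\<^sub>R J (x * x) = 2 *\<^sub>R (J x * J x)" using anti[of x x] by (simp add: add scaleR_2)
  then show ?thesis by simp
qed

lemma one: "J 1 = 1"
proof -
  obtain e where e: "J e = 1" using bij by (metis bij_pointE)
  have "2 *\<^sub>R J e = 2 *\<^sub>R J 1" using anti[of 1 e] by (simp add: add e scaleR_2 del: one_add_one)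
  then show ?thesis using e by simp
qed

text \<open>With {u,v} = u v + v u one has 2 x y x = {x,{x,y}} - {x^2,y}, an expression in Jordan
  products alone.\<close>

lemma triple: "J (x * y * x) = J x * J y * J x"
proof -
  let ?a = "\<lambda>u v. u * v + v * u"
  have "2 *\<^sub>R (x * y * x) = ?a x (?a x y) - ?a (x * x) y" by (simp add: algebra_simps scaleR_2)
  then have "2 *\<^sub>R J (x * y * x) = ?a (J x) (?a (J x) (J y)) - ?a (J x * J x) (J y)"
    using scaleR[of 2 "x * y * x"] by (simp only: diff anti square)
  also have "\<dots> = 2 *\<^sub>R (J x * J y * J x)" by (simp add: algebra_simps scaleR_2)
  finally show ?thesis by simp
qed

text \<open>J need not be multiplicative, but it preserves x b x = 1 for b = x^-2, which exhibits a
  right and a left inverse of J x.\<close>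

lemma invertible: assumes "invertible_elem x" shows "invertible_elem (J x)"
proof (rule invertible_two_sided)
  let ?b = "inv_elem x * inv_elem x"
  have "x * ?b * x = 1" by (simp add: mult.assoc inv_elem assms)
  then have "J x * J ?b * J x = 1" using triple[of x ?b] by (simp add: one)
  then show "J x * (J ?b * J x) = 1" "(J x * J ?b) * J x = 1" by (simp_all add: mult.assoc)
qed

lemma spectrum_subset: "spectrum (J x) \<subseteq> spectrum x"
  using invertible[of "x - z *\<^sub>C 1" for z] by (auto simp: spectrum_def diff scaleC one)

lemma selfadjoint: "selfadjoint x \<Longrightarrow> selfadjoint (J x)"
  by (simp add: selfadjoint_def flip: star)

lemma pos: "x \<in> pos_cone \<Longrightarrow> J x \<in> pos_cone"
  using spectrum_subset[of x] by (auto simp: pos_cone_def simp flip: star)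

lemma norm_le: "selfadjoint h \<Longrightarrow> norm (J h) \<le> norm h"
proof -
  assume h: "selfadjoint h"
  then have "h \<preceq> norm h *\<^sub>R 1" "- (norm h *\<^sub>R 1) \<preceq> h" using selfadjoint_norm_le_iff[of h "norm h"] by auto
  then have "J (norm h *\<^sub>R 1 - h) \<in> pos_cone" "J (h + norm h *\<^sub>R 1) \<in> pos_cone"
    using pos by (simp_all add: pos_le_def)
  then show ?thesis
    using selfadjoint_norm_le_iff[OF selfadjoint[OF h]] by (simp add: pos_le_def diff add scaleR one)
qed

lemma inverse: "jordan_iso (inv J)"
proof
  have s: "J (inv J u) = u" and i: "inv J (J x) = x" for u x
    using bij by (simp_all add: bij_is_surj surj_f_inv_f bij_is_inj)
  have eqI: "inv J u = x" if "J x = u" for u x using i that by auto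
  have "inv J (x + y) = inv J x + inv J y" for x y by (rule eqI) (simp only: add s)
  moreover have "inv J (c *\<^sub>C x) = c *\<^sub>C inv J x" for c x by (rule eqI) (simp only: scaleC s)
  moreover have "inv J (x * y + y * x) = inv J x * inv J y + inv J y * inv J x" for x y
    by (rule eqI) (simp only: anti s)
  moreover have "inv J (star x) = star (inv J x)" for x by (rule eqI) (simp only: star s)
  ultimately show "jordan_star_iso (inv J)"
    unfolding jordan_star_iso_iff using bij_imp_bij_inv[OF bij] by blast
qed

lemma inv_left: "inv J (J x) = x"
  using bij by (simp add: bij_is_inj)

lemma spectrum: "spectrum (J x) = spectrum x"
  using spectrum_subset[of x] jordan_iso.spectrum_subset[OF inverse, of "J x"] by (simp add: inv_left)

lemma norm: "selfadjoint h \<Longrightarrow> norm (J h) = norm h"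
  using norm_le[of h] jordan_iso.norm_le[OF inverse, of "J h"] selfadjoint[of h] by (simp add: inv_left)

lemma bounded_linear: "bounded_linear J"
proof (rule bounded_linear_intro[where K = 2])
  fix x
  have "J x = J (re_part x) + \<i> *\<^sub>C J (im_part x)" by (subst parts_eq) (simp add: add scaleC)
  then have "norm (J x) \<le> norm (J (re_part x)) + norm (J (im_part x))"
    using norm_triangle_ineq[of "J (re_part x)" "\<i> *\<^sub>C J (im_part x)"] by (simp add: norm_scaleC)
  then show "norm (J x) \<le> norm x * 2" using norm_parts_le[of x] by (simp add: norm)
qed (simp_all add: add scaleR)

text \<open>Since a commutes with p(a), their Jordan product is their product, so Horner's scheme is
  preserved.\<close>

lemma poly_elem: "J (poly_elem p a) = poly_elem p (J a)"
proof (induction p)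
  case (pCons c p)
  have "2 *\<^sub>R (a * poly_elem p a) = a * poly_elem p a + poly_elem p a * a"
    using poly_elem_commute[of a a p] by (simp add: scaleR_2)
  then have "2 *\<^sub>R J (a * poly_elem p a) = J a * poly_elem p (J a) + poly_elem p (J a) * J a"
    using scaleR[of 2 "a * poly_elem p a"] by (simp add: anti pCons.IH)
  also have "\<dots> = 2 *\<^sub>R (J a * poly_elem p (J a))"
    using poly_elem_commute[of "J a" "J a" p] by (simp add: scaleR_2)
  finally show ?case by (simp add: add scaleC one)
qed (simp add: zero)

lemma cfc_rel: "cfc_rel a f b \<Longrightarrow> cfc_rel (J a) f (J b)"
  unfolding cfc_rel_def spectrum using bounded_linear.tendsto[OF bounded_linear] by (fastforce simp: poly_elem)

lemma pos_powr: "a \<in> pos_cone \<Longrightarrow> r > 0 \<Longrightarrow> J (pos_powr a r) = pos_powr (J a) r"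
  using cfc_rel_unique[OF _ cfc_rel[OF cfc_rel_pos_powr] cfc_rel_pos_powr] pos by simp

lemma pairing: "x \<in> pos_cone \<Longrightarrow> y \<in> pos_cone \<Longrightarrow> pairing (J x) (J y) = pairing x y"
  unfolding pairing_def by (simp add: pos_root_pos norm flip: pos_powr triple)

end

text \<open>Nonzero points are exchanged by the a b versus b a rule. The point 0 needs its own
  argument: one-sided inverses of the selfadjoint factors are two-sided, so either product is
  invertible only if its factors are.\<close>

lemma spectrum_square_mult:
  assumes w: "selfadjoint w" and y: "selfadjoint y"
  shows "spectrum (w * w * y) = spectrum (w * y * w)"
proof -
  have zero: "invertible_elem (w * w * y) \<longleftrightarrow> invertible_elem (w * y * w)"
  proof
    assume i: "invertible_elem (w * w * y)"
    have iw: "invertible_elem w"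
      using selfadjoint_right_inverse[OF w, of "w * y * inv_elem (w * w * y)"] inv_elem(1)[OF i]
      by (simp add: mult.assoc)
    have "invertible_elem y"
      using selfadjoint_left_inverse[OF y, of "inv_elem (w * w * y) * (w * w)"] inv_elem(2)[OF i]
      by (simp add: mult.assoc)
    then show "invertible_elem (w * y * w)" using iw by (intro invertible_mult)
  next
    assume i: "invertible_elem (w * y * w)"
    have iw: "invertible_elem w"
      using selfadjoint_right_inverse[OF w, of "y * w * inv_elem (w * y * w)"] inv_elem(1)[OF i]
      by (simp add: mult.assoc)
    have "w * w * y = w * (w * y * w) * inv_elem w" by (simp add: mult.assoc inv_elem iw)
    then show "invertible_elem (w * w * y)" using i iw by (simp add: invertible_mult invertible_inv_elem)
  qed
  have "z \<in> spectrum (w * w * y) \<longleftrightarrow> z \<in> spectrum (w * y * w)" for z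
  proof (cases "z = 0")
    case True
    then show ?thesis using zero by (simp add: spectrum_def)
  next
    case False
    then show ?thesis
      using nonzero_spectrum_commute[of z w "w * y"] nonzero_spectrum_commute[of z "w * y" w] by (auto simp: mult.assoc)
  qed
  then show ?thesis by blast
qed

lemma spectrum_mult_pos:
  assumes "x \<in> pos_cone" "y \<in> pos_cone"
  shows "spectrum (x * y) = spectrum (pos_root x * y * pos_root x)"
  using spectrum_square_mult[of "pos_root x" y] assms by (simp add: pos_root_pos pos_root_square)

lemma spectral_seminorm_mult_pos:
  assumes "x \<in> pos_cone" "y \<in> pos_cone" shows "spectral_seminorm (x * y) = pairing x y"
proof -
  have "selfadjoint (pos_root x * y * pos_root x)" using assms by (simp add: pos_root_pos)
  from cfc_rel_norm[OF this cfc_rel_ident] show ?thesis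
    by (simp add: spectral_seminorm_def pairing_def spectrum_mult_pos[OF assms])
qed

lemma (in jordan_iso) spectrum_mult:
  assumes "x \<in> pos_cone" "y \<in> pos_cone" shows "spectrum (J x * J y) = spectrum (x * y)"
proof -
  have "spectrum (J x * J y) = spectrum (J (pos_root x * y * pos_root x))"
    using assms by (simp add: spectrum_mult_pos pos triple pos_powr)
  then show ?thesis using assms by (simp add: spectrum spectrum_mult_pos)
qed

text \<open>Both sides are |x y^2 x| by the C*-identity, with x serving as the root of x^2. This is
  the exponent 2 behind condition (ii).\<close>

lemma norm_mult_eq_pairing:
  assumes "x \<in> pos_cone" "y \<in> pos_cone"
  shows "(norm (x * y))\<^sup>2 = pairing (pos_powr x 2) (pos_powr y 2)"
proof -
  have star: "star x = x" "star y = y"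
    using pos_selfadjoint[OF assms(1)] pos_selfadjoint[OF assms(2)] by (simp_all add: selfadjoint_def)
  have sq: "pos_powr x 2 = x * x" "pos_powr y 2 = y * y"
    using pos_powr_add[of x 1 1] pos_powr_add[of y 1 1] assms by simp_all
  have "pairing (pos_powr x 2) (pos_powr y 2) = norm (x * (y * y) * x)"
    using assms unfolding sq by (intro pairing_eq square_pos) auto
  also have "\<dots> = norm (star (y * x) * (y * x))"
    by (simp add: star_mult star mult.assoc)
  also have "\<dots> = (norm (y * x))\<^sup>2" by (rule cstar_identity)
  also have "norm (y * x) = norm (star (y * x))" by simp
  also have "star (y * x) = x * y"
    by (simp add: star_mult star)
  finally show ?thesis by simp
qed

lemma norm_powr_mean:
  assumes x: "x \<in> pos_cone" and y: "y \<in> pos_cone" and p: "p > 0"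
  shows "norm (pos_powr (pos_powr x (p/2) * pos_powr y p * pos_powr x (p/2)) (1/p))
    = pairing (pos_powr x p) (pos_powr y p) powr (1/p)"
proof -
  have xp: "pos_powr x (p/2) \<in> pos_cone" and yp: "pos_powr y p \<in> pos_cone" using x y p by (simp_all add: pos_powr_pos)
  have "pos_root (pos_powr x p) = pos_powr x (p/2)" using x p by (simp add: pos_powr_powr)
  moreover have "pos_powr x (p/2) * pos_powr y p * pos_powr x (p/2) \<in> pos_cone"
    using xp yp by (intro conj_selfadjoint_pos) auto
  ultimately show ?thesis using p by (simp add: norm_pos_powr pairing_def)
qed

text \<open>Conjugating \<open>\<phi>\<close> by the p-th power map gives a pairing-preserving
  \<open>\<psi>\<close>; it is injective because the pairing determines the order. Jordan
  isomorphisms commute with powers, so \<open>\<psi>\<close> = J leads back to \<open>\<phi>\<close>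
  = J.\<close>

lemma pairing_powr_preserving_iff_jordan:
  fixes \<phi> :: "'a::unital_cstar_algebra \<Rightarrow> 'b::unital_cstar_algebra"
  assumes p: "p > 0" and surj: "\<phi> ` pos_cone = pos_cone"
  shows "(\<exists>J. jordan_star_iso J \<and> (\<forall>x\<in>pos_cone. \<phi> x = J x)) \<longleftrightarrow>
    (\<forall>x\<in>pos_cone. \<forall>y\<in>pos_cone.
      pairing (pos_powr (\<phi> x) p) (pos_powr (\<phi> y) p) = pairing (pos_powr x p) (pos_powr y p))"
  (is "?L \<longleftrightarrow> ?R")
proof
  assume ?L
  then obtain J where J: "jordan_star_iso J" "\<And>x. x \<in> pos_cone \<Longrightarrow> \<phi> x = J x" by blast
  interpret jordan_iso J by unfold_locales fact
  show ?R using p by (simp add: J(2) pos_powr_pos pairing flip: pos_powr)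
next
  assume R: ?R
  have \<phi>pos: "\<phi> x \<in> pos_cone" if "x \<in> pos_cone" for x using surj that by blast
  have cancel: "pos_powr (pos_powr x (1/p)) p = x" "pos_powr (pos_powr x p) (1/p) = x"
    if "x \<in> pos_cone" for x :: "'c::unital_cstar_algebra"
    using that p by (simp_all add: pos_powr_powr)
  have root: "pos_powr x (1/p) \<in> pos_cone" "pos_powr x p \<in> pos_cone"
    if "x \<in> pos_cone" for x :: "'c::unital_cstar_algebra"
    using that p by (simp_all add: pos_powr_pos)
  define \<psi> where "\<psi> x = pos_powr (\<phi> (pos_powr x (1/p))) p" for x
  have \<psi>pos: "\<psi> x \<in> pos_cone" if "x \<in> pos_cone" for x using that by (simp add: \<psi>_def root \<phi>pos)
  have pair: "pairing (\<psi> x) (\<psi> y) = pairing x y" if "x \<in> pos_cone" "y \<in> pos_cone" for x y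
    using R root[OF that(1)] root[OF that(2)] that by (simp add: \<psi>_def cancel)
  have surj\<psi>: "\<exists>x\<in>pos_cone. \<psi> x = y" if y: "y \<in> pos_cone" for y
  proof -
    obtain x where "x \<in> pos_cone" "\<phi> x = pos_powr y (1/p)" using surj root(1)[OF y] by (metis imageE)
    then show ?thesis using y by (intro bexI[of _ "pos_powr x p"]) (simp_all add: \<psi>_def cancel root)
  qed
  have le: "x \<preceq> y" if xy: "x \<in> pos_cone" "y \<in> pos_cone" "\<psi> x = \<psi> y" for x y
  proof -
    have "pairing x z \<le> pairing y z" if "z \<in> pos_inv" for z
      using pair[of x z] pair[of y z] xy pos_invD(1)[OF that] by simp
    then show ?thesis using xy by (simp add: pos_le_iff_pairing)
  qed
  have inj: "inj_on \<psi> pos_cone" by (rule inj_onI) (blast intro: pos_le_antisym le sym)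
  have img: "\<psi> ` pos_cone = pos_cone" using \<psi>pos surj\<psi> by (auto simp: image_iff)
  define \<psi>' where "\<psi>' = inv_into pos_cone \<psi>"
  interpret cone_iso \<psi> \<psi>'
  proof
    show "\<psi>' y \<in> pos_cone" if "y \<in> pos_cone" for y
      unfolding \<psi>'_def using img that by (metis inv_into_into)
    show "\<psi>' (\<psi> x) = x" if "x \<in> pos_cone" for x unfolding \<psi>'_def using inj that by simp
    show "\<psi> (\<psi>' y) = y" if "y \<in> pos_cone" for y unfolding \<psi>'_def using img that by (metis f_inv_into_f)
  qed (use \<psi>pos pair in auto)
  obtain J where J: "jordan_star_iso J" "\<And>x. x \<in> pos_cone \<Longrightarrow> \<psi> x = J x"
    using jordan_star_iso_exists by blast
  interpret J: jordan_iso J by unfold_locales fact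
  have "\<phi> x = J x" if x: "x \<in> pos_cone" for x
  proof -
    have "pos_powr (\<phi> x) p = J (pos_powr x p)" using J(2)[OF root(2)[OF x]] x by (simp add: \<psi>_def cancel)
    then have "pos_powr (pos_powr (\<phi> x) p) (1/p) = pos_powr (pos_powr (J x) p) (1/p)"
      using x p by (simp add: J.pos_powr)
    then show ?thesis using x by (simp add: cancel \<phi>pos J.pos)
  qed
  then show ?L using J(1) by blast
qed

theorem theorem5p5:
  fixes \<phi> :: "'a::unital_cstar_algebra \<Rightarrow> 'b::unital_cstar_algebra"
    and p :: real
  assumes "p > 0"
    and "\<phi> ` pos_cone = pos_cone"
  shows
    "let
       i = (\<exists>J. jordan_star_iso J \<and> (\<forall>x\<in>pos_cone. \<phi> x = J x));
       ii = (\<forall>x\<in>pos_cone. \<forall>y\<in>pos_cone. norm (\<phi> x * \<phi> y) = norm (x * y));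
       iii = (\<forall>x\<in>pos_cone. \<forall>y\<in>pos_cone.
                spectral_seminorm (\<phi> x * \<phi> y) = spectral_seminorm (x * y));
       iv = (\<forall>x\<in>pos_cone. \<forall>y\<in>pos_cone. spectrum (\<phi> x * \<phi> y) = spectrum (x * y));
       v = (\<forall>x\<in>pos_cone. \<forall>y\<in>pos_cone.
              norm (pos_powr (pos_powr (\<phi> x) (p/2) * pos_powr (\<phi> y) p * pos_powr (\<phi> x) (p/2)) (1/p))
              = norm (pos_powr (pos_powr x (p/2) * pos_powr y p * pos_powr x (p/2)) (1/p)))
     in (i \<longleftrightarrow> ii) \<and> (i \<longleftrightarrow> iii) \<and> (i \<longleftrightarrow> iv) \<and> (i \<longleftrightarrow> v)"
proof -
  have \<phi>: "\<phi> x \<in> pos_cone" if "x \<in> pos_cone" for x using assms(2) that by blast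
  define i where "i \<longleftrightarrow> (\<exists>J. jordan_star_iso J \<and> (\<forall>x\<in>pos_cone. \<phi> x = J x))"
  define iii where "iii \<longleftrightarrow> (\<forall>x\<in>pos_cone. \<forall>y\<in>pos_cone.
    spectral_seminorm (\<phi> x * \<phi> y) = spectral_seminorm (x * y))"
  define iv where "iv \<longleftrightarrow> (\<forall>x\<in>pos_cone. \<forall>y\<in>pos_cone. spectrum (\<phi> x * \<phi> y) = spectrum (x * y))"
  note iff = pairing_powr_preserving_iff_jordan[OF _ assms(2), folded i_def]
  have "norm (\<phi> x * \<phi> y) = norm (x * y) \<longleftrightarrow>
      pairing (pos_powr (\<phi> x) 2) (pos_powr (\<phi> y) 2) = pairing (pos_powr x 2) (pos_powr y 2)"
    if "x \<in> pos_cone" "y \<in> pos_cone" for x y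
    using that \<phi> by (simp flip: norm_mult_eq_pairing add: power2_eq_iff_nonneg)
  then have ii: "i \<longleftrightarrow> (\<forall>x\<in>pos_cone. \<forall>y\<in>pos_cone. norm (\<phi> x * \<phi> y) = norm (x * y))"
    using iff[of 2] by simp
  have iii: "i \<longleftrightarrow> iii"
    unfolding iii_def using iff[of 1] \<phi> by (simp add: spectral_seminorm_mult_pos)
  have iv: "i \<longleftrightarrow> iv"
  proof
    assume i
    then obtain J where "jordan_iso J" "\<And>x. x \<in> pos_cone \<Longrightarrow> \<phi> x = J x"
      unfolding i_def jordan_iso_def by blast
    then show iv by (simp add: iv_def jordan_iso.spectrum_mult)
  next
    \<comment> \<open>The spectral seminorm is a function of the spectrum, so (iv) gives (iii), and
      (iii) is already known to give (i).\<close>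
    assume iv
    then have iii by (simp add: iv_def iii_def spectral_seminorm_def)
    then show i using iii by simp
  qed
  \<comment> \<open>Strict monotonicity lets the outer exponent 1/p of (v) be cancelled, which
    leaves the pairing of p-th powers.\<close>
  have "a powr (1/p) = b powr (1/p) \<longleftrightarrow> a = b" if "0 \<le> a" "0 \<le> b" for a b :: real
    using that assms(1) powr_less_mono2[of "1/p" a b] powr_less_mono2[of "1/p" b a] by (cases a b rule: linorder_cases) auto
  then have v: "i \<longleftrightarrow> (\<forall>x\<in>pos_cone. \<forall>y\<in>pos_cone.
      norm (pos_powr (pos_powr (\<phi> x) (p/2) * pos_powr (\<phi> y) p * pos_powr (\<phi> x) (p/2)) (1/p))
      = norm (pos_powr (pos_powr x (p/2) * pos_powr y p * pos_powr x (p/2)) (1/p)))"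
    using iff[OF assms(1)] \<phi> by (simp add: norm_powr_mean assms(1))
  show ?thesis
    unfolding Let_def using ii iii iv v unfolding i_def iii_def iv_def by blast
qed

end
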